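(* For every integer $k \geq 1$, there exists a finite, connected, loopless multigraph $G_k$ such that $\operatorname{dgon}(G_k) = 6k$ and $\operatorname{dgon}(\Gamma(G_k)) = \operatorname{dgon}(\sigma_2(G_k)) = 5k$. Furthermore, $G_k$ can be chosen simple and bipartite.
   Context: A divisor on a finite connected loopless multigraph $G$ is a formal sum $\sum_{v\in V(G)} a_v v$ with $a_v\in\mathbb{Z}$; degree and effectivity are as usual. With $L_G$ the Laplacian matrix, principal divisors are $L_G x$ for $x\in\mathbb{Z}^{V(G)}$, and divisors are equivalent if their difference is principal. The rank of $D$ is the largest $k$ such that $D-E$ is equivalent to an effective divisor for all effective $E$ of degree $k$ ($-1$ if $D$ is not equivalent to an effective divisor). The divisorial gonality $\operatorname{dgon}(G)$ is the minimum degree of a divisor of rank $1$. $\sigma_2(G)$ is the graph obtained by subdividing each edge of $G$ once (into two edges). $\Gamma(G)$ is the metric graph obtained by replacing each edge of $G$ by a unit interval glued at the endpoints. Divisors on $\Gamma(G)$ are finitely supported $\mathbb{Z}$-combinations of points; a rational function is a continuous piecewise linear function with integer slopes, its principal divisor assigns to each point the sum of outgoing slopes there; equivalence, rank and $\operatorname{dgon}(\Gamma(G))$ (minimum degree of a rank-$1$ divisor) are defined analogously. *)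

theory Defs
  imports Complex_Main "HOL-Library.Poly_Mapping" "Graph_Theory.Digraph_Component"
begin

section \<open>Multigraphs\<close>

text \<open>
  An undirected multigraph is encoded as a pre_digraph in which every edge is exactly one arc: the
  choice of which endpoint of an edge is its tail and which is its head is an arbitrary reference
  orientation, needed to parametrise the edges of the metric graph. (This differs from the
  symmetric digraphs of Graph_Theory, where an edge is a pair of opposite arcs.) The predicate
  connected below is the one of Graph_Theory, which passes to the symmetric closure and requires
  a nonempty vertex set.
\<close>

definition multigraph :: "('a, 'b) pre_digraph \<Rightarrow> bool" where
  "multigraph G \<longleftrightarrow> fin_digraph G \<and> loopfree_digraph G \<and> Digraph_Component.connected G"

definition edge_ends :: "('a, 'b) pre_digraph \<Rightarrow> 'b \<Rightarrow> 'a set" where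
  "edge_ends G e = {tail G e, head G e}"

definition simple_multigraph :: "('a, 'b) pre_digraph \<Rightarrow> bool" where
  "simple_multigraph G \<longleftrightarrow>
     (\<forall>e\<in>arcs G. tail G e \<noteq> head G e) \<and> inj_on (edge_ends G) (arcs G)"

definition bipartite :: "('a, 'b) pre_digraph \<Rightarrow> bool" where
  "bipartite G \<longleftrightarrow> (\<exists>A B. A \<union> B = verts G \<and> A \<inter> B = {} \<and>
     (\<forall>e\<in>arcs G. \<exists>a\<in>A. \<exists>b\<in>B. edge_ends G e = {a, b}))"

text \<open>
  In the subdivision, the vertex Inr e is the midpoint of the edge e, and the edges (e, False),
  (e, True) are the halves of e at its tail and at its head.
\<close>

definition subdivide2 :: "('a, 'b) pre_digraph \<Rightarrow> ('a + 'b, 'b \<times> bool) pre_digraph" where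
  "subdivide2 G =
     \<lparr> verts = Inl ` verts G \<union> Inr ` arcs G,
       arcs = arcs G \<times> UNIV,
       tail = (\<lambda>(e, h). if h then Inr e else Inl (tail G e)),
       head = (\<lambda>(e, h). if h then Inl (head G e) else Inr e) \<rparr>"


section \<open>Divisors, rank and gonality\<close>

text \<open>
  The notions common to graphs and metric graphs, for divisors supported on a set X of points and
  a set P of principal divisors.
\<close>

type_synonym 'p divisor = "'p \<Rightarrow>\<^sub>0 int"

definition divisors_on :: "'p set \<Rightarrow> 'p divisor set" where
  "divisors_on X = {D. Poly_Mapping.keys D \<subseteq> X}"

definition divisor_degree :: "'p divisor \<Rightarrow> int" where
  "divisor_degree D = (\<Sum>p\<in>Poly_Mapping.keys D. Poly_Mapping.lookup D p)"

definition effective :: "'p divisor \<Rightarrow> bool" where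
  "effective D \<longleftrightarrow> (\<forall>p. Poly_Mapping.lookup D p \<ge> 0)"

definition equiv_effective :: "'p set \<Rightarrow> 'p divisor set \<Rightarrow> 'p divisor \<Rightarrow> bool" where
  "equiv_effective X P D \<longleftrightarrow> (\<exists>D'\<in>divisors_on X. effective D' \<and> D - D' \<in> P)"

definition divisor_rank :: "'p set \<Rightarrow> 'p divisor set \<Rightarrow> 'p divisor \<Rightarrow> int" where
  "divisor_rank X P D =
     (if equiv_effective X P D
      then int (GREATEST k. \<forall>E\<in>divisors_on X.
             effective E \<and> divisor_degree E = int k \<longrightarrow> equiv_effective X P (D - E))
      else - 1)"

definition gonality :: "'p set \<Rightarrow> 'p divisor set \<Rightarrow> nat" where
  "gonality X P =
     (LEAST d. \<exists>D\<in>divisors_on X. divisor_rank X P D = 1 \<and> divisor_degree D = int d)"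


section \<open>Divisorial gonality of a graph\<close>

definition laplacian :: "('a, 'b) pre_digraph \<Rightarrow> 'a \<Rightarrow> 'a \<Rightarrow> int" where
  "laplacian G u v =
     (if u = v then int (card {e \<in> arcs G. u \<in> edge_ends G e})
      else - int (card {e \<in> arcs G. edge_ends G e = {u, v}}))"

definition principal_divisors :: "('a, 'b) pre_digraph \<Rightarrow> 'a divisor set" where
  "principal_divisors G =
     {D \<in> divisors_on (verts G).
        \<exists>x :: 'a \<Rightarrow> int. \<forall>u\<in>verts G.
          Poly_Mapping.lookup D u = (\<Sum>v\<in>verts G. laplacian G u v * x v)}"

definition dgon :: "('a, 'b) pre_digraph \<Rightarrow> nat" where
  "dgon G = gonality (verts G) (principal_divisors G)"


section \<open>Divisorial gonality of the metric graph\<close>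

text \<open>
  Interior e t is the point of the edge e at distance t from its tail, where 0 < t < 1; the
  endpoints of the unit interval of e are glued to the vertices by edge_point.
\<close>

datatype ('a, 'b) metric_point = Vertex 'a | Interior 'b real

definition metric_points :: "('a, 'b) pre_digraph \<Rightarrow> ('a, 'b) metric_point set" where
  "metric_points G =
     Vertex ` verts G \<union> {Interior e t | e t. e \<in> arcs G \<and> 0 < t \<and> t < 1}"

definition edge_point :: "('a, 'b) pre_digraph \<Rightarrow> 'b \<Rightarrow> real \<Rightarrow> ('a, 'b) metric_point" where
  "edge_point G e t =
     (if t = 0 then Vertex (tail G e) else if t = 1 then Vertex (head G e) else Interior e t)"

text \<open>
  Continuous piecewise linear with integer slopes on the unit interval; S contains the
  breakpoints.
\<close>

definition integer_piecewise_linear :: "(real \<Rightarrow> real) \<Rightarrow> bool" where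
  "integer_piecewise_linear g \<longleftrightarrow>
     continuous_on {0..1} g \<and>
     (\<exists>S. finite S \<and>
       (\<forall>a b. 0 \<le> a \<and> a < b \<and> b \<le> 1 \<and> {a<..<b} \<inter> S = {} \<longrightarrow>
         (\<exists>(m :: int) c. \<forall>t\<in>{a<..<b}. g t = of_int m * t + c)))"

text \<open>
  The topology of the metric graph is the quotient topology of the disjoint union of the edges
  (and the vertices), so continuity is tested edge by edge.
\<close>

definition rational_function ::
    "('a, 'b) pre_digraph \<Rightarrow> (('a, 'b) metric_point \<Rightarrow> real) \<Rightarrow> bool" where
  "rational_function G f \<longleftrightarrow>
     (\<forall>e\<in>arcs G. integer_piecewise_linear (\<lambda>t. f (edge_point G e t)))"

definition forward_slope :: "(real \<Rightarrow> real) \<Rightarrow> real \<Rightarrow> real" where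
  "forward_slope g t = Lim (at_right 0) (\<lambda>h. (g (t + h) - g t) / h)"

definition backward_slope :: "(real \<Rightarrow> real) \<Rightarrow> real \<Rightarrow> real" where
  "backward_slope g t = Lim (at_right 0) (\<lambda>h. (g (t - h) - g t) / h)"

fun outgoing_slopes ::
    "('a, 'b) pre_digraph \<Rightarrow> (('a, 'b) metric_point \<Rightarrow> real) \<Rightarrow> ('a, 'b) metric_point \<Rightarrow> real" where
  "outgoing_slopes G f (Vertex v) =
     (\<Sum>e\<in>out_arcs G v. forward_slope (\<lambda>t. f (edge_point G e t)) 0) +
     (\<Sum>e\<in>in_arcs G v. backward_slope (\<lambda>t. f (edge_point G e t)) 1)"
| "outgoing_slopes G f (Interior e t) =
     forward_slope (\<lambda>s. f (edge_point G e s)) t + backward_slope (\<lambda>s. f (edge_point G e s)) t"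

definition metric_principal_divisors ::
    "('a, 'b) pre_digraph \<Rightarrow> ('a, 'b) metric_point divisor set" where
  "metric_principal_divisors G =
     {D \<in> divisors_on (metric_points G).
        \<exists>f. rational_function G f \<and>
          (\<forall>p\<in>metric_points G. of_int (Poly_Mapping.lookup D p) = outgoing_slopes G f p)}"

definition metric_dgon :: "('a, 'b) pre_digraph \<Rightarrow> nat" where
  "metric_dgon G = gonality (metric_points G) (metric_principal_divisors G)"

end

theory Submission
  imports Defs "HOL-Library.Countable"
begin

text \<open>
  The graph consists of three blobs arranged in a cycle together with a hub. Each blob has 2k ports
  that fewer than 6k chips cannot separate; consecutive blobs are joined by k thin edges between
  ports, each port lying on exactly one thin edge, and 2k spokes lead from the hub to each blob.

  On the subdivision, put a chip on the midpoint of every thin edge and 2k chips on the hub. Pushing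
  towards a blob uses the 2k chips on its thin edges, which arrive at its ports, and the 2k chips of the
  hub, which arrive in the middle of its spokes. These are 5k chips, and the midpoint of a thin edge
  serves both of its ends. On the graph itself a thin edge between two blobs that both need to be pushed
  into must carry a chip at each end, which costs k more.

  For the lower bounds, the effective divisors equivalent to a given one are closed under taking
  maxima of the underlying functions. So one may pass to a divisor from which every port without a
  chip is reached by firing a set that contains the hub. Such a set cannot separate the ports of a
  blob, and cuts separating the hub from two blobs have at least 6k edges; hence it contains exactly
  the ports of the other two blobs. Counting the chips on its boundary gives 5k, and 6k if no chip lies
  in the interior of an edge. The same count applies to graphs and to metric graphs. The upper bound
  for the metric graph and the lower bound for the subdivision both follow because positive rank on the
  subdivision implies positive rank on the metric graph.
\<close>

section \<open>Divisors and chip firing\<close>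

text \<open>The gap of \<open>k\<close> is a matter of parity. Call a blob deficient if one of its
  ports has no chip. When chips lie on vertices only, a thin edge gets by with a single chip at its
  two ends only if exactly one of its two blobs is deficient. On a cycle of three blobs the
  deficient ones cannot alternate with the others, so some bundle of \<open>k\<close> thin edges
  joins blobs of equal status and carries \<open>2 * k\<close> chips; a chip in the interior of an
  edge escapes this. The \<open>2 * k\<close> spokes per blob balance the cuts. Cutting off one blob
  costs \<open>2 * k\<close> spokes and \<open>2 * k\<close> thin edges, which fewer than
  \<open>6 * k\<close> chips can afford; cutting off two blobs costs \<open>4 * k\<close> spokes and
  \<open>2 * k\<close> thin edges, and cutting off all three costs \<open>6 * k\<close> spokes. So
  fewer than \<open>6 * k\<close> chips can cut off single blobs only. The rank itself is hardly
  ever handled: a divisor of least degree among those of rank at least 1 has rank exactly 1, so only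
  witnesses for single points have to be studied.\<close>

abbreviation chips :: "'p divisor \<Rightarrow> 'p \<Rightarrow> int" where
  "chips \<equiv> Poly_Mapping.lookup"

lemma divisor_degree_eq_sum:
  assumes "finite K" "Poly_Mapping.keys D \<subseteq> K"
  shows "divisor_degree D = (\<Sum>p\<in>K. chips D p)"
  unfolding divisor_degree_def using assms
  by (intro sum.mono_neutral_left) (auto simp: in_keys_iff)

lemma divisor_degree_add: "divisor_degree (D + E) = divisor_degree D + divisor_degree E"
proof -
  let ?K = "Poly_Mapping.keys D \<union> Poly_Mapping.keys E"
  have "divisor_degree (D + E) = (\<Sum>p\<in>?K. chips (D + E) p)"
    using Poly_Mapping.keys_add[of D E] by (intro divisor_degree_eq_sum) auto
  also have "\<dots> = (\<Sum>p\<in>?K. chips D p) + (\<Sum>p\<in>?K. chips E p)"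
    by (simp add: lookup_add sum.distrib)
  also have "\<dots> = divisor_degree D + divisor_degree E"
    by (simp add: divisor_degree_eq_sum[of ?K])
  finally show ?thesis .
qed

lemma divisor_degree_zero [simp]: "divisor_degree 0 = 0"
  by (simp add: divisor_degree_def)

lemma divisor_degree_diff: "divisor_degree (D - E) = divisor_degree D - divisor_degree E"
  using divisor_degree_add[of "D - E" E] by simp

lemma divisor_degree_single [simp]: "divisor_degree (Poly_Mapping.single p n) = n"
  by (simp add: divisor_degree_def)

lemma divisors_on_add: "D \<in> divisors_on X \<Longrightarrow> E \<in> divisors_on X \<Longrightarrow> D + E \<in> divisors_on X"
  using Poly_Mapping.keys_add[of D E] by (auto simp: divisors_on_def)

lemma divisors_on_diff: "D \<in> divisors_on X \<Longrightarrow> E \<in> divisors_on X \<Longrightarrow> D - E \<in> divisors_on X"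
  using keys_diff[of D E] by (auto simp: divisors_on_def)

lemma divisors_on_single: "p \<in> X \<Longrightarrow> Poly_Mapping.single p n \<in> divisors_on X"
  by (auto simp: divisors_on_def)

lemma lookup_not_on: "D \<in> divisors_on X \<Longrightarrow> p \<notin> X \<Longrightarrow> chips D p = 0"
  by (auto simp: divisors_on_def in_keys_iff)

lemma divisors_on_eqI:
  assumes "D \<in> divisors_on X" "E \<in> divisors_on X"
    and "\<And>p. p \<in> X \<Longrightarrow> chips D p = chips E p"
  shows "D = E"
proof (rule poly_mapping_eqI)
  fix p show "chips D p = chips E p"
    by (cases "p \<in> X") (simp_all add: assms lookup_not_on[OF assms(1)] lookup_not_on[OF assms(2)])
qed

lemma divisor_of_function:
  fixes d :: "'p \<Rightarrow> int"
  assumes "finite K"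
  shows "\<exists>D\<in>divisors_on K. (\<forall>p. chips D p = (if p \<in> K then d p else 0)) \<and>
    divisor_degree D = (\<Sum>p\<in>K. d p)"
proof -
  let ?D = "Abs_poly_mapping (\<lambda>p. if p \<in> K then d p else 0)"
  have "finite {p. (if p \<in> K then d p else 0) \<noteq> 0}"
    by (rule finite_subset[OF _ assms]) auto
  then have lk: "chips ?D p = (if p \<in> K then d p else 0)" for p
    by (simp add: Abs_poly_mapping_inverse)
  then have on: "Poly_Mapping.keys ?D \<subseteq> K"
    by (auto simp: in_keys_iff split: if_splits)
  have "divisor_degree ?D = (\<Sum>p\<in>K. d p)"
    by (subst divisor_degree_eq_sum[OF assms on]) (simp add: lk)
  with on lk show ?thesis by (auto simp: divisors_on_def)
qed

lemma divisor_push_forward: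
  assumes inj: "inj \<phi>" and V: "finite V" "D \<in> divisors_on V"
  shows "\<exists>D'\<in>divisors_on (\<phi> ` V). divisor_degree D' = divisor_degree D \<and>
    (\<forall>v\<in>V. chips D' (\<phi> v) = chips D v)"
proof -
  let ?d = "\<lambda>p. chips D (the_inv \<phi> p)"
  have inv: "the_inv \<phi> (\<phi> v) = v" for v by (rule the_inv_f_f[OF inj])
  obtain D' where D': "D' \<in> divisors_on (\<phi> ` V)"
    "\<forall>p. chips D' p = (if p \<in> \<phi> ` V then ?d p else 0)"
    "divisor_degree D' = (\<Sum>p\<in>\<phi> ` V. ?d p)"
    using divisor_of_function[OF finite_imageI[OF V(1)], of \<phi> ?d] by blast
  have "(\<Sum>p\<in>\<phi> ` V. ?d p) = (\<Sum>v\<in>V. chips D v)"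
    by (subst sum.reindex) (simp_all add: inv inj_on_subset[OF inj])
  also have "\<dots> = divisor_degree D"
    using V by (intro divisor_degree_eq_sum[symmetric]) (auto simp: divisors_on_def)
  finally show ?thesis using D' by (auto simp: inv)
qed

lemma effective_degree_ge_sum:
  assumes "effective D" "finite K"
  shows "(\<Sum>p\<in>K. chips D p) \<le> divisor_degree D"
proof -
  have "(\<Sum>p\<in>K. chips D p) \<le> (\<Sum>p\<in>K \<union> Poly_Mapping.keys D. chips D p)"
    using assms by (intro sum_mono2) (auto simp: effective_def)
  also have "\<dots> = divisor_degree D"
    using assms by (intro divisor_degree_eq_sum[symmetric]) auto
  finally show ?thesis .
qed

lemma effective_degree_nonneg: "effective D \<Longrightarrow> 0 \<le> divisor_degree D"
  using effective_degree_ge_sum[of D "{}"] by simp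

text \<open>Covers graphs (integer-valued functions) and metric graphs (real-valued rational
  functions) at once. \<open>dv f p\<close> has the sign of outgoing slopes, that is, it is the
  number of chips that \<open>p\<close> gains. \<open>dv_mono\<close> is the maximum principle for
  two functions touching at \<open>p\<close>; \<open>dv_divisor\<close> packages finite support and
  degree zero.\<close>

locale chip_firing =
  fixes X :: "'p set"
    and F :: "('p \<Rightarrow> 'r::linordered_idom) set"
    and dv :: "('p \<Rightarrow> 'r) \<Rightarrow> 'p \<Rightarrow> int"
  assumes X_nonempty: "X \<noteq> {}"
    and const_in: "(\<lambda>_. c) \<in> F"
    and diff_in: "f \<in> F \<Longrightarrow> g \<in> F \<Longrightarrow> (\<lambda>p. f p - g p) \<in> F"
    and max_in: "f \<in> F \<Longrightarrow> g \<in> F \<Longrightarrow> (\<lambda>p. max (f p) (g p)) \<in> F"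
    and dv_const: "p \<in> X \<Longrightarrow> dv (\<lambda>_. c) p = 0"
    and dv_diff: "f \<in> F \<Longrightarrow> g \<in> F \<Longrightarrow> p \<in> X \<Longrightarrow> dv (\<lambda>p. f p - g p) p = dv f p - dv g p"
    and dv_mono: "f \<in> F \<Longrightarrow> g \<in> F \<Longrightarrow> p \<in> X \<Longrightarrow> f p = g p \<Longrightarrow>
      (\<And>q. q \<in> X \<Longrightarrow> f q \<le> g q) \<Longrightarrow> dv f p \<le> dv g p"
    and dv_divisor: "f \<in> F \<Longrightarrow> \<exists>D\<in>divisors_on X. divisor_degree D = 0 \<and>
      (\<forall>p\<in>X. chips D p = dv f p)"
begin

definition principal :: "'p divisor set" where
  "principal = {D \<in> divisors_on X. \<exists>f\<in>F. \<forall>p\<in>X. chips D p = dv f p}"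

text \<open>Rank at least 1, stated through functions instead of equivalent divisors so that
  witnesses can be combined by pointwise maxima. The bound at the points other than \<open>q\<close>
  is effectivity.\<close>

definition positive_rank :: "'p divisor \<Rightarrow> bool" where
  "positive_rank D \<longleftrightarrow>
     (\<forall>q\<in>X. \<exists>f\<in>F. \<forall>p\<in>X. chips D p + dv f p \<ge> (if p = q then 1 else 0))"

lemma minus_in: "f \<in> F \<Longrightarrow> (\<lambda>p. - f p) \<in> F"
  using diff_in[OF const_in[of 0], of f] by simp

lemma add_in: "f \<in> F \<Longrightarrow> g \<in> F \<Longrightarrow> (\<lambda>p. f p + g p) \<in> F"
  using diff_in[OF _ minus_in, of f g] by simp

lemma dv_minus: "f \<in> F \<Longrightarrow> p \<in> X \<Longrightarrow> dv (\<lambda>p. - f p) p = - dv f p"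
  using dv_diff[OF const_in[of 0], of f p] by (simp add: dv_const)

lemma dv_add: "f \<in> F \<Longrightarrow> g \<in> F \<Longrightarrow> p \<in> X \<Longrightarrow> dv (\<lambda>p. f p + g p) p = dv f p + dv g p"
  using dv_diff[OF _ minus_in, of f g p] by (simp add: dv_minus)

lemma principal_divisors_on: "D \<in> principal \<Longrightarrow> D \<in> divisors_on X"
  by (simp add: principal_def)

lemma dv_principal:
  assumes "f \<in> F"
  obtains D where "D \<in> principal" "\<And>p. p \<in> X \<Longrightarrow> chips D p = dv f p"
  using dv_divisor[OF assms] assms by (auto simp: principal_def)

lemma principal_degree:
  assumes "D \<in> principal" shows "divisor_degree D = 0"
proof -
  obtain f where f: "f \<in> F" "\<forall>p\<in>X. chips D p = dv f p"
    and D: "D \<in> divisors_on X"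
    using assms by (auto simp: principal_def)
  obtain E where E: "E \<in> divisors_on X" "divisor_degree E = 0"
    "\<forall>p\<in>X. chips E p = dv f p"
    using dv_divisor[OF f(1)] by blast
  have "D = E" using D E f by (intro divisors_on_eqI[of _ X]) auto
  with E show ?thesis by simp
qed

text \<open>\<open>equiv_effective\<close> subtracts the effective divisor while the right-hand side
  adds the principal one, hence the change of sign between the two witnesses.\<close>

lemma equiv_effective_iff:
  assumes D: "D \<in> divisors_on X"
  shows "equiv_effective X principal D \<longleftrightarrow>
    (\<exists>f\<in>F. \<forall>p\<in>X. chips D p + dv f p \<ge> 0)"
proof
  assume "equiv_effective X principal D"
  then obtain D' f where D': "effective D'" "D' \<in> divisors_on X" and f: "f \<in> F"
    "\<forall>p\<in>X. chips (D - D') p = dv f p"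
    unfolding equiv_effective_def principal_def by auto
  have "chips D p + dv (\<lambda>p. - f p) p \<ge> 0" if "p \<in> X" for p
  proof -
    have "chips D p - chips D' p = dv f p"
      using f(2) that by (simp add: lookup_minus)
    moreover have "chips D' p \<ge> 0" using D' by (simp add: effective_def)
    ultimately show ?thesis using dv_minus[OF f(1) that] by linarith
  qed
  then show "\<exists>f\<in>F. \<forall>p\<in>X. chips D p + dv f p \<ge> 0"
    using minus_in[OF f(1)] by blast
next
  assume "\<exists>f\<in>F. \<forall>p\<in>X. chips D p + dv f p \<ge> 0"
  then obtain f where f: "f \<in> F" "\<forall>p\<in>X. chips D p + dv f p \<ge> 0" by blast
  obtain P where P: "P \<in> principal" "\<And>p. p \<in> X \<Longrightarrow> chips P p = dv (\<lambda>p. - f p) p"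
    using dv_principal[OF minus_in[OF f(1)]] by blast
  have on: "D - P \<in> divisors_on X"
    using D P by (intro divisors_on_diff) (auto simp: principal_def)
  have "effective (D - P)"
    unfolding effective_def
  proof
    fix p show "0 \<le> chips (D - P) p"
    proof (cases "p \<in> X")
      case True then show ?thesis using f P(2) dv_minus[OF f(1)] by (simp add: lookup_minus)
    next
      case False then show ?thesis using lookup_not_on[OF on False] by simp
    qed
  qed
  then show "equiv_effective X principal D"
    unfolding equiv_effective_def using on P by (intro bexI[of _ "D - P"]) auto
qed

lemma equiv_effective_degree:
  assumes "equiv_effective X principal D" shows "0 \<le> divisor_degree D"
proof -
  obtain D' where D': "effective D'" "D - D' \<in> principal"
    using assms by (auto simp: equiv_effective_def)
  then show ?thesis
    using principal_degree[OF D'(2)] effective_degree_nonneg[OF D'(1)] divisor_degree_diff[of D D'] by simp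
qed

lemma positive_rank_iff:
  assumes "D \<in> divisors_on X"
  shows "positive_rank D \<longleftrightarrow> (\<forall>q\<in>X. equiv_effective X principal (D - Poly_Mapping.single q 1))"
proof -
  have "(chips (D - Poly_Mapping.single q 1) p + dv f p \<ge> 0) \<longleftrightarrow>
     (chips D p + dv f p \<ge> (if p = q then 1 else 0))" for p q f
    by (auto simp: lookup_minus lookup_single)
  then show ?thesis
    using assms unfolding positive_rank_def
    by (simp add: equiv_effective_iff divisors_on_diff divisors_on_single)
qed

lemma effective_degree_1:
  assumes "effective E" "divisor_degree E = 1" "E \<in> divisors_on X"
  obtains q where "q \<in> X" "E = Poly_Mapping.single q 1"
proof -
  have "E \<noteq> 0" using assms(2) by auto
  then obtain q where q: "q \<in> Poly_Mapping.keys E" using keys_eq_empty[of E] by blast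
  then have q1: "chips E q \<ge> 1"
  proof -
    have "chips E q \<noteq> 0" using q by (simp add: in_keys_iff)
    moreover have "chips E q \<ge> 0" using assms(1) by (simp add: effective_def)
    ultimately show ?thesis by linarith
  qed
  have "chips E p = chips (Poly_Mapping.single q 1) p" for p
  proof (cases "p = q")
    case True
    have "chips E q \<le> 1"
      using effective_degree_ge_sum[OF assms(1), of "{q}"] assms(2) by simp
    then show ?thesis using q1 True by simp
  next
    case False
    have "chips E q + chips E p \<le> 1"
      using effective_degree_ge_sum[OF assms(1), of "{q,p}"] assms(2) False by simp
    moreover have "chips E p \<ge> 0" using assms(1) by (simp add: effective_def)
    ultimately show ?thesis using q1 False by (simp add: lookup_single)
  qed
  then have "E = Poly_Mapping.single q 1" by (intro poly_mapping_eqI)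
  moreover have "q \<in> X" using q assms(3) by (auto simp: divisors_on_def)
  ultimately show ?thesis using that by blast
qed

lemma effective_single: "n \<ge> 0 \<Longrightarrow> effective (Poly_Mapping.single q n)"
  by (simp add: effective_def lookup_single when_def)

section \<open>Rank and gonality in terms of positive rank\<close>

abbreviation rank_at_least :: "'p divisor \<Rightarrow> nat \<Rightarrow> bool" where
  "rank_at_least D k \<equiv> \<forall>E\<in>divisors_on X. effective E \<and> divisor_degree E = int k \<longrightarrow>
     equiv_effective X principal (D - E)"

text \<open>\<open>GREATEST\<close> is informative only for a bounded set of ranks. Placing all
  \<open>k\<close> chips of the test divisor on one point bounds \<open>k\<close> by the
  degree.\<close>

lemma rank_bounded:
  assumes "rank_at_least D k"
  shows "k \<le> nat (divisor_degree D)"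
proof -
  obtain q where q: "q \<in> X" using X_nonempty by blast
  have "equiv_effective X principal (D - Poly_Mapping.single q (int k))"
    using assms divisors_on_single[OF q, of "int k"] effective_single[of "int k" q] by simp
  from equiv_effective_degree[OF this] show ?thesis by (simp add: divisor_degree_diff)
qed

lemma rank_1_imp_positive_rank:
  assumes "D \<in> divisors_on X" "divisor_rank X principal D = 1"
  shows "positive_rank D"
proof -
  let ?Q = "rank_at_least D"
  have eff: "equiv_effective X principal D" and g: "(GREATEST k. ?Q k) = 1"
    using assms(2) by (auto simp: divisor_rank_def split: if_splits)
  have "?Q 0"
  proof (intro ballI impI)
    fix E assume "E \<in> divisors_on X" and E: "effective E \<and> divisor_degree E = int 0"
    have "chips E p = 0" for p
      using effective_degree_ge_sum[of E "{p}"] E by (auto simp: effective_def intro: antisym)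
    then have "E = 0" by (intro poly_mapping_eqI) simp
    with eff show "equiv_effective X principal (D - E)" by simp
  qed
  then have "?Q (GREATEST k. ?Q k)"
    by (rule GreatestI_nat) (rule rank_bounded)
  then have "?Q 1" using g by simp
  then show ?thesis
    unfolding positive_rank_iff[OF assms(1)] by (simp add: divisors_on_single effective_single)
qed

text \<open>If the rank were some \<open>k >= 2\<close>, then after setting aside
  \<open>k - 1\<close> chips at one point a further chip could still be demanded anywhere. The
  remainder would have positive rank and smaller degree, against minimality.\<close>

lemma positive_rank_imp_rank_1:
  assumes D: "D \<in> divisors_on X" "positive_rank D"
    and least: "\<And>D'. D' \<in> divisors_on X \<Longrightarrow> positive_rank D' \<Longrightarrow> divisor_degree D \<le> divisor_degree D'"
  shows "divisor_rank X principal D = 1"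
proof -
  let ?Q = "rank_at_least D"
  obtain q where q: "q \<in> X" using X_nonempty by blast
  obtain f where f: "f \<in> F" "\<forall>p\<in>X. chips D p + dv f p \<ge> (if p = q then 1 else 0)"
    using D q unfolding positive_rank_def by blast
  have "chips D p + dv f p \<ge> 0" if "p \<in> X" for p
  proof -
    have "(0::int) \<le> (if p = q then 1 else 0)" by simp
    also have "\<dots> \<le> chips D p + dv f p" using f(2) that by blast
    finally show ?thesis .
  qed
  with f(1) have eff: "equiv_effective X principal D"
    unfolding equiv_effective_iff[OF D(1)] by blast
  have Q1: "?Q 1"
  proof (intro ballI impI)
    fix E assume "E \<in> divisors_on X" "effective E \<and> divisor_degree E = int 1"
    then obtain q where "q \<in> X" "E = Poly_Mapping.single q 1"
      using effective_degree_1[of E] by auto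
    then show "equiv_effective X principal (D - E)"
      using D by (simp add: positive_rank_iff)
  qed
  have le: "k \<le> 1" if Qk: "?Q k" for k
  proof (rule ccontr)
    assume "\<not> k \<le> 1"
    then have k: "k \<ge> 2" by simp
    let ?E = "Poly_Mapping.single q (int (k - 1))"
    have on: "D - ?E \<in> divisors_on X"
      using D q by (intro divisors_on_diff divisors_on_single)
    have "positive_rank (D - ?E)"
      unfolding positive_rank_iff[OF on]
    proof
      fix p assume p: "p \<in> X"
      let ?E' = "?E + Poly_Mapping.single p 1"
      have "?E' \<in> divisors_on X" using p q by (intro divisors_on_add divisors_on_single)
      moreover have "effective ?E'" by (simp add: effective_def lookup_add lookup_single when_def)
      moreover have "divisor_degree ?E' = int k"
        using k by (simp add: divisor_degree_add of_nat_diff)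
      ultimately have "equiv_effective X principal (D - ?E')" using Qk by blast
      then show "equiv_effective X principal (D - ?E - Poly_Mapping.single p 1)"
        by (simp add: diff_diff_eq)
    qed
    from least[OF on this] k show False by (simp add: divisor_degree_diff)
  qed
  have "(GREATEST k. ?Q k) = 1"
    by (rule Greatest_equality) (use Q1 le in auto)
  then show ?thesis using eff by (simp add: divisor_rank_def)
qed

lemma gonality_eqI:
  assumes D: "D \<in> divisors_on X" "positive_rank D" "divisor_degree D = int d"
    and least: "\<And>D'. D' \<in> divisors_on X \<Longrightarrow> positive_rank D' \<Longrightarrow> int d \<le> divisor_degree D'"
  shows "gonality X principal = d"
  unfolding gonality_def
proof (rule Least_equality)
  show "\<exists>D\<in>divisors_on X. divisor_rank X principal D = 1 \<and> divisor_degree D = int d"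
    using D least by (intro bexI[of _ D] conjI positive_rank_imp_rank_1) auto
  show "d \<le> y" if "\<exists>D\<in>divisors_on X. divisor_rank X principal D = 1 \<and> divisor_degree D = int y" for y
    using that
  proof clarify
    fix D' assume D': "D' \<in> divisors_on X" "divisor_rank X principal D' = 1" "divisor_degree D' = int y"
    then show "d \<le> y" using least[OF D'(1) rank_1_imp_positive_rank[OF D'(1,2)]] by simp
  qed
qed

text \<open>At each point the maximum touches one of the two functions from above, so
  \<open>dv_mono\<close> compares it with that function.\<close>

lemma dv_max_ge:
  assumes "f \<in> F" "g \<in> F" "p \<in> X" "c + dv f p \<ge> 0" "c + dv g p \<ge> 0"
  shows "c + dv (\<lambda>p. max (f p) (g p)) p \<ge> 0"
proof (cases "f p \<ge> g p")
  case True
  have "dv f p \<le> dv (\<lambda>p. max (f p) (g p)) p"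
    using True assms by (intro dv_mono max_in) auto
  then show ?thesis using assms by simp
next
  case False
  have "dv g p \<le> dv (\<lambda>p. max (f p) (g p)) p"
    using False assms by (intro dv_mono max_in) auto
  then show ?thesis using assms by simp
qed

text \<open>The last clause, that the maximum is attained pointwise, fixes the value of
  \<open>g\<close> at a point where all the functions agree.\<close>

lemma finite_max:
  assumes "finite Q" "Q \<noteq> {}" "\<And>q. q \<in> Q \<Longrightarrow> f q \<in> F"
    and "\<And>q p. q \<in> Q \<Longrightarrow> p \<in> X \<Longrightarrow> c p + dv (f q) p \<ge> 0"
  shows "\<exists>g\<in>F. (\<forall>p\<in>X. c p + dv g p \<ge> 0) \<and> (\<forall>q\<in>Q. \<forall>p. f q p \<le> g p) \<and> (\<forall>p. \<exists>q\<in>Q. g p = f q p)"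
  using assms
proof (induction Q rule: finite_ne_induct)
  case (singleton x)
  then show ?case by (intro bexI[of _ "f x"]) auto
next
  case (insert x Q)
  then obtain g where g: "g \<in> F" "\<forall>p\<in>X. c p + dv g p \<ge> 0" "\<forall>q\<in>Q. \<forall>p. f q p \<le> g p"
    "\<forall>p. \<exists>q\<in>Q. g p = f q p" by auto
  show ?case
  proof (intro bexI[of _ "\<lambda>p. max (f x p) (g p)"] conjI ballI allI)
    show "0 \<le> c p + dv (\<lambda>p. max (f x p) (g p)) p" if "p \<in> X" for p
      using that insert.prems g by (intro dv_max_ge) auto
    show "f q p \<le> max (f x p) (g p)" if "q \<in> insert x Q" for q p
      using that g(3) by (auto simp: le_max_iff_disj)
    show "\<exists>q\<in>insert x Q. max (f x p) (g p) = f q p" for p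
      using g(4) by (metis insert_iff max_def)
    show "(\<lambda>p. max (f x p) (g p)) \<in> F" using insert.prems g by (intro max_in) auto
  qed
qed

text \<open>
  Replacing D by its translate along the maximum of finitely many witnesses turns all these
  witnesses into functions that attain their maximum at z; this takes the place of a reduced
  divisor.
\<close>

lemma positive_rank_dominated:
  assumes D: "D \<in> divisors_on X" "positive_rank D" and z: "z \<in> X" and Q: "finite Q" "Q \<noteq> {}" "Q \<subseteq> X"
  obtains D' where "D' \<in> divisors_on X" "effective D'" "divisor_degree D' = divisor_degree D"
    "\<And>q. q \<in> Q \<Longrightarrow> \<exists>y\<in>F. y z = 0 \<and> (\<forall>p\<in>X. y p \<le> 0) \<and>
       (\<forall>p\<in>X. chips D' p + dv y p \<ge> (if p = q then 1 else 0))"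
proof -
  have "\<forall>q\<in>Q. \<exists>f\<in>F. \<forall>p\<in>X. chips D p + dv f p \<ge> (if p = q then 1 else 0)"
    using D(2) Q(3) unfolding positive_rank_def by blast
  then have "\<exists>f. \<forall>q\<in>Q. f q \<in> F \<and> (\<forall>p\<in>X. chips D p + dv (f q) p \<ge> (if p = q then 1 else 0))"
    by (intro bchoice) blast
  then obtain f where f: "\<And>q. q \<in> Q \<Longrightarrow> f q \<in> F"
    "\<And>q p. q \<in> Q \<Longrightarrow> p \<in> X \<Longrightarrow> chips D p + dv (f q) p \<ge> (if p = q then 1 else 0)"
    by blast
  \<comment> \<open>Normalised to vanish at \<open>z\<close>, so that their maximum vanishes there
    as well.\<close>
  define h where "h q = (\<lambda>p. f q p - f q z)" for q
  have h: "h q \<in> F" if "q \<in> Q" for q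
    unfolding h_def by (intro diff_in f that const_in)
  have dvh: "dv (h q) p = dv (f q) p" if "q \<in> Q" "p \<in> X" for q p
    unfolding h_def using that f(1) by (subst dv_diff) (auto simp: dv_const const_in)
  have pos: "chips D p + dv (h q) p \<ge> 0" if "q \<in> Q" "p \<in> X" for q p
    using f(2)[OF that] dvh[OF that] by (auto split: if_splits)
  have "\<exists>g\<in>F. (\<forall>p\<in>X. chips D p + dv g p \<ge> 0) \<and>
      (\<forall>q\<in>Q. \<forall>p. h q p \<le> g p) \<and> (\<forall>p. \<exists>q\<in>Q. g p = h q p)"
    by (rule finite_max[OF Q(1,2) h pos])
  then obtain g where g: "g \<in> F" "\<And>p. p \<in> X \<Longrightarrow> chips D p + dv g p \<ge> 0"
    "\<And>q p. q \<in> Q \<Longrightarrow> h q p \<le> g p" "\<And>p. \<exists>q\<in>Q. g p = h q p"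
    by blast
  obtain P where P: "P \<in> principal" "\<And>p. p \<in> X \<Longrightarrow> chips P p = dv g p"
    using dv_principal[OF g(1)] by blast
  have on: "D + P \<in> divisors_on X"
    using D P principal_divisors_on by (intro divisors_on_add) auto
  show ?thesis
  proof (rule that[OF on])
    show "effective (D + P)"
      unfolding effective_def
    proof
      fix p show "0 \<le> chips (D + P) p"
        using g(2)[of p] P(2)[of p] lookup_not_on[OF on, of p] by (cases "p \<in> X") (auto simp: lookup_add)
    qed
    show "divisor_degree (D + P) = divisor_degree D"
      using principal_degree[OF P(1)] by (simp add: divisor_degree_add)
    fix q assume q: "q \<in> Q"
    show "\<exists>y\<in>F. y z = 0 \<and> (\<forall>p\<in>X. y p \<le> 0) \<and>
       (\<forall>p\<in>X. chips (D + P) p + dv y p \<ge> (if p = q then 1 else 0))"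
    \<comment> \<open>Measured from the common maximum \<open>g\<close>, every witness is at most 0
      and still takes the value 0 at \<open>z\<close>.\<close>
    proof (intro bexI[of _ "\<lambda>p. h q p - g p"] conjI ballI)
      show "(\<lambda>p. h q p - g p) \<in> F" using h q g by (intro diff_in) auto
      show "h q z - g z = 0" using g(4)[of z] by (auto simp: h_def)
      show "h q p - g p \<le> 0" for p using g(3)[OF q, of p] by simp
      fix p assume p: "p \<in> X"
      have "dv (\<lambda>p. h q p - g p) p = dv (f q) p - dv g p"
        using dv_diff[OF h[OF q] g(1) p] dvh[OF q p] by simp
      then show "(if p = q then 1 else 0) \<le> chips (D + P) p + dv (\<lambda>p. h q p - g p) p"
        using f(2)[OF q p] P(2)[OF p] by (simp add: lookup_add)
    qed
  qed
qed

end

section \<open>Divisors on graphs\<close>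

text \<open>The negative of the Laplacian, which gives it the sign of outgoing slopes on a metric
  graph. The set of principal divisors is closed under negation and stays the same.\<close>

definition graph_div :: "('a, 'b) pre_digraph \<Rightarrow> ('a \<Rightarrow> int) \<Rightarrow> 'a \<Rightarrow> int" where
  "graph_div H f u =
     (\<Sum>e\<in>out_arcs H u. f (head H e) - f u) + (\<Sum>e\<in>in_arcs H u. f (tail H e) - f u)"

locale loopfree_multigraph = fin_digraph G + loopfree_digraph G for G :: "('a, 'b) pre_digraph"
begin

lemma finite_out_in [simp]: "finite (out_arcs G u)" "finite (in_arcs G u)"
  by (auto simp: out_arcs_def in_arcs_def)

lemma sum_out_arcs: "(\<Sum>u\<in>verts G. \<Sum>e\<in>out_arcs G u. h e) = (\<Sum>e\<in>arcs G. h e)"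
  for h :: "'b \<Rightarrow> 'c::comm_monoid_add"
  unfolding out_arcs_def by (rule sum.group) auto

lemma sum_in_arcs: "(\<Sum>u\<in>verts G. \<Sum>e\<in>in_arcs G u. h e) = (\<Sum>e\<in>arcs G. h e)"
  for h :: "'b \<Rightarrow> 'c::comm_monoid_add"
  unfolding in_arcs_def by (rule sum.group) auto

definition other_end :: "'a \<Rightarrow> 'b \<Rightarrow> 'a" where
  "other_end u e = (if tail G e = u then head G e else tail G e)"

lemma incident_eq: "{e \<in> arcs G. u \<in> edge_ends G e} = out_arcs G u \<union> in_arcs G u"
  by (auto simp: edge_ends_def out_arcs_def in_arcs_def)

lemma out_in_disjoint: "out_arcs G u \<inter> in_arcs G u = {}"
proof -
  have False if "e \<in> arcs G" "tail G e = u" "head G e = u" for e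
    using no_loops[OF that(1)] that(2,3) by simp
  then show ?thesis by (auto simp: out_arcs_def in_arcs_def)
qed

lemma other_end_out: "e \<in> out_arcs G u \<Longrightarrow> other_end u e = head G e"
  by (simp add: other_end_def out_arcs_def)

lemma other_end_in: "e \<in> in_arcs G u \<Longrightarrow> other_end u e = tail G e"
  using no_loops[of e] by (simp add: other_end_def in_arcs_def split: if_split)

lemma edge_ends_other: "e \<in> arcs G \<Longrightarrow> u \<in> edge_ends G e \<Longrightarrow> edge_ends G e = {u, other_end u e}"
  by (auto simp: other_end_def edge_ends_def)

lemma other_end_neq: "e \<in> arcs G \<Longrightarrow> u \<in> edge_ends G e \<Longrightarrow> other_end u e \<noteq> u"
  using no_loops[of e] by (cases "tail G e = u") (simp_all add: other_end_def edge_ends_def)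

lemma other_end_in_verts: "e \<in> arcs G \<Longrightarrow> other_end u e \<in> verts G"
  by (simp add: other_end_def)

lemma ends_meet_iff:
  assumes "e \<in> arcs G" "u \<in> edge_ends G e" "u \<notin> W"
  shows "edge_ends G e \<inter> W \<noteq> {} \<longleftrightarrow> other_end u e \<in> W"
  using edge_ends_other[OF assms(1,2)] assms(3) by auto

lemma sum_incident:
  "(\<Sum>e | e \<in> arcs G \<and> u \<in> edge_ends G e. h e) = (\<Sum>e\<in>out_arcs G u. h e) + (\<Sum>e\<in>in_arcs G u. h e)"
  for h :: "'b \<Rightarrow> 'c::comm_monoid_add"
  unfolding incident_eq by (rule sum.union_disjoint) (simp_all add: out_in_disjoint)

lemma graph_div_eq:
  "graph_div G f u = (\<Sum>e | e \<in> arcs G \<and> u \<in> edge_ends G e. f (other_end u e) - f u)"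
  unfolding graph_div_def sum_incident by (simp add: other_end_out other_end_in)

lemma laplacian_graph_div:
  assumes u: "u \<in> verts G"
  shows "(\<Sum>v\<in>verts G. laplacian G u v * x v) = - graph_div G x u"
proof -
  let ?I = "{e \<in> arcs G. u \<in> edge_ends G e}"
  \<comment> \<open>The off-diagonal entries of the Laplacian count the fibres of
    \<open>other_end u\<close> on the edges at \<open>u\<close>, which lets \<open>sum.group\<close>
    regroup the sum by edges.\<close>
  have mult: "{e \<in> arcs G. edge_ends G e = {u, v}} = {e \<in> ?I. other_end u e = v}" if "v \<noteq> u" for v
    using that by (auto simp: edge_ends_def other_end_def doubleton_eq_iff)
  have "(\<Sum>v\<in>verts G. laplacian G u v * x v) =
      laplacian G u u * x u + (\<Sum>v\<in>verts G - {u}. laplacian G u v * x v)"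
    using u by (simp add: sum.remove)
  also have "(\<Sum>v\<in>verts G - {u}. laplacian G u v * x v) =
      - (\<Sum>v\<in>verts G - {u}. \<Sum>e\<in>{e \<in> ?I. other_end u e = v}. x (other_end u e))"
    unfolding sum_negf[symmetric]
    by (rule sum.cong) (use mult in \<open>auto simp: laplacian_def\<close>)
  also have "(\<Sum>v\<in>verts G - {u}. \<Sum>e\<in>{e \<in> ?I. other_end u e = v}. x (other_end u e)) =
      (\<Sum>e\<in>?I. x (other_end u e))"
    by (rule sum.group) (use other_end_in_verts other_end_neq in auto)
  finally show ?thesis
    unfolding graph_div_eq by (simp add: laplacian_def sum_subtractf)
qed

lemma graph_div_degree: "(\<Sum>u\<in>verts G. graph_div G f u) = 0"
proof -
  have "(\<Sum>u\<in>verts G. graph_div G f u) =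
      (\<Sum>u\<in>verts G. \<Sum>e\<in>out_arcs G u. f (head G e) - f (tail G e)) +
      (\<Sum>u\<in>verts G. \<Sum>e\<in>in_arcs G u. f (tail G e) - f (head G e))"
    unfolding graph_div_def sum.distrib
    by (intro arg_cong2[of _ _ _ _ "(+)"] sum.cong) (auto simp: out_arcs_def in_arcs_def)
  also have "\<dots> = 0"
    by (simp only: sum_out_arcs sum_in_arcs sum.distrib[symmetric]) simp
  finally show ?thesis .
qed

end

locale nonempty_multigraph = loopfree_multigraph +
  assumes verts_nonempty: "verts G \<noteq> {}"

sublocale nonempty_multigraph \<subseteq> chip_firing "verts G" UNIV "graph_div G"
proof
  fix f g :: "'a \<Rightarrow> int" and p
  show "graph_div G (\<lambda>p. f p - g p) p = graph_div G f p - graph_div G g p"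
    by (simp add: graph_div_eq sum_subtractf[symmetric] algebra_simps)
  show "graph_div G f p \<le> graph_div G g p" if "f p = g p" "\<And>q. q \<in> verts G \<Longrightarrow> f q \<le> g q"
    unfolding graph_div_eq by (rule sum_mono) (use that other_end_in_verts in auto)
  show "\<exists>D\<in>divisors_on (verts G). divisor_degree D = 0 \<and>
      (\<forall>p\<in>verts G. chips D p = graph_div G f p)"
    using divisor_of_function[OF finite_verts, of "graph_div G f"] graph_div_degree by auto
qed (auto simp: verts_nonempty graph_div_def)

context nonempty_multigraph
begin

lemma principal_divisors_eq: "principal_divisors G = principal"
proof -
  have *: "(\<exists>x. \<forall>u\<in>verts G. chips D u = - graph_div G x u) \<longleftrightarrow>
    (\<exists>x. \<forall>u\<in>verts G. chips D u = graph_div G x u)" for D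
  proof
    assume "\<exists>x. \<forall>u\<in>verts G. chips D u = - graph_div G x u"
    then obtain x where "\<forall>u\<in>verts G. chips D u = - graph_div G x u" by blast
    then show "\<exists>x. \<forall>u\<in>verts G. chips D u = graph_div G x u"
      by (intro exI[of _ "\<lambda>v. - x v"]) (simp add: dv_minus)
  next
    assume "\<exists>x. \<forall>u\<in>verts G. chips D u = graph_div G x u"
    then obtain x where "\<forall>u\<in>verts G. chips D u = graph_div G x u" by blast
    then show "\<exists>x. \<forall>u\<in>verts G. chips D u = - graph_div G x u"
      by (intro exI[of _ "\<lambda>v. - x v"]) (simp add: dv_minus)
  qed
  show ?thesis
  proof (rule set_eqI)
    fix D
    have "D \<in> principal_divisors G \<longleftrightarrow> D \<in> divisors_on (verts G) \<and>
        (\<exists>x. \<forall>u\<in>verts G. chips D u = - graph_div G x u)"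
      unfolding principal_divisors_def by (simp add: laplacian_graph_div)
    also have "\<dots> \<longleftrightarrow> D \<in> principal"
      unfolding * by (simp add: principal_def)
    finally show "D \<in> principal_divisors G \<longleftrightarrow> D \<in> principal" .
  qed
qed

lemma dgon_eq: "dgon G = gonality (verts G) principal"
  by (simp add: dgon_def principal_divisors_eq)

text \<open>Meant for \<open>u\<close> outside \<open>W\<close>: an edge at \<open>u\<close> that
  meets \<open>W\<close> then has its other end in \<open>W\<close>, whatever its
  orientation.\<close>

definition links :: "'a \<Rightarrow> 'a set \<Rightarrow> nat" where
  "links u W = card {e \<in> arcs G. u \<in> edge_ends G e \<and> edge_ends G e \<inter> W \<noteq> {}}"

text \<open>By integrality every edge from a maximum to a lower vertex contributes at most -1, and
  no edge contributes a positive amount.\<close>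

lemma graph_div_at_maximum:
  assumes "u \<in> verts G" "f u = 0" "\<And>v. v \<in> verts G \<Longrightarrow> f v \<le> 0"
  shows "graph_div G f u \<le> - int (links u {v. f v < 0})"
proof -
  let ?I = "{e \<in> arcs G. u \<in> edge_ends G e}"
  let ?J = "{e \<in> arcs G. u \<in> edge_ends G e \<and> edge_ends G e \<inter> {v. f v < 0} \<noteq> {}}"
  have "graph_div G f u \<le> (\<Sum>e\<in>?I. if e \<in> ?J then -1 else 0)"
    unfolding graph_div_eq
  proof (rule sum_mono)
    fix e assume e: "e \<in> ?I"
    then show "f (other_end u e) - f u \<le> (if e \<in> ?J then - 1 else 0)"
      using edge_ends_other[of e u] other_end_in_verts[of e u] assms(2) assms(3)[of "other_end u e"]
      by auto
  qed
  also have "\<dots> = (\<Sum>e\<in>?J. -1)"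
    by (rule sum.mono_neutral_cong_right) auto
  finally show ?thesis by (simp add: links_def)
qed

text \<open>Effective configurations equivalent to \<open>D\<close>, taken as plain functions so
  that firings can be chained without building a divisor each time.\<close>

definition attainable :: "'a divisor \<Rightarrow> ('a \<Rightarrow> int) \<Rightarrow> bool" where
  "attainable D d \<longleftrightarrow> (\<forall>v\<in>verts G. d v \<ge> 0) \<and>
     (\<exists>f. \<forall>v\<in>verts G. d v = chips D v + graph_div G f v)"

text \<open>The set that fires is the complement of \<open>W\<close>: chips are pushed into
  \<open>W\<close>. Vertices of \<open>W\<close> only gain, so legality is a condition on the other
  side alone.\<close>

lemma attainable_fire:
  assumes "attainable D d" and legal: "\<And>u. u \<in> verts G \<Longrightarrow> u \<notin> W \<Longrightarrow> int (links u W) \<le> d u"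
  obtains d' where "attainable D d'"
    "\<And>u. u \<in> verts G \<Longrightarrow> u \<notin> W \<Longrightarrow> d' u = d u - int (links u W)"
    "\<And>u. u \<in> verts G \<Longrightarrow> u \<in> W \<Longrightarrow> d' u = d u + int (links u (- W))"
proof -
  define x :: "'a \<Rightarrow> int" where "x v = (if v \<in> W then -1 else 0)" for v
  have out: "graph_div G x u = - int (links u W)" if "u \<notin> W" for u
  proof -
    have "graph_div G x u = (\<Sum>e | e \<in> arcs G \<and> u \<in> edge_ends G e. if other_end u e \<in> W then -1 else 0)"
      unfolding graph_div_eq using that by (intro sum.cong) (auto simp: x_def)
    also have "\<dots> = (\<Sum>e | e \<in> arcs G \<and> u \<in> edge_ends G e \<and> edge_ends G e \<inter> W \<noteq> {}. -1)"
      using that by (intro sum.mono_neutral_cong_right) (use ends_meet_iff[of _ u W] in auto)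
    finally show ?thesis by (simp add: links_def)
  qed
  have inn: "graph_div G x u = int (links u (- W))" if "u \<in> W" for u
  proof -
    have "graph_div G x u = (\<Sum>e | e \<in> arcs G \<and> u \<in> edge_ends G e. if other_end u e \<in> W then 0 else 1)"
      unfolding graph_div_eq using that by (intro sum.cong) (auto simp: x_def)
    also have "\<dots> = (\<Sum>e | e \<in> arcs G \<and> u \<in> edge_ends G e \<and> edge_ends G e \<inter> (- W) \<noteq> {}. 1)"
      using that by (intro sum.mono_neutral_cong_right) (use ends_meet_iff[of _ u "- W"] in auto)
    finally show ?thesis by (simp add: links_def)
  qed
  obtain f where f: "\<forall>v\<in>verts G. d v = chips D v + graph_div G f v"
    and d: "\<forall>v\<in>verts G. d v \<ge> 0"
    using assms(1) unfolding attainable_def by (elim conjE exE) (rule that)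
  let ?d = "\<lambda>v. d v + graph_div G x v"
  have "attainable D ?d"
    unfolding attainable_def
  proof
    show "\<forall>v\<in>verts G. 0 \<le> ?d v"
    proof
      fix v assume "v \<in> verts G"
      then show "0 \<le> ?d v" using d legal[of v] out[of v] inn[of v] by (cases "v \<in> W") auto
    qed
    have "\<forall>v\<in>verts G. ?d v = chips D v + graph_div G (\<lambda>v. f v + x v) v"
      using f by (simp add: dv_add)
    then show "\<exists>f. \<forall>v\<in>verts G. ?d v = chips D v + graph_div G f v" by blast
  qed
  then show ?thesis
  proof (rule that[of ?d])
    show "?d u = d u - int (links u W)" if "u \<notin> W" for u using out[OF that] by simp
    show "?d u = d u + int (links u (- W))" if "u \<in> W" for u using inn[OF that] by simp
  qed
qed

lemma positive_rankI:
  assumes "\<And>q. q \<in> verts G \<Longrightarrow> \<exists>d. attainable D d \<and> d q \<ge> 1"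
  shows "positive_rank D"
  unfolding positive_rank_def
proof
  fix q assume "q \<in> verts G"
  from assms[OF this] obtain d where ad: "attainable D d" and dq: "d q \<ge> 1" by (elim exE conjE)
  then obtain f where f: "\<forall>v\<in>verts G. d v = chips D v + graph_div G f v"
    unfolding attainable_def by (elim conjE exE)
  have nonneg: "\<forall>v\<in>verts G. d v \<ge> 0" using ad unfolding attainable_def by (elim conjE)
  have "(if p = q then 1 else 0) \<le> chips D p + graph_div G f p" if "p \<in> verts G" for p
  proof -
    have "(if p = q then 1 else 0) \<le> d p" using dq nonneg that by (cases "p = q") simp_all
    then show ?thesis using f that by metis
  qed
  then show "\<exists>f\<in>UNIV. \<forall>p\<in>verts G. chips D p + graph_div G f p \<ge> (if p = q then 1 else 0)"
    by blast
qed

end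

section \<open>Piecewise linear functions on an edge\<close>

text \<open>Exact affineness immediately to the right of \<open>t\<close>, rather than a limit of
  quotients: such statements combine pointwise, and \<open>forward_slope_eq\<close> recovers the
  slope defined by the limit. In \<open>has_bwd\<close> the slope is the outgoing one, measured
  towards the left.\<close>

definition has_fwd :: "(real \<Rightarrow> real) \<Rightarrow> real \<Rightarrow> real \<Rightarrow> bool" where
  "has_fwd g t m \<longleftrightarrow> eventually (\<lambda>h. g (t + h) = g t + m * h) (at_right 0)"

definition has_bwd :: "(real \<Rightarrow> real) \<Rightarrow> real \<Rightarrow> real \<Rightarrow> bool" where
  "has_bwd g t m \<longleftrightarrow> eventually (\<lambda>h. g (t - h) = g t + m * h) (at_right 0)"

lemma has_bwd_reflect: "has_bwd g t m \<longleftrightarrow> has_fwd (\<lambda>s. g (- s)) (- t) m"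
  by (simp add: has_bwd_def has_fwd_def add.commute)

lemma backward_slope_reflect: "backward_slope g t = forward_slope (\<lambda>s. g (- s)) (- t)"
  by (simp add: backward_slope_def forward_slope_def add.commute)

lemma forward_slope_eq: "has_fwd g t m \<Longrightarrow> forward_slope g t = m"
proof -
  assume *: "has_fwd g t m"
  have "eventually (\<lambda>h. m = (g (t + h) - g t) / h) (at_right 0)"
    using *[unfolded has_fwd_def] eventually_at_right_less[of "0::real"]
    by eventually_elim (simp add: field_simps)
  then have "((\<lambda>h. (g (t + h) - g t) / h) \<longlongrightarrow> m) (at_right 0)"
    by (rule tendsto_eventually[OF eventually_mono]) simp
  then show ?thesis
    unfolding forward_slope_def by (intro tendsto_Lim) simp_all
qed

lemma backward_slope_eq: "has_bwd g t m \<Longrightarrow> backward_slope g t = m"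
  by (simp add: has_bwd_reflect backward_slope_reflect forward_slope_eq)

lemma has_fwd_const: "has_fwd (\<lambda>_. c) t 0"
  by (simp add: has_fwd_def)

lemma has_fwd_diff:
  assumes "has_fwd f t m" "has_fwd g t n"
  shows "has_fwd (\<lambda>s. f s - g s) t (m - n)"
  using assms unfolding has_fwd_def by eventually_elim (simp add: algebra_simps)

lemma has_fwd_mono:
  assumes "has_fwd f t m" "has_fwd g t n" "f t = g t" "eventually (\<lambda>h. f (t + h) \<le> g (t + h)) (at_right 0)"
  shows "m \<le> n"
proof -
  have "eventually (\<lambda>h. m \<le> n) (at_right (0::real))"
    using assms(1)[unfolded has_fwd_def] assms(2)[unfolded has_fwd_def] assms(4) eventually_at_right_less[of "0::real"]
    by eventually_elim (use assms(3) in simp)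
  then show ?thesis by simp
qed

text \<open>Where the values differ, the linear terms are too small near \<open>t\<close> to close
  the gap; at a tie the larger slope wins.\<close>

lemma has_fwd_max:
  assumes "has_fwd f t m" "has_fwd g t n"
  shows "has_fwd (\<lambda>s. max (f s) (g s)) t (if f t > g t then m else if g t > f t then n else max m n)"
proof -
  have small: "eventually (\<lambda>h. \<bar>m * h\<bar> + \<bar>n * h\<bar> < e) (at_right 0)" if "e > 0" for e
  proof -
    have "((\<lambda>h. \<bar>m * h\<bar> + \<bar>n * h\<bar>) \<longlongrightarrow> \<bar>m * 0\<bar> + \<bar>n * 0\<bar>) (at_right 0)"
      by (intro tendsto_intros)
    then show ?thesis using that by (auto dest: order_tendstoD(2)[of _ _ _ e])
  qed
  consider "f t > g t" | "g t > f t" | "f t = g t" by linarith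
  then show ?thesis
  proof cases
    case 1
    then have "eventually (\<lambda>h. \<bar>m * h\<bar> + \<bar>n * h\<bar> < f t - g t) (at_right 0)"
      by (intro small) simp
    with assms[unfolded has_fwd_def]
    have "eventually (\<lambda>h. max (f (t + h)) (g (t + h)) = max (f t) (g t) + m * h) (at_right 0)"
    proof eventually_elim
      case (elim h)
      then have "f (t + h) > g (t + h)"
        using abs_ge_minus_self[of "m * h"] abs_ge_self[of "n * h"] by linarith
      then show ?case using 1 elim by (simp add: max_def)
    qed
    then show ?thesis using 1 by (simp add: has_fwd_def)
  next
    case 2
    then have "eventually (\<lambda>h. \<bar>m * h\<bar> + \<bar>n * h\<bar> < g t - f t) (at_right 0)"
      by (intro small) simp
    with assms[unfolded has_fwd_def]
    have "eventually (\<lambda>h. max (f (t + h)) (g (t + h)) = max (f t) (g t) + n * h) (at_right 0)"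
    proof eventually_elim
      case (elim h)
      then have "f (t + h) < g (t + h)"
        using abs_ge_minus_self[of "n * h"] abs_ge_self[of "m * h"] by linarith
      then show ?case using 2 elim by (simp add: max_def)
    qed
    then show ?thesis using 2 by (simp add: has_fwd_def)
  next
    case 3
    have "eventually (\<lambda>h. max (f (t + h)) (g (t + h)) = max (f t) (g t) + max m n * h) (at_right 0)"
      using assms[unfolded has_fwd_def] eventually_at_right_less[of "0::real"]
    proof eventually_elim
      case (elim h)
      then show ?case using 3 by (simp add: max_mult_distrib_right max_add_distrib_right)
    qed
    then show ?thesis using 3 by (simp add: has_fwd_def)
  qed
qed

lemma has_bwd_const: "has_bwd (\<lambda>_. c) t 0"
  by (simp add: has_bwd_def)

lemma has_bwd_diff:
  "has_bwd f t m \<Longrightarrow> has_bwd g t n \<Longrightarrow> has_bwd (\<lambda>s. f s - g s) t (m - n)"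
  unfolding has_bwd_reflect by (rule has_fwd_diff)

lemma has_bwd_mono:
  "has_bwd f t m \<Longrightarrow> has_bwd g t n \<Longrightarrow> f t = g t \<Longrightarrow>
    eventually (\<lambda>h. f (t - h) \<le> g (t - h)) (at_right 0) \<Longrightarrow> m \<le> n"
  unfolding has_bwd_reflect
  using has_fwd_mono[of "\<lambda>s. f (- s)" "- t" m "\<lambda>s. g (- s)" n] by (simp add: add.commute)

lemma has_bwd_max:
  "has_bwd f t m \<Longrightarrow> has_bwd g t n \<Longrightarrow>
    has_bwd (\<lambda>s. max (f s) (g s)) t (if f t > g t then m else if g t > f t then n else max m n)"
  unfolding has_bwd_reflect using has_fwd_max[of "\<lambda>s. f (- s)" "- t" m "\<lambda>s. g (- s)" n]
  by (simp only: minus_minus)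

text \<open>A pointwise substitute for a finite set of breakpoints. It passes to differences and
  maxima without computing where two functions cross; compactness of the unit interval restores the
  finite set.\<close>

definition locally_linear :: "(real \<Rightarrow> real) \<Rightarrow> bool" where
  "locally_linear g \<longleftrightarrow>
     (\<forall>t. 0 \<le> t \<and> t < 1 \<longrightarrow> (\<exists>m::int. has_fwd g t (of_int m))) \<and>
     (\<forall>t. 0 < t \<and> t \<le> 1 \<longrightarrow> (\<exists>m::int. has_bwd g t (of_int m)))"

lemma eventually_at_right_0_iff:
  "eventually P (at_right (0::real)) \<longleftrightarrow> (\<exists>e>0. \<forall>h. 0 < h \<and> h < e \<longrightarrow> P h)"
  unfolding eventually_at_right_field by auto

lemma finite_gap_right:
  assumes "finite S" "t < (b::real)"
  obtains c where "t < c" "c \<le> b" "{t<..<c} \<inter> S = {}"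
proof (cases "S \<inter> {t<..<b} = {}")
  case True
  then show ?thesis using assms that[of b] by auto
next
  case False
  let ?c = "Min (S \<inter> {t<..<b})"
  have "?c \<in> S \<inter> {t<..<b}" using False assms by (intro Min_in) auto
  moreover have "{t<..<?c} \<inter> S = {}"
  proof -
    have False if "s \<in> S" "t < s" "s < ?c" for s
    proof -
      have "?c \<le> s" using that assms \<open>?c \<in> _\<close> by (intro Min_le) auto
      then show False using that by simp
    qed
    then show ?thesis by auto
  qed
  ultimately show ?thesis using that[of ?c] by auto
qed

text \<open>Piecewise linearity provides the affine formula on open intervals only; continuity
  carries it to the left endpoint, where the slope is taken.\<close>

lemma affine_extend_left:
  fixes g :: "real \<Rightarrow> real"
  assumes cont: "continuous_on {0..1} g" and t: "0 \<le> t" "t < c" "c \<le> 1"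
    and aff: "\<forall>s\<in>{t<..<c}. g s = m * s + d"
  shows "g t = m * t + d"
proof -
  have "(g \<longlongrightarrow> g t) (at t within {0..1})"
    using cont t by (auto simp: continuous_on_def)
  then have 1: "(g \<longlongrightarrow> g t) (at t within {t<..<c})"
    by (rule tendsto_within_subset) (use t in auto)
  have 2: "((\<lambda>s. m * s + d) \<longlongrightarrow> m * t + d) (at t within {t<..<c})"
    by (intro tendsto_intros)
  have 3: "eventually (\<lambda>s. g s = m * s + d) (at t within {t<..<c})"
    using aff by (auto simp: eventually_at_filter)
  have nt: "at t within {t<..<c} \<noteq> bot"
  proof -
    have "at t within {t<..<c} = at_right t"
      using t by (intro at_within_nhd[of _ "{..<c}"]) auto
    then show ?thesis by simp
  qed
  have "(g \<longlongrightarrow> m * t + d) (at t within {t<..<c})"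
    using 2 tendsto_cong[OF 3] by simp
  with 1 nt show ?thesis using tendsto_unique by blast
qed

lemma ipl_has_fwd:
  assumes "integer_piecewise_linear g" "0 \<le> t" "t < 1"
  shows "\<exists>m::int. has_fwd g t (of_int m)"
proof -
  obtain S where S: "finite S" and lin: "\<And>a b. 0 \<le> a \<and> a < b \<and> b \<le> 1 \<and> {a<..<b} \<inter> S = {} \<Longrightarrow>
         \<exists>(m :: int) c. \<forall>t\<in>{a<..<b}. g t = of_int m * t + c" and cont: "continuous_on {0..1} g"
    using assms(1) unfolding integer_piecewise_linear_def by blast
  obtain c where c: "t < c" "c \<le> 1" "{t<..<c} \<inter> S = {}"
    using finite_gap_right[OF S assms(3)] by blast
  then obtain m :: int and d where md: "\<forall>s\<in>{t<..<c}. g s = of_int m * s + d"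
    using lin[of t c] assms(2) by blast
  have gt: "g t = of_int m * t + d"
    using affine_extend_left[OF cont assms(2) c(1,2) md] .
  have "has_fwd g t (of_int m)"
    unfolding has_fwd_def eventually_at_right_0_iff
    using md gt c by (intro exI[of _ "c - t"]) (auto simp: algebra_simps)
  then show ?thesis ..
qed

lemma ipl_reflect:
  assumes "integer_piecewise_linear g"
  shows "integer_piecewise_linear (\<lambda>t. g (1 - t))"
proof -
  obtain S where S: "finite S" and lin: "\<And>a b. 0 \<le> a \<and> a < b \<and> b \<le> 1 \<and> {a<..<b} \<inter> S = {} \<Longrightarrow>
         \<exists>(m :: int) c. \<forall>t\<in>{a<..<b}. g t = of_int m * t + c" and cont: "continuous_on {0..1} g"
    using assms(1) unfolding integer_piecewise_linear_def by blast
  have "continuous_on {0..1} (\<lambda>t. g (1 - t))"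
    by (rule continuous_on_compose2[OF cont]) (auto intro: continuous_intros)
  moreover have "\<exists>(m :: int) c. \<forall>t\<in>{a<..<b}. g (1 - t) = of_int m * t + c"
    if ab: "0 \<le> a \<and> a < b \<and> b \<le> 1 \<and> {a<..<b} \<inter> (\<lambda>s. 1 - s) ` S = {}" for a b
  proof -
    have "{1 - b<..<1 - a} \<inter> S = {}"
    proof -
      have "1 - s \<in> {a<..<b} \<inter> (\<lambda>s. 1 - s) ` S" if "s \<in> {1 - b<..<1 - a} \<inter> S" for s
        using that by auto
      then show ?thesis using ab by blast
    qed
    then obtain m :: int and c where m: "\<forall>t\<in>{1 - b<..<1 - a}. g t = of_int m * t + c"
      using lin[of "1 - b" "1 - a"] ab by auto
    have "\<forall>t\<in>{a<..<b}. g (1 - t) = of_int (- m) * t + (of_int m + c)"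
      using m by (auto simp: algebra_simps)
    then show ?thesis by blast
  qed
  ultimately show ?thesis
    unfolding integer_piecewise_linear_def using S by blast
qed

lemma ipl_has_bwd:
  assumes "integer_piecewise_linear g" "0 < t" "t \<le> 1"
  shows "\<exists>m::int. has_bwd g t (of_int m)"
  using ipl_has_fwd[OF ipl_reflect[OF assms(1)], of "1 - t"] assms(2,3)
  by (simp add: has_fwd_def has_bwd_def algebra_simps)

lemma ipl_locally_linear: "integer_piecewise_linear g \<Longrightarrow> locally_linear g"
  unfolding locally_linear_def using ipl_has_fwd ipl_has_bwd by blast

lemma locally_linear_near:
  assumes "locally_linear g" "0 \<le> x" "x \<le> 1"
  shows "\<exists>e>0. \<exists>m n::int. (\<forall>s. 0 \<le> s \<and> s \<le> x \<and> x - s < e \<longrightarrow> g s = g x + of_int m * (x - s)) \<and>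
    (\<forall>s. s \<le> 1 \<and> x \<le> s \<and> s - x < e \<longrightarrow> g s = g x + of_int n * (s - x))"
proof -
  have "\<exists>e>0. \<exists>m::int. \<forall>s. 0 \<le> s \<and> s \<le> x \<and> x - s < e \<longrightarrow> g s = g x + of_int m * (x - s)"
  proof (cases "0 < x")
    case True
    then obtain m :: int where m: "has_bwd g x (of_int m)" using assms by (auto simp: locally_linear_def)
    then obtain e where e: "e > 0" "\<And>h. 0 < h \<and> h < e \<Longrightarrow> g (x - h) = g x + of_int m * h"
      unfolding has_bwd_def eventually_at_right_0_iff by blast
    have "g s = g x + of_int m * (x - s)" if "s \<le> x" "x - s < e" for s
      using e(2)[of "x - s"] that by (cases "s = x") auto
    with e(1) show ?thesis by blast
  next
    case False
    then show ?thesis using assms by (intro exI[of _ 1] exI[of _ 0]) auto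
  qed
  then obtain e1 m where 1: "e1 > 0" "\<forall>s. 0 \<le> s \<and> s \<le> x \<and> x - s < e1 \<longrightarrow> g s = g x + of_int m * (x - s)"
    by blast
  have "\<exists>e>0. \<exists>n::int. \<forall>s. s \<le> 1 \<and> x \<le> s \<and> s - x < e \<longrightarrow> g s = g x + of_int n * (s - x)"
  proof (cases "x < 1")
    case True
    then obtain m :: int where m: "has_fwd g x (of_int m)" using assms by (auto simp: locally_linear_def)
    then obtain e where e: "e > 0" "\<And>h. 0 < h \<and> h < e \<Longrightarrow> g (x + h) = g x + of_int m * h"
      unfolding has_fwd_def eventually_at_right_0_iff by blast
    have "g s = g x + of_int m * (s - x)" if "x \<le> s" "s - x < e" for s
      using e(2)[of "s - x"] that by (cases "s = x") auto
    with e(1) show ?thesis by blast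
  next
    case False
    then show ?thesis using assms by (intro exI[of _ 1] exI[of _ 0]) auto
  qed
  then obtain e2 n where 2: "e2 > 0" "\<forall>s. s \<le> 1 \<and> x \<le> s \<and> s - x < e2 \<longrightarrow> g s = g x + of_int n * (s - x)"
    by blast
  have "min e1 e2 > 0" using 1(1) 2(1) by simp
  moreover have "\<forall>s. 0 \<le> s \<and> s \<le> x \<and> x - s < min e1 e2 \<longrightarrow> g s = g x + of_int m * (x - s)"
    using 1(2) by (metis min_less_iff_conj)
  moreover have "\<forall>s. s \<le> 1 \<and> x \<le> s \<and> s - x < min e1 e2 \<longrightarrow> g s = g x + of_int n * (s - x)"
    using 2(2) by (metis min_less_iff_conj)
  ultimately show ?thesis by blast
qed

lemma has_fwd_affine:
  assumes "t < b" "\<forall>s\<in>{t..<b}. g s = g t + m * (s - t)"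
  shows "has_fwd g t m"
proof -
  have "g (t + h) = g t + m * h" if "0 < h" "h < b - t" for h
    using assms(2)[rule_format, of "t + h"] that by simp
  then show ?thesis
    unfolding has_fwd_def eventually_at_right_0_iff using assms(1) by (intro exI[of _ "b - t"]) simp
qed

lemma has_bwd_affine:
  assumes "b < t" "\<forall>s\<in>{b<..t}. g s = g t + m * (t - s)"
  shows "has_bwd g t m"
proof -
  have "g (t - h) = g t + m * h" if "0 < h" "h < t - b" for h
    using assms(2)[rule_format, of "t - h"] that by simp
  then show ?thesis
    unfolding has_bwd_def eventually_at_right_0_iff using assms(1) by (intro exI[of _ "t - b"]) simp
qed

definition kink :: "(real \<Rightarrow> real) \<Rightarrow> real \<Rightarrow> real" where
  "kink g t = forward_slope g t + backward_slope g t"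

text \<open>The last conjunct says that the principal divisor of \<open>g\<close> has degree zero on
  the segment, its endpoints counting with their slopes into the segment. Summed over the edges it
  becomes the degree formula for principal divisors.\<close>

definition linear_pieces :: "(real \<Rightarrow> real) \<Rightarrow> real \<Rightarrow> real \<Rightarrow> real set \<Rightarrow> bool" where
  "linear_pieces g u v S \<longleftrightarrow> finite S \<and> S \<subseteq> {u<..<v} \<and>
    (\<forall>a b. u \<le> a \<and> a < b \<and> b \<le> v \<and> {a<..<b} \<inter> S = {} \<longrightarrow>
       (\<exists>(m::int) c. \<forall>t\<in>{a<..<b}. g t = of_int m * t + c)) \<and>
    (\<forall>t\<in>{u<..<v} - S. kink g t = 0) \<and>
    forward_slope g u + backward_slope g v + (\<Sum>t\<in>S. kink g t) = 0"

text \<open>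
  The claim is local and passes to unions of adjacent intervals, so the bisection principle of the
  library applies; finiteness of the set of breakpoints comes from the same argument.
\<close>

lemma locally_linear_pieces:
  assumes g: "locally_linear g"
  shows "\<exists>S. linear_pieces g 0 1 S"
proof -
  \<comment> \<open>Bisection also meets degenerate intervals. They are exempted because on a single
    point with a kink the degree condition of \<open>linear_pieces\<close> would fail.\<close>
  define P where "P u v \<longleftrightarrow> (u < v \<longrightarrow> (\<exists>S. linear_pieces g u v S))" for u v :: real
  have combine: "P a c" if ab: "P a b" and bc: "P b c" and le: "a \<le> b" "b \<le> c" for a b c
  proof (cases "a < b \<and> b < c")
    case False
    then show ?thesis using ab bc le by (cases "a = b") auto
  next
    case True
    obtain S where S: "finite S" "S \<subseteq> {a<..<b}"
      "\<And>x y. a \<le> x \<and> x < y \<and> y \<le> b \<and> {x<..<y} \<inter> S = {} \<Longrightarrow>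
         \<exists>(m::int) c. \<forall>t\<in>{x<..<y}. g t = of_int m * t + c"
      "\<forall>t\<in>{a<..<b} - S. kink g t = 0"
      "forward_slope g a + backward_slope g b + (\<Sum>t\<in>S. kink g t) = 0"
      using ab True unfolding P_def linear_pieces_def by blast
    obtain T where T: "finite T" "T \<subseteq> {b<..<c}"
      "\<And>x y. b \<le> x \<and> x < y \<and> y \<le> c \<and> {x<..<y} \<inter> T = {} \<Longrightarrow>
         \<exists>(m::int) c. \<forall>t\<in>{x<..<y}. g t = of_int m * t + c"
      "\<forall>t\<in>{b<..<c} - T. kink g t = 0"
      "forward_slope g b + backward_slope g c + (\<Sum>t\<in>T. kink g t) = 0"
      using bc True unfolding P_def linear_pieces_def by blast
    \<comment> \<open>The junction becomes a breakpoint: its kink is the sum of the slopes that the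
      two halves attribute to their common end.\<close>
    let ?S = "insert b (S \<union> T)"
    have dis: "S \<inter> T = {}" "b \<notin> S \<union> T" 
      proof -
        have "s < b" if "s \<in> S" for s using S(2) that by auto
        moreover have "b < s" if "s \<in> T" for s using T(2) that by auto
        ultimately show "S \<inter> T = {}" "b \<notin> S \<union> T" by (auto dest: less_asym)
      qed
    have "(\<Sum>t\<in>?S. kink g t) = kink g b + ((\<Sum>t\<in>S. kink g t) + (\<Sum>t\<in>T. kink g t))"
      using dis S(1) T(1) by (simp add: sum.union_disjoint)
    then have sum: "forward_slope g a + backward_slope g c + (\<Sum>t\<in>?S. kink g t) = 0"
      using S(5) T(5) by (simp add: kink_def)
    have "\<exists>(m::int) c. \<forall>t\<in>{x<..<y}. g t = of_int m * t + c"
      if xy: "a \<le> x \<and> x < y \<and> y \<le> c \<and> {x<..<y} \<inter> ?S = {}" for x y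
    proof -
      have "y \<le> b \<or> b \<le> x" using xy by force
      then show ?thesis using S(3)[of x y] T(3)[of x y] xy by blast
    qed
    moreover have "kink g t = 0" if "t \<in> {a<..<c} - ?S" for t
    proof (cases "t < b")
      case True then show ?thesis using that S(4) by auto
    next
      case False then show ?thesis using that T(4) by auto
    qed
    moreover have "finite ?S" "?S \<subseteq> {a<..<c}" using S(1,2) T(1,2) True by auto
    ultimately show ?thesis
      unfolding P_def linear_pieces_def using sum by (intro impI exI[of _ ?S] conjI allI ballI) blast+
  qed
  have affine: "P u v" if A: "\<forall>s\<in>{u..v}. g s = of_int m * s + d" for m :: int and d u v
    unfolding P_def
  proof
    assume uv: "u < v"
    have fw: "forward_slope g t = of_int m" if "u \<le> t" "t < v" for t
      by (intro forward_slope_eq has_fwd_affine[of t v]) (use A that in \<open>simp_all add: algebra_simps\<close>)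
    have bw: "backward_slope g t = - of_int m" if "u < t" "t \<le> v" for t
      by (intro backward_slope_eq has_bwd_affine[of u t]) (use A that in \<open>simp_all add: algebra_simps\<close>)
    have "\<exists>(m::int) c. \<forall>t\<in>{a<..<b}. g t = of_int m * t + c" if "u \<le> a \<and> a < b \<and> b \<le> v" for a b
      using A that by (intro exI[of _ m] exI[of _ d]) auto
    moreover have "\<forall>t\<in>{u<..<v}. kink g t = 0" using fw bw by (auto simp: kink_def)
    moreover have "forward_slope g u + backward_slope g v = 0" using fw bw uv by simp
    ultimately show "\<exists>S. linear_pieces g u v S"
      unfolding linear_pieces_def
      by (intro exI[of _ "{}"]) simp
  qed
  \<comment> \<open>\<open>Bolzano\<close> quantifies over small intervals around \<open>x\<close>
    that may leave the unit interval; clamping brings them back into it.\<close>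
  define clamp :: "real \<Rightarrow> real" where "clamp u = max 0 (min 1 u)" for u
  have "P (clamp 0) (clamp 1)"
  proof (rule Bolzano[of 0 1 "\<lambda>u v. P (clamp u) (clamp v)"])
    show "P (clamp a) (clamp c)" if "P (clamp a) (clamp b)" "P (clamp b) (clamp c)" "a \<le> b" "b \<le> c" for a b c
      using that by (intro combine[of "clamp a" "clamp b" "clamp c"]) (auto simp: clamp_def)
  next
    fix x :: real assume x: "0 \<le> x" "x \<le> 1"
    obtain e m n where e: "e > 0"
      and left: "\<forall>s. 0 \<le> s \<and> s \<le> x \<and> x - s < e \<longrightarrow> g s = g x + of_int m * (x - s)"
      and right: "\<forall>s. s \<le> 1 \<and> x \<le> s \<and> s - x < e \<longrightarrow> g s = g x + of_int n * (s - x)"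
      using locally_linear_near[OF g x] by (elim exE conjE) (rule that)
    have "P a b" if "0 \<le> a" "a \<le> x" "x \<le> b" "b \<le> 1" "b - a < e" for a b
    proof (rule combine[of a x b])
      have "g s = of_int (- m) * s + (g x + of_int m * x)" if "s \<in> {a..x}" for s
      proof -
        have "g s = g x + of_int m * (x - s)"
          by (rule left[rule_format]) (use that \<open>0 \<le> a\<close> \<open>x \<le> b\<close> \<open>b - a < e\<close> in auto)
        then show ?thesis by (simp add: algebra_simps)
      qed
      then show "P a x" by (intro affine) blast
      have "g s = of_int n * s + (g x - of_int n * x)" if "s \<in> {x..b}" for s
      proof -
        have "g s = g x + of_int n * (s - x)"
          by (rule right[rule_format]) (use that \<open>b \<le> 1\<close> \<open>a \<le> x\<close> \<open>b - a < e\<close> in auto)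
        then show ?thesis by (simp add: algebra_simps)
      qed
      then show "P x b" by (intro affine) blast
    qed (use that in auto)
    then have "P (clamp a) (clamp b)" if "a \<le> x" "x \<le> b" "b - a < e" for a b
      using that x by (auto simp: clamp_def)
    with e show "\<exists>d>0. \<forall>a b. a \<le> x \<and> x \<le> b \<and> b - a < d \<longrightarrow> P (clamp a) (clamp b)"
      by blast
  qed simp
  then have "P 0 1" by (simp add: clamp_def)
  then show ?thesis unfolding P_def by (rule mp) simp
qed

section \<open>Divisors on metric graphs\<close>

lemma locally_linear_imp_ipl:
  assumes "locally_linear g" "continuous_on {0..1} g"
  shows "integer_piecewise_linear g"
  using locally_linear_pieces[OF assms(1)] assms(2)
  unfolding integer_piecewise_linear_def linear_pieces_def by blast

lemma ipl_forward:
  assumes "integer_piecewise_linear g" "0 \<le> t" "t < 1"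
  shows "has_fwd g t (forward_slope g t)" "forward_slope g t \<in> \<int>"
proof -
  obtain m :: int where m: "has_fwd g t (of_int m)" using ipl_has_fwd[OF assms] by blast
  show "has_fwd g t (forward_slope g t)" "forward_slope g t \<in> \<int>"
    using m forward_slope_eq[OF m] by simp_all
qed

lemma ipl_backward:
  assumes "integer_piecewise_linear g" "0 < t" "t \<le> 1"
  shows "has_bwd g t (backward_slope g t)" "backward_slope g t \<in> \<int>"
proof -
  obtain m :: int where m: "has_bwd g t (of_int m)" using ipl_has_bwd[OF assms] by blast
  show "has_bwd g t (backward_slope g t)" "backward_slope g t \<in> \<int>"
    using m backward_slope_eq[OF m] by simp_all
qed

lemma forward_slope_const [simp]: "forward_slope (\<lambda>_. c) t = 0"
  by (rule forward_slope_eq[OF has_fwd_const])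

lemma backward_slope_const [simp]: "backward_slope (\<lambda>_. c) t = 0"
  by (rule backward_slope_eq[OF has_bwd_const])

lemma forward_slope_diff:
  assumes "integer_piecewise_linear f" "integer_piecewise_linear g" "0 \<le> t" "t < 1"
  shows "forward_slope (\<lambda>s. f s - g s) t = forward_slope f t - forward_slope g t"
  using assms by (intro forward_slope_eq has_fwd_diff ipl_forward)

lemma backward_slope_diff:
  assumes "integer_piecewise_linear f" "integer_piecewise_linear g" "0 < t" "t \<le> 1"
  shows "backward_slope (\<lambda>s. f s - g s) t = backward_slope f t - backward_slope g t"
  using assms by (intro backward_slope_eq has_bwd_diff ipl_backward)

lemma forward_slope_mono:
  assumes "integer_piecewise_linear f" "integer_piecewise_linear g" "0 \<le> t" "t < 1" "f t = g t"
    and le: "\<And>s. 0 \<le> s \<Longrightarrow> s \<le> 1 \<Longrightarrow> f s \<le> g s"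
  shows "forward_slope f t \<le> forward_slope g t"
proof (rule has_fwd_mono[OF ipl_forward(1) ipl_forward(1)])
  show "\<forall>\<^sub>F h in at_right 0. f (t + h) \<le> g (t + h)"
    unfolding eventually_at_right_0_iff using assms(3,4) by (intro exI[of _ "1 - t"]) (auto intro: le)
qed fact+

lemma backward_slope_mono:
  assumes "integer_piecewise_linear f" "integer_piecewise_linear g" "0 < t" "t \<le> 1" "f t = g t"
    and le: "\<And>s. 0 \<le> s \<Longrightarrow> s \<le> 1 \<Longrightarrow> f s \<le> g s"
  shows "backward_slope f t \<le> backward_slope g t"
proof (rule has_bwd_mono[OF ipl_backward(1) ipl_backward(1)])
  show "\<forall>\<^sub>F h in at_right 0. f (t - h) \<le> g (t - h)"
    unfolding eventually_at_right_0_iff using assms(3,4) by (intro exI[of _ t]) (auto intro: le)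
qed fact+

lemma ipl_const: "integer_piecewise_linear (\<lambda>_. c)"
proof (rule locally_linear_imp_ipl)
  show "locally_linear (\<lambda>_. c)"
    unfolding locally_linear_def using has_fwd_const[of c] has_bwd_const[of c]
    by (metis of_int_0)
qed simp

lemma ipl_diff:
  assumes "integer_piecewise_linear f" "integer_piecewise_linear g"
  shows "integer_piecewise_linear (\<lambda>s. f s - g s)"
proof (rule locally_linear_imp_ipl)
  show "locally_linear (\<lambda>s. f s - g s)"
    unfolding locally_linear_def
  proof (intro conjI allI impI)
    fix t :: real assume t: "0 \<le> t \<and> t < 1"
    obtain m n :: int where mn: "has_fwd f t (of_int m)" "has_fwd g t (of_int n)"
      using ipl_has_fwd[OF assms(1), of t] ipl_has_fwd[OF assms(2), of t] t by auto
    from has_fwd_diff[OF mn] show "\<exists>m::int. has_fwd (\<lambda>s. f s - g s) t (of_int m)"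
      by (intro exI[of _ "m - n"]) simp
  next
    fix t :: real assume t: "0 < t \<and> t \<le> 1"
    obtain m n :: int where mn: "has_bwd f t (of_int m)" "has_bwd g t (of_int n)"
      using ipl_has_bwd[OF assms(1), of t] ipl_has_bwd[OF assms(2), of t] t by auto
    from has_bwd_diff[OF mn] show "\<exists>m::int. has_bwd (\<lambda>s. f s - g s) t (of_int m)"
      by (intro exI[of _ "m - n"]) simp
  qed
  show "continuous_on {0..1} (\<lambda>s. f s - g s)"
    using assms unfolding integer_piecewise_linear_def by (intro continuous_intros) auto
qed

lemma ipl_max:
  assumes "integer_piecewise_linear f" "integer_piecewise_linear g"
  shows "integer_piecewise_linear (\<lambda>s. max (f s) (g s))"
proof (rule locally_linear_imp_ipl)
  have int: "\<exists>k::int. (if P then real_of_int m else if Q then real_of_int n else max (real_of_int m) (real_of_int n)) = of_int k"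
    for P Q and m n :: int
    by (cases P; cases Q) (auto simp flip: of_int_max)
  show "locally_linear (\<lambda>s. max (f s) (g s))"
    unfolding locally_linear_def
  proof (intro conjI allI impI)
    fix t :: real assume t: "0 \<le> t \<and> t < 1"
    obtain m n :: int where mn: "has_fwd f t (of_int m)" "has_fwd g t (of_int n)"
      using ipl_has_fwd[OF assms(1), of t] ipl_has_fwd[OF assms(2), of t] t by auto
    obtain k :: int where "(if g t < f t then real_of_int m else if f t < g t then of_int n else max (of_int m) (of_int n)) = of_int k"
      using int by blast
    from has_fwd_max[OF mn, unfolded this] show "\<exists>m::int. has_fwd (\<lambda>s. max (f s) (g s)) t (of_int m)" ..
  next
    fix t :: real assume t: "0 < t \<and> t \<le> 1"
    obtain m n :: int where mn: "has_bwd f t (of_int m)" "has_bwd g t (of_int n)"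
      using ipl_has_bwd[OF assms(1), of t] ipl_has_bwd[OF assms(2), of t] t by auto
    obtain k :: int where "(if g t < f t then real_of_int m else if f t < g t then of_int n else max (of_int m) (of_int n)) = of_int k"
      using int by blast
    from has_bwd_max[OF mn, unfolded this] show "\<exists>m::int. has_bwd (\<lambda>s. max (f s) (g s)) t (of_int m)" ..
  qed
  show "continuous_on {0..1} (\<lambda>s. max (f s) (g s))"
    using assms unfolding integer_piecewise_linear_def by (intro continuous_intros) auto
qed

text \<open>The floor serves to obtain an integer type: outgoing slopes of a rational function are
  integers at the points of the metric graph, see \<open>of_int_metric_div\<close>.\<close>

definition metric_div :: "('a, 'b) pre_digraph \<Rightarrow> (('a, 'b) metric_point \<Rightarrow> real) \<Rightarrow> ('a, 'b) metric_point \<Rightarrow> int" where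
  "metric_div G f p = \<lfloor>outgoing_slopes G f p\<rfloor>"

lemma rational_const: "rational_function G (\<lambda>_. c)"
  by (simp add: rational_function_def ipl_const)

lemma rational_diff:
  "rational_function G f \<Longrightarrow> rational_function G g \<Longrightarrow> rational_function G (\<lambda>p. f p - g p)"
  by (simp add: rational_function_def ipl_diff)

lemma rational_max:
  "rational_function G f \<Longrightarrow> rational_function G g \<Longrightarrow> rational_function G (\<lambda>p. max (f p) (g p))"
  by (simp add: rational_function_def ipl_max)

context nonempty_multigraph
begin

lemma rational_ipl: "rational_function G f \<Longrightarrow> e \<in> arcs G \<Longrightarrow> integer_piecewise_linear (\<lambda>t. f (edge_point G e t))"
  by (simp add: rational_function_def)

lemma out_arcs_arcs: "e \<in> out_arcs G v \<Longrightarrow> e \<in> arcs G" and in_arcs_arcs: "e \<in> in_arcs G v \<Longrightarrow> e \<in> arcs G"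
  by simp_all

lemma edge_point_in: "e \<in> arcs G \<Longrightarrow> 0 \<le> t \<Longrightarrow> t \<le> 1 \<Longrightarrow> edge_point G e t \<in> metric_points G"
  by (auto simp: edge_point_def metric_points_def)

lemma edge_point_simps [simp]:
  "edge_point G e 0 = Vertex (tail G e)" "edge_point G e 1 = Vertex (head G e)"
  "0 < t \<Longrightarrow> t < 1 \<Longrightarrow> edge_point G e t = Interior e t"
  by (simp_all add: edge_point_def)

lemma metric_points_cases:
  assumes "p \<in> metric_points G"
  obtains v where "v \<in> verts G" "p = Vertex v"
  | e t where "e \<in> arcs G" "0 < t" "t < 1" "p = Interior e t"
  using assms by (auto simp: metric_points_def)

lemma outgoing_slopes_int:
  assumes "rational_function G f" "p \<in> metric_points G"
  shows "outgoing_slopes G f p \<in> \<int>"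
  using assms(2)
proof (cases rule: metric_points_cases)
  case (1 v)
  then show ?thesis
    using ipl_forward(2)[OF rational_ipl[OF assms(1) out_arcs_arcs]]
      ipl_backward(2)[OF rational_ipl[OF assms(1) in_arcs_arcs]]
    by (auto intro!: Ints_add Ints_sum)
next
  case (2 e t)
  then show ?thesis
    using ipl_forward(2)[OF rational_ipl[OF assms(1)]] ipl_backward(2)[OF rational_ipl[OF assms(1)]]
    by (auto intro!: Ints_add)
qed

lemma of_int_metric_div:
  "rational_function G f \<Longrightarrow> p \<in> metric_points G \<Longrightarrow> real_of_int (metric_div G f p) = outgoing_slopes G f p"
  using outgoing_slopes_int[of f p] by (auto simp: metric_div_def elim: Ints_cases)

lemma outgoing_slopes_diff:
  assumes f: "rational_function G f" and g: "rational_function G g" and p: "p \<in> metric_points G"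
  shows "outgoing_slopes G (\<lambda>p. f p - g p) p = outgoing_slopes G f p - outgoing_slopes G g p"
  using p
proof (cases rule: metric_points_cases)
  case (1 v)
  then show ?thesis
    using forward_slope_diff[OF rational_ipl[OF f out_arcs_arcs] rational_ipl[OF g out_arcs_arcs], of _ v _ v 0]
      backward_slope_diff[OF rational_ipl[OF f in_arcs_arcs] rational_ipl[OF g in_arcs_arcs], of _ v _ v 1]
    by (simp add: sum_subtractf)
next
  case (2 e t)
  then show ?thesis
    using forward_slope_diff[OF rational_ipl[OF f] rational_ipl[OF g], of e e t]
      backward_slope_diff[OF rational_ipl[OF f] rational_ipl[OF g], of e e t] by simp
qed

lemma outgoing_slopes_mono:
  assumes f: "rational_function G f" and g: "rational_function G g" and p: "p \<in> metric_points G"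
    and eq: "f p = g p" and le: "\<And>q. q \<in> metric_points G \<Longrightarrow> f q \<le> g q"
  shows "outgoing_slopes G f p \<le> outgoing_slopes G g p"
  using p
proof (cases rule: metric_points_cases)
  case (1 v)
  have "forward_slope (\<lambda>t. f (edge_point G e t)) 0 \<le> forward_slope (\<lambda>t. g (edge_point G e t)) 0"
    if "e \<in> out_arcs G v" for e
    using that 1 eq by (intro forward_slope_mono rational_ipl[OF f] rational_ipl[OF g] le edge_point_in) auto
  moreover have "backward_slope (\<lambda>t. f (edge_point G e t)) 1 \<le> backward_slope (\<lambda>t. g (edge_point G e t)) 1"
    if "e \<in> in_arcs G v" for e
    using that 1 eq by (intro backward_slope_mono rational_ipl[OF f] rational_ipl[OF g] le edge_point_in) auto
  ultimately show ?thesis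
    using 1 by (auto intro!: add_mono sum_mono)
next
  case (2 e t)
  have "forward_slope (\<lambda>t. f (edge_point G e t)) t \<le> forward_slope (\<lambda>t. g (edge_point G e t)) t"
    using 2 eq by (intro forward_slope_mono rational_ipl[OF f] rational_ipl[OF g] le edge_point_in) auto
  moreover have "backward_slope (\<lambda>t. f (edge_point G e t)) t \<le> backward_slope (\<lambda>t. g (edge_point G e t)) t"
    using 2 eq by (intro backward_slope_mono rational_ipl[OF f] rational_ipl[OF g] le edge_point_in) auto
  ultimately show ?thesis
    using 2 by (auto intro!: add_mono)
qed

text \<open>Regrouping the slopes at the vertices by edges leaves, for each edge, the sum that the
  degree condition of \<open>linear_pieces\<close> makes zero. The finite support consists of the
  vertices and the breakpoints.\<close>

lemma metric_div_divisor:
  assumes f: "rational_function G f"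
  shows "\<exists>D\<in>divisors_on (metric_points G). divisor_degree D = 0 \<and>
    (\<forall>p\<in>metric_points G. chips D p = metric_div G f p)"
proof -
  let ?g = "\<lambda>e t. f (edge_point G e t)"
  have "\<forall>e\<in>arcs G. \<exists>S. linear_pieces (?g e) 0 1 S"
    using locally_linear_pieces[OF ipl_locally_linear[OF rational_ipl[OF f]]] by blast
  then have "\<exists>S. \<forall>e\<in>arcs G. linear_pieces (?g e) 0 1 (S e)"
    by (rule bchoice)
  then obtain S where S0: "\<forall>e\<in>arcs G. linear_pieces (?g e) 0 1 (S e)" ..
  have S: "finite (S e)" "S e \<subseteq> {0<..<1}" "\<And>t. t \<in> {0<..<1} - S e \<Longrightarrow> kink (?g e) t = 0"
    "forward_slope (?g e) 0 + backward_slope (?g e) 1 + (\<Sum>t\<in>S e. kink (?g e) t) = 0"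
    if "e \<in> arcs G" for e
    using bspec[OF S0 that] unfolding linear_pieces_def by simp_all
  let ?I = "(\<lambda>(e, t). Interior e t) ` Sigma (arcs G) S"
  let ?V = "Vertex ` verts G :: ('a, 'b) metric_point set"
  let ?K = "?V \<union> ?I"
  have fin: "finite ?V" "finite ?I" using S(1) by auto
  have K: "?K \<subseteq> metric_points G" using S(2) by (force simp: metric_points_def)
  have "real_of_int (\<Sum>p\<in>?K. metric_div G f p) = (\<Sum>p\<in>?K. outgoing_slopes G f p)"
    using K f by (auto simp: of_int_metric_div intro!: sum.cong)
  also have "\<dots> = (\<Sum>p\<in>?V. outgoing_slopes G f p) + (\<Sum>p\<in>?I. outgoing_slopes G f p)"
    by (rule sum.union_disjoint) (use fin in auto)
  also have "(\<Sum>p\<in>?V. outgoing_slopes G f p) = (\<Sum>v\<in>verts G. outgoing_slopes G f (Vertex v))"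
    by (subst sum.reindex) (auto intro: inj_onI)
  also have "\<dots> = (\<Sum>e\<in>arcs G. forward_slope (?g e) 0) + (\<Sum>e\<in>arcs G. backward_slope (?g e) 1)"
    by (simp add: sum.distrib sum_out_arcs sum_in_arcs)
  also have "(\<Sum>p\<in>?I. outgoing_slopes G f p) = (\<Sum>(e, t)\<in>Sigma (arcs G) S. kink (?g e) t)"
    by (subst sum.reindex) (auto intro!: inj_onI sum.cong simp: kink_def)
  also have "\<dots> = (\<Sum>e\<in>arcs G. \<Sum>t\<in>S e. kink (?g e) t)"
    by (subst sum.Sigma) (auto simp: S(1))
  also have "(\<Sum>e\<in>arcs G. forward_slope (?g e) 0) + (\<Sum>e\<in>arcs G. backward_slope (?g e) 1) + \<dots> = 0"
    unfolding sum.distrib[symmetric] using S(4) by simp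
  finally have deg: "(\<Sum>p\<in>?K. metric_div G f p) = 0" by (simp only: of_int_eq_0_iff)
  obtain D where D: "D \<in> divisors_on ?K" "\<forall>p. chips D p = (if p \<in> ?K then metric_div G f p else 0)"
    "divisor_degree D = (\<Sum>p\<in>?K. metric_div G f p)"
    using divisor_of_function[of ?K "metric_div G f"] fin by blast
  have "metric_div G f p = 0" if p: "p \<in> metric_points G" "p \<notin> ?K" for p
    using p(1)
  proof (cases rule: metric_points_cases)
    case (1 v)
    then show ?thesis using p(2) by auto
  next
    case (2 e t)
    then have "t \<in> {0<..<1} - S e" using p(2) by force
    then show ?thesis using S(3)[of e t] 2 by (simp add: metric_div_def kink_def)
  qed
  then have "\<forall>p\<in>metric_points G. chips D p = metric_div G f p"
    using D(2) by simp
  moreover have "D \<in> divisors_on (metric_points G)"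
    using D(1) K unfolding divisors_on_def by blast
  ultimately show ?thesis
    using D(3) deg by auto
qed

sublocale metric: chip_firing "metric_points G" "{f. rational_function G f}" "metric_div G"
proof
  show "metric_points G \<noteq> {}" using verts_nonempty by (auto simp: metric_points_def)
  show "metric_div G (\<lambda>_. c) p = 0" if "p \<in> metric_points G" for c p
    using that by (cases rule: metric_points_cases) (simp_all add: metric_div_def)
  fix f g p assume f: "f \<in> {f. rational_function G f}" and g: "g \<in> {f. rational_function G f}"
    and p: "p \<in> metric_points G"
  have "real_of_int (metric_div G (\<lambda>p. f p - g p) p) = real_of_int (metric_div G f p - metric_div G g p)"
    using f g p by (simp add: of_int_metric_div outgoing_slopes_diff rational_diff)
  then show "metric_div G (\<lambda>p. f p - g p) p = metric_div G f p - metric_div G g p"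
    by (simp only: of_int_eq_iff)
  show "metric_div G f p \<le> metric_div G g p" if "f p = g p" "\<And>q. q \<in> metric_points G \<Longrightarrow> f q \<le> g q"
    unfolding metric_div_def using f g p that by (intro floor_mono outgoing_slopes_mono) auto
qed (simp_all add: rational_const rational_diff rational_max metric_div_divisor)

lemma metric_principal_divisors_eq: "metric_principal_divisors G = metric.principal"
proof (rule set_eqI)
  fix D
  have "(\<forall>p\<in>metric_points G. real_of_int (chips D p) = outgoing_slopes G f p) \<longleftrightarrow>
      (\<forall>p\<in>metric_points G. chips D p = metric_div G f p)" if "rational_function G f" for f
    using that by (auto simp: of_int_metric_div[symmetric])
  then show "D \<in> metric_principal_divisors G \<longleftrightarrow> D \<in> metric.principal"
    unfolding metric_principal_divisors_def metric.principal_def by blast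
qed

lemma metric_dgon_eq: "metric_dgon G = gonality (metric_points G) metric.principal"
  by (simp add: metric_dgon_def metric_principal_divisors_eq)

end

section \<open>Cuts enforced by divisors of positive rank\<close>

lemma forward_slope_reflect: "forward_slope (\<lambda>s. g (1 - s)) t = backward_slope g (1 - t)"
  by (simp add: forward_slope_def backward_slope_def algebra_simps)

lemma backward_slope_reflect_1: "backward_slope (\<lambda>s. g (1 - s)) t = forward_slope g (1 - t)"
  by (simp add: forward_slope_def backward_slope_def algebra_simps)

lemma forward_slope_nonpos:
  assumes "integer_piecewise_linear g" "0 \<le> t" "t < 1" "g t = 0" "\<And>s. 0 \<le> s \<Longrightarrow> s \<le> 1 \<Longrightarrow> g s \<le> 0"
  shows "forward_slope g t \<le> 0"
  using forward_slope_mono[OF assms(1) ipl_const[of 0] assms(2,3)] assms(4,5) by simp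

lemma backward_slope_nonpos:
  assumes "integer_piecewise_linear g" "0 < t" "t \<le> 1" "g t = 0" "\<And>s. 0 \<le> s \<Longrightarrow> s \<le> 1 \<Longrightarrow> g s \<le> 0"
  shows "backward_slope g t \<le> 0"
  using backward_slope_mono[OF assms(1) ipl_const[of 0] assms(2,3)] assms(4,5) by simp

text \<open>
  At its last zero g has negative forward slope; if that zero were interior, it would be a point
  of negative kink.
\<close>

lemma forward_slope_le_minus_1:
  assumes ipl: "integer_piecewise_linear g" and le: "\<And>s. 0 \<le> s \<Longrightarrow> s \<le> 1 \<Longrightarrow> g s \<le> 0"
    and g0: "g 0 = 0" and g1: "g 1 < 0" and kink: "\<And>t. 0 < t \<Longrightarrow> t < 1 \<Longrightarrow> kink g t \<ge> 0"
  shows "forward_slope g 0 \<le> -1"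
proof -
  let ?Z = "{t \<in> {0..1}. g t = 0}"
  have cont: "continuous_on {0..1} g" using ipl by (simp add: integer_piecewise_linear_def)
  have "closed (g -` {0} \<inter> {0..1})"
    using cont continuous_on_closed_vimage[of "{0..1}" g] by auto
  then have "compact ({0..1} \<inter> (g -` {0} \<inter> {0..1}))"
    by (intro compact_Int_closed) auto
  moreover have "{0..1} \<inter> (g -` {0} \<inter> {0..1}) = ?Z" by auto
  ultimately have "compact ?Z" by simp
  moreover have "0 \<in> ?Z" using g0 by simp
  ultimately obtain z where z: "z \<in> ?Z" "\<forall>t\<in>?Z. t \<le> z"
    using compact_attains_sup[of ?Z] by blast
  then have z1: "z < 1" using g1 by (cases "z = 1") auto
  have fw: "has_fwd g z (forward_slope g z)" "forward_slope g z \<in> \<int>"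
    using ipl_forward[OF ipl] z z1 by auto
  have "forward_slope g z \<noteq> 0"
  proof
    assume "forward_slope g z = 0"
    then obtain e where e: "e > 0" "\<And>h. 0 < h \<and> h < e \<Longrightarrow> g (z + h) = g z"
      using fw(1) unfolding has_fwd_def eventually_at_right_0_iff by auto
    define h where "h = min (e / 2) ((1 - z) / 2)"
    have h: "0 < h" "h < e" "z + h \<le> 1" using e z1 by (auto simp: h_def min_def field_simps)
    then have "z + h \<in> ?Z" using e(2)[of h] z by auto
    then show False using z(2) h by auto
  qed
  moreover have "forward_slope g z \<le> 0"
    by (rule forward_slope_nonpos[OF ipl]) (use z z1 le in auto)
  ultimately have fs: "forward_slope g z \<le> -1"
    using fw(2) by (auto elim!: Ints_cases)
  show ?thesis
  proof (cases "z = 0")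
    case True then show ?thesis using fs by simp
  next
    case False
    then have "backward_slope g z \<le> 0"
      by (intro backward_slope_nonpos[OF ipl]) (use z le in auto)
    then show ?thesis using kink[of z] False z z1 fs by (simp add: kink_def)
  qed
qed

lemma backward_slope_le_minus_1:
  assumes ipl: "integer_piecewise_linear g" and le: "\<And>s. 0 \<le> s \<Longrightarrow> s \<le> 1 \<Longrightarrow> g s \<le> 0"
    and g0: "g 0 < 0" and g1: "g 1 = 0" and kink: "\<And>t. 0 < t \<Longrightarrow> t < 1 \<Longrightarrow> kink g t \<ge> 0"
  shows "backward_slope g 1 \<le> -1"
proof -
  have "forward_slope (\<lambda>s. g (1 - s)) 0 \<le> -1"
  proof (rule forward_slope_le_minus_1[OF ipl_reflect[OF ipl]])
    show "kink (\<lambda>s. g (1 - s)) t \<ge> 0" if "0 < t" "t < 1" for t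
      using kink[of "1 - t"] that by (simp add: kink_def forward_slope_reflect backward_slope_reflect_1)
  qed (use le g0 g1 in auto)
  then show ?thesis by (simp add: forward_slope_reflect)
qed

context nonempty_multigraph
begin

text \<open>The number of chips that \<open>u\<close> has to hold itself; a cut edge in
  \<open>C\<close> is charged to the chip in its interior instead.\<close>

definition cut_degree :: "'b set \<Rightarrow> 'a set \<Rightarrow> 'a \<Rightarrow> nat" where
  "cut_degree C U u = card {e \<in> arcs G. u \<in> edge_ends G e \<and> \<not> edge_ends G e \<subseteq> U \<and> e \<notin> C}"

text \<open>
  What a divisor of positive rank leaves behind: d counts chips on vertices and C is the set of
  edges carrying an interior chip.
\<close>

definition cut_configuration :: "'a \<Rightarrow> 'a set \<Rightarrow> ('a \<Rightarrow> int) \<Rightarrow> 'b set \<Rightarrow> bool" where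
  "cut_configuration z Q d C \<longleftrightarrow> C \<subseteq> arcs G \<and> (\<forall>v\<in>verts G. d v \<ge> 0) \<and>
     (\<forall>q\<in>Q. d q = 0 \<longrightarrow> (\<exists>U\<subseteq>verts G. z \<in> U \<and> q \<notin> U \<and> (\<forall>u\<in>U. int (cut_degree C U u) \<le> d u)))"

text \<open>\<open>U\<close> is the set where the dominated witness \<open>y\<close> attains its
  maximum 0. A vertex of \<open>U\<close> cannot gain chips, so an empty \<open>q\<close> that must
  receive one lies outside; since the result is effective, each vertex of \<open>U\<close> can
  afford all its edges leaving \<open>U\<close>.\<close>

lemma discrete_cut_configuration:
  assumes D: "D \<in> divisors_on (verts G)" "positive_rank D"
    and z: "z \<in> verts G" and Q: "Q \<noteq> {}" "Q \<subseteq> verts G"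
  shows "\<exists>d. cut_configuration z Q d {} \<and> (\<Sum>v\<in>verts G. d v) = divisor_degree D"
proof -
  have fQ: "finite Q" using finite_subset[OF Q(2) finite_verts] .
  obtain D' where D': "D' \<in> divisors_on (verts G)" "effective D'" "divisor_degree D' = divisor_degree D"
    and y: "\<And>q. q \<in> Q \<Longrightarrow> \<exists>y\<in>UNIV. y z = 0 \<and> (\<forall>p\<in>verts G. y p \<le> 0) \<and>
       (\<forall>p\<in>verts G. chips D' p + graph_div G y p \<ge> (if p = q then 1 else 0))"
    by (rule positive_rank_dominated[OF D z fQ Q]) (rule that)
  have "cut_configuration z Q (chips D') {}"
    unfolding cut_configuration_def
  proof (intro conjI ballI impI)
    fix q assume q: "q \<in> Q" "chips D' q = 0"
    obtain y where y: "y z = 0" "\<forall>p\<in>verts G. y p \<le> 0"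
      "\<forall>p\<in>verts G. chips D' p + graph_div G y p \<ge> (if p = q then 1 else 0)"
      using y[OF q(1)] by blast
    let ?U = "{v \<in> verts G. y v = 0}"
    have cd: "cut_degree {} ?U u \<le> links u {v. y v < 0}" if "u \<in> ?U" for u
    proof -
      have "{e \<in> arcs G. u \<in> edge_ends G e \<and> \<not> edge_ends G e \<subseteq> ?U} \<subseteq>
        {e \<in> arcs G. u \<in> edge_ends G e \<and> edge_ends G e \<inter> {v. y v < 0} \<noteq> {}}"
      proof (rule subsetI)
        fix e assume e: "e \<in> {e \<in> arcs G. u \<in> edge_ends G e \<and> \<not> edge_ends G e \<subseteq> ?U}"
        then obtain v where v: "v \<in> edge_ends G e" "v \<notin> ?U" by auto
        then have "v \<in> verts G" using e by (auto simp: edge_ends_def)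
        then have "y v < 0" using v y(2) by (metis (mono_tags, lifting) mem_Collect_eq order_le_less)
        then show "e \<in> {e \<in> arcs G. u \<in> edge_ends G e \<and> edge_ends G e \<inter> {v. y v < 0} \<noteq> {}}"
          using e v by auto
      qed
      then show ?thesis unfolding cut_degree_def links_def by (intro card_mono) auto
    qed
    have dv: "graph_div G y u \<le> - int (links u {v. y v < 0})" if "u \<in> ?U" for u
      using that y(2) by (intro graph_div_at_maximum) auto
    have "q \<notin> ?U"
    proof
      assume "q \<in> ?U"
      then show False using dv[of q] y(3)[rule_format, of q] q by simp
    qed
    moreover have "int (cut_degree {} ?U u) \<le> chips D' u" if "u \<in> ?U" for u
    proof -
      have "0 \<le> chips D' u + graph_div G y u"
        using y(3)[rule_format, of u] that by (auto split: if_splits)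
      then show ?thesis using cd[OF that] dv[OF that] by linarith
    qed
    ultimately show "\<exists>U\<subseteq>verts G. z \<in> U \<and> q \<notin> U \<and> (\<forall>u\<in>U. int (cut_degree {} U u) \<le> chips D' u)"
      using z y(1) by (intro exI[of _ ?U]) auto
  qed (use D' in \<open>auto simp: effective_def\<close>)
  moreover have "(\<Sum>v\<in>verts G. chips D' v) = divisor_degree D"
    using divisor_degree_eq_sum[of "verts G" D'] D' by (simp add: divisors_on_def)
  ultimately show ?thesis by blast
qed

text \<open>The metric counterpart of \<open>graph_div_at_maximum\<close>. Along an edge outside
  \<open>C\<close> the function is convex, so a far end below the maximum forces a slope of at most
  -1 already at \<open>u\<close>.\<close>

lemma outgoing_slopes_at_maximum:
  assumes f: "rational_function G f" and le: "\<And>p. p \<in> metric_points G \<Longrightarrow> f p \<le> 0"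
    and u: "u \<in> verts G" "f (Vertex u) = 0"
    and C: "\<And>e t. e \<in> arcs G \<Longrightarrow> e \<notin> C \<Longrightarrow> 0 < t \<Longrightarrow> t < 1 \<Longrightarrow> outgoing_slopes G f (Interior e t) \<ge> 0"
  shows "outgoing_slopes G f (Vertex u) \<le> - real (cut_degree C {v \<in> verts G. f (Vertex v) = 0} u)"
proof -
  let ?U = "{v \<in> verts G. f (Vertex v) = 0}"
  let ?J = "{e \<in> arcs G. u \<in> edge_ends G e \<and> \<not> edge_ends G e \<subseteq> ?U \<and> e \<notin> C}"
  let ?g = "\<lambda>e t. f (edge_point G e t)"
  have le': "?g e s \<le> 0" if "e \<in> arcs G" "0 \<le> s" "s \<le> 1" for e s
    using le edge_point_in that by blast
  have out: "forward_slope (?g e) 0 \<le> (if e \<in> ?J then -1 else 0)" if e: "e \<in> out_arcs G u" for e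
  proof (cases "e \<in> ?J")
    case True
    have "f (Vertex (head G e)) \<noteq> 0" using True e u by (auto simp: edge_ends_def)
    moreover have "f (Vertex (head G e)) \<le> 0" using le'[of e 1] True by simp
    ultimately have "forward_slope (?g e) 0 \<le> -1"
      using True e u C[of e] le'[of e]
      by (intro forward_slope_le_minus_1 rational_ipl[OF f]) (auto simp: kink_def)
    then show ?thesis using True by simp
  next
    case False
    then show ?thesis
      using e u le'[of e] by (auto intro!: forward_slope_nonpos rational_ipl[OF f])
  qed
  have inn: "backward_slope (?g e) 1 \<le> (if e \<in> ?J then -1 else 0)" if e: "e \<in> in_arcs G u" for e
  proof (cases "e \<in> ?J")
    case True
    have "f (Vertex (tail G e)) \<noteq> 0" using True e u by (auto simp: edge_ends_def)
    moreover have "f (Vertex (tail G e)) \<le> 0" using le'[of e 0] True by simp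
    ultimately have "backward_slope (?g e) 1 \<le> -1"
      using True e u C[of e] le'[of e]
      by (intro backward_slope_le_minus_1 rational_ipl[OF f]) (auto simp: kink_def)
    then show ?thesis using True by simp
  next
    case False
    then show ?thesis
      using e u le'[of e] by (auto intro!: backward_slope_nonpos rational_ipl[OF f])
  qed
  have "outgoing_slopes G f (Vertex u) \<le>
      (\<Sum>e\<in>out_arcs G u. if e \<in> ?J then -1 else 0) + (\<Sum>e\<in>in_arcs G u. if e \<in> ?J then -1 else 0)"
    unfolding outgoing_slopes.simps using out inn by (intro add_mono sum_mono)
  also have "\<dots> = (\<Sum>e | e \<in> arcs G \<and> u \<in> edge_ends G e. if e \<in> ?J then -1 else 0)"
    by (rule sum_incident[symmetric])
  also have "\<dots> = (\<Sum>e\<in>?J. -1)"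
    by (rule sum.mono_neutral_cong_right) auto
  finally show ?thesis by (simp add: cut_degree_def)
qed

text \<open>As in the discrete case, with \<open>U\<close> the set of vertices at the maximum. The
  degree is only bounded, because an edge of \<open>C\<close> may carry several interior chips and
  counts once.\<close>

lemma metric_cut_configuration:
  assumes D: "D \<in> divisors_on (metric_points G)" "metric.positive_rank D"
    and z: "z \<in> verts G" and Q: "Q \<noteq> {}" "Q \<subseteq> verts G"
  shows "\<exists>d C. cut_configuration z Q d C \<and> (\<Sum>v\<in>verts G. d v) + int (card C) \<le> divisor_degree D"
proof -
  let ?X = "metric_points G"
  have fQ: "finite (Vertex ` Q :: ('a, 'b) metric_point set)" using finite_subset[OF Q(2) finite_verts] by simp
  have zX: "Vertex z \<in> ?X" and QX: "Vertex ` Q \<subseteq> ?X" "Vertex ` Q \<noteq> {}"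
    using z Q by (auto simp: metric_points_def)
  obtain D' where D': "D' \<in> divisors_on ?X" "effective D'" "divisor_degree D' = divisor_degree D"
    and y: "\<And>q. q \<in> Vertex ` Q \<Longrightarrow> \<exists>y\<in>{f. rational_function G f}. y (Vertex z) = 0 \<and> (\<forall>p\<in>?X. y p \<le> 0) \<and>
       (\<forall>p\<in>?X. chips D' p + metric_div G y p \<ge> (if p = q then 1 else 0))"
    by (rule metric.positive_rank_dominated[OF D zX fQ QX(2,1)]) (rule that)
  have nn: "chips D' p \<ge> 0" for p using D'(2) by (simp add: effective_def)
  define d where "d v = chips D' (Vertex v)" for v
  define C where "C = {e \<in> arcs G. \<exists>t. 0 < t \<and> t < 1 \<and> chips D' (Interior e t) \<ge> 1}"
  have "cut_configuration z Q d C"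
    unfolding cut_configuration_def
  proof (intro conjI ballI impI)
    fix q assume q: "q \<in> Q" "d q = 0"
    obtain y where yr: "rational_function G y" and y: "y (Vertex z) = 0" "\<forall>p\<in>?X. y p \<le> 0"
      "\<forall>p\<in>?X. chips D' p + metric_div G y p \<ge> (if p = Vertex q then 1 else 0)"
      using y[of "Vertex q"] q(1) by blast
    have pos: "real_of_int (chips D' p) + outgoing_slopes G y p \<ge> (if p = Vertex q then 1 else 0)"
      if "p \<in> ?X" for p
    proof -
      have "real_of_int (if p = Vertex q then 1 else 0) \<le> real_of_int (chips D' p + metric_div G y p)"
        using y(3) that by (simp only: of_int_le_iff)
      then show ?thesis using of_int_metric_div[OF yr that] by (simp split: if_splits)
    qed
    let ?U = "{v \<in> verts G. y (Vertex v) = 0}"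
    have VX: "Vertex v \<in> ?X" if "v \<in> verts G" for v using that by (auto simp: metric_points_def)
    have dv: "outgoing_slopes G y (Vertex u) \<le> - real (cut_degree C ?U u)" if "u \<in> ?U" for u
    proof (rule outgoing_slopes_at_maximum[OF yr])
      fix e t assume e: "e \<in> arcs G" "e \<notin> C" and t: "0 < t" "t < (1::real)"
      have "Interior e t \<in> ?X" using e t by (auto simp: metric_points_def)
      moreover have "chips D' (Interior e t) = 0"
        using e t nn[of "Interior e t"] by (force simp: C_def)
      ultimately show "0 \<le> outgoing_slopes G y (Interior e t)" using pos[of "Interior e t"] by simp
    qed (use y(2) that in auto)
    have "q \<notin> ?U"
    proof
      assume qU: "q \<in> ?U"
      then show False using dv[OF qU] pos[OF VX, of q] q by (simp add: d_def)
    qed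
    moreover have "int (cut_degree C ?U u) \<le> d u" if "u \<in> ?U" for u
    proof -
      have "0 \<le> real_of_int (d u) + outgoing_slopes G y (Vertex u)"
        using pos[OF VX, of u] that by (auto simp: d_def split: if_splits)
      then have "real_of_int (int (cut_degree C ?U u)) \<le> real_of_int (d u)" using dv[OF that] by simp
      then show ?thesis by (simp only: of_int_le_iff)
    qed
    ultimately show "\<exists>U\<subseteq>verts G. z \<in> U \<and> q \<notin> U \<and> (\<forall>u\<in>U. int (cut_degree C U u) \<le> d u)"
      using z y(1) by (intro exI[of _ ?U]) auto
  qed (auto simp: C_def d_def nn)
  moreover have "(\<Sum>v\<in>verts G. d v) + int (card C) \<le> divisor_degree D"
  proof -
    have "\<forall>e\<in>C. \<exists>t. 0 < t \<and> t < 1 \<and> chips D' (Interior e t) \<ge> 1" by (auto simp: C_def)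
    \<comment> \<open>One interior chip is selected on each edge of \<open>C\<close>; the selected
      points are distinct since they lie on distinct edges.\<close>
    then obtain t where t: "\<forall>e\<in>C. chips D' (Interior e (t e)) \<ge> 1" by metis
    have fC: "finite C" by (simp add: C_def)
    let ?I = "(\<lambda>e. Interior e (t e)) ` C"
    have "int (card C) \<le> (\<Sum>e\<in>C. chips D' (Interior e (t e)))"
      using sum_mono[of C "\<lambda>_. 1" "\<lambda>e. chips D' (Interior e (t e))"] t by simp
    also have "\<dots> = (\<Sum>p\<in>?I. chips D' p)"
      by (subst sum.reindex) (auto intro: inj_onI)
    finally have 1: "int (card C) \<le> (\<Sum>p\<in>?I. chips D' p)" .
    have 2: "(\<Sum>v\<in>verts G. d v) = (\<Sum>p\<in>Vertex ` verts G. chips D' p)"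
      unfolding d_def by (subst sum.reindex) (auto intro: inj_onI)
    have "(\<Sum>p\<in>Vertex ` verts G. chips D' p) + (\<Sum>p\<in>?I. chips D' p) =
      (\<Sum>p\<in>Vertex ` verts G \<union> ?I. chips D' p)"
      by (rule sum.union_disjoint[symmetric]) (use fC in auto)
    also have "\<dots> \<le> divisor_degree D'"
      by (rule effective_degree_ge_sum[OF D'(2)]) (use fC in auto)
    finally show ?thesis using 1 2 D'(3) by simp
  qed
  ultimately show ?thesis by blast
qed

end

section \<open>From the subdivision to the metric graph\<close>

text \<open>Its slopes add up to 1 at \<open>a\<close> and \<open>b\<close> and to -1 at
  \<open>a + h\<close> and \<open>b - h\<close> (-2 if these coincide). Subtracting it therefore
  moves one chip from each of \<open>a\<close> and \<open>b\<close> a distance \<open>h\<close>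
  towards the other.\<close>

definition trapezoid :: "real \<Rightarrow> real \<Rightarrow> real \<Rightarrow> real \<Rightarrow> real" where
  "trapezoid a b h s = max 0 (min h (min (s - a) (b - s)))"

lemma trapezoid_has_fwd:
  assumes "0 < h" "a + h \<le> b - h"
  shows "has_fwd (trapezoid a b h) s
    (if s < a then 0 else if s < a + h then 1 else if s < b - h then 0 else if s < b then -1 else 0)"
proof -
  consider "s < a" | "a \<le> s" "s < a + h" | "a + h \<le> s" "s < b - h" | "b - h \<le> s" "s < b" | "b \<le> s"
    by linarith
  then show ?thesis
  proof cases
    case 1
    then show ?thesis using assms
      by (intro has_fwd_affine[of s a]) (auto simp: trapezoid_def max_def min_def)
  next
    case 2
    then show ?thesis using assms
      by (intro has_fwd_affine[of s "a + h"]) (auto simp: trapezoid_def max_def min_def)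
  next
    case 3
    then show ?thesis using assms
      by (intro has_fwd_affine[of s "b - h"]) (auto simp: trapezoid_def max_def min_def)
  next
    case 4
    then show ?thesis using assms
      by (intro has_fwd_affine[of s b]) (auto simp: trapezoid_def max_def min_def)
  next
    case 5
    then show ?thesis using assms
      by (intro has_fwd_affine[of s "s + 1"]) (auto simp: trapezoid_def max_def min_def)
  qed
qed

lemma trapezoid_has_bwd:
  assumes "0 < h" "a + h \<le> b - h"
  shows "has_bwd (trapezoid a b h) s
    (if b < s then 0 else if b - h < s then 1 else if a + h < s then 0 else if a < s then -1 else 0)"
proof -
  have "(\<lambda>x. trapezoid a b h (- x)) = trapezoid (- b) (- a) h"
    by (rule ext) (auto simp: trapezoid_def min_def)
  moreover have "- s < - b + h \<longleftrightarrow> b - h < s" "- s < - a - h \<longleftrightarrow> a + h < s" by auto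
  ultimately show ?thesis
    using trapezoid_has_fwd[of h "- b" "- a" "- s"] assms
    unfolding has_bwd_reflect by (simp only: neg_less_iff_less)
qed

lemma trapezoid_slopes:
  assumes "0 < h" "a + h \<le> b - h"
  shows "forward_slope (trapezoid a b h) s =
      (if s < a then 0 else if s < a + h then 1 else if s < b - h then 0 else if s < b then -1 else 0)"
    and "backward_slope (trapezoid a b h) s =
      (if b < s then 0 else if b - h < s then 1 else if a + h < s then 0 else if a < s then -1 else 0)"
  using trapezoid_has_fwd[OF assms] trapezoid_has_bwd[OF assms]
  by (blast intro: forward_slope_eq backward_slope_eq)+

lemma trapezoid_ipl:
  assumes "0 < h" "a + h \<le> b - h"
  shows "integer_piecewise_linear (trapezoid a b h)"
proof (rule locally_linear_imp_ipl)
  have int: "\<exists>m::int. P (real_of_int m)" if "P x" "x \<in> \<int>" for P x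
    using that by (auto elim: Ints_cases)
  have "\<exists>m::int. has_fwd (trapezoid a b h) s (of_int m)" for s
    using trapezoid_has_fwd[OF assms, of s] by (rule int) auto
  moreover have "\<exists>m::int. has_bwd (trapezoid a b h) s (of_int m)" for s
    using trapezoid_has_bwd[OF assms, of s] by (rule int) auto
  ultimately show "locally_linear (trapezoid a b h)"
    unfolding locally_linear_def by blast
  show "continuous_on {0..1} (trapezoid a b h)"
    unfolding trapezoid_def by (intro continuous_intros)
qed

context nonempty_multigraph
begin

definition edge_bump :: "'b \<Rightarrow> real \<Rightarrow> real \<Rightarrow> real \<Rightarrow> ('a, 'b) metric_point \<Rightarrow> real" where
  "edge_bump e a b h p = (case p of Vertex v \<Rightarrow> 0 | Interior e' s \<Rightarrow> if e' = e then trapezoid a b h s else 0)"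

lemma edge_bump_edge_point:
  assumes "0 \<le> a" "b \<le> 1"
  shows "(\<lambda>s. edge_bump e a b h (edge_point G e' s)) = (if e' = e then trapezoid a b h else (\<lambda>_. 0))"
proof
  fix s
  have "trapezoid a b h 0 = 0" "trapezoid a b h 1 = 0"
    using assms by (auto simp: trapezoid_def)
  then show "edge_bump e a b h (edge_point G e' s) = (if e' = e then trapezoid a b h else (\<lambda>_. 0)) s"
    by (simp add: edge_bump_def edge_point_def)
qed

lemma edge_bump_rational:
  assumes "0 \<le> a" "b \<le> 1" "0 < h" "a + h \<le> b - h"
  shows "rational_function G (edge_bump e a b h)"
  unfolding rational_function_def
  by (auto simp: edge_bump_edge_point[OF assms(1,2)] trapezoid_ipl[OF assms(3,4)] ipl_const)

text \<open>Upper bounds are what is wanted because the bump will be subtracted; they also cover the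
  case \<open>a + h = b - h\<close>, where the two interior kinks merge.\<close>

lemma edge_bump_slopes:
  assumes e: "e \<in> arcs G" and ab: "0 \<le> a" "b \<le> 1" and h: "0 < h" "a + h \<le> b - h"
    and p: "p \<in> metric_points G"
  shows "outgoing_slopes G (edge_bump e a b h) p \<le>
      (if p = edge_point G e a \<or> p = edge_point G e b then 1 else 0)"
    and "p = edge_point G e (a + h) \<or> p = edge_point G e (b - h) \<Longrightarrow>
      outgoing_slopes G (edge_bump e a b h) p \<le> -1"
proof -
  note slopes = trapezoid_slopes[OF h]
  note bump = edge_bump_edge_point[OF ab]
  have "outgoing_slopes G (edge_bump e a b h) p \<le>
      (if p = edge_point G e a \<or> p = edge_point G e b then 1 else 0) \<and>
    (p = edge_point G e (a + h) \<or> p = edge_point G e (b - h) \<longrightarrow>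
      outgoing_slopes G (edge_bump e a b h) p \<le> -1)"
    using p
  proof (cases rule: metric_points_cases)
    case (1 v)
    have "(\<Sum>e'\<in>out_arcs G v. forward_slope (\<lambda>s. edge_bump e a b h (edge_point G e' s)) 0) =
        (\<Sum>e'\<in>out_arcs G v. if e' = e then forward_slope (trapezoid a b h) 0 else 0)"
      by (rule sum.cong) (simp_all add: bump)
    also have "\<dots> = (if tail G e = v then forward_slope (trapezoid a b h) 0 else 0)"
      using e by simp
    also have "\<dots> = (if tail G e = v \<and> a = 0 then 1 else 0)"
      unfolding slopes using ab h by auto
    finally have out: "(\<Sum>e'\<in>out_arcs G v. forward_slope (\<lambda>s. edge_bump e a b h (edge_point G e' s)) 0) =
        (if tail G e = v \<and> a = 0 then 1 else 0)" .
    have "(\<Sum>e'\<in>in_arcs G v. backward_slope (\<lambda>s. edge_bump e a b h (edge_point G e' s)) 1) =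
        (\<Sum>e'\<in>in_arcs G v. if e' = e then backward_slope (trapezoid a b h) 1 else 0)"
      by (rule sum.cong) (simp_all add: bump)
    also have "\<dots> = (if head G e = v then backward_slope (trapezoid a b h) 1 else 0)"
      using e by simp
    also have "\<dots> = (if head G e = v \<and> b = 1 then 1 else 0)"
      unfolding slopes using ab h by auto
    finally have inn: "(\<Sum>e'\<in>in_arcs G v. backward_slope (\<lambda>s. edge_bump e a b h (edge_point G e' s)) 1) =
        (if head G e = v \<and> b = 1 then 1 else 0)" .
    have "p \<noteq> edge_point G e (a + h)" "p \<noteq> edge_point G e (b - h)"
      using 1 ab h by simp_all
    moreover have "outgoing_slopes G (edge_bump e a b h) p =
        (if tail G e = v \<and> a = 0 then 1 else 0) + (if head G e = v \<and> b = 1 then 1 else 0)"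
      using 1 out inn by simp
    \<comment> \<open>For \<open>a = 0\<close> and \<open>b = 1\<close> a loop would collect both
      slopes at one vertex and exceed the bound 1.\<close>
    moreover have "tail G e \<noteq> head G e" using no_loops[OF e] .
    ultimately show ?thesis using 1 by (auto simp: edge_point_def)
  next
    case (2 e' t)
    have "outgoing_slopes G (edge_bump e a b h) p =
        (if e' = e then kink (trapezoid a b h) t else 0)"
      using 2 by (simp add: bump kink_def)
    then show ?thesis
      unfolding kink_def slopes using 2 ab h by (auto simp: edge_point_def split: if_splits)
  qed
  then show "outgoing_slopes G (edge_bump e a b h) p \<le>
      (if p = edge_point G e a \<or> p = edge_point G e b then 1 else 0)"
    "p = edge_point G e (a + h) \<or> p = edge_point G e (b - h) \<Longrightarrow>
      outgoing_slopes G (edge_bump e a b h) p \<le> -1" by blast+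
qed

lemma metric_div_edge_bump:
  assumes e: "e \<in> arcs G" and ab: "0 \<le> a" "b \<le> 1" and h: "0 < h" "a + h \<le> b - h"
    and p: "p \<in> metric_points G"
  shows "metric_div G (edge_bump e a b h) p \<le>
      (if p = edge_point G e a \<or> p = edge_point G e b then 1 else 0)"
    and "p = edge_point G e (a + h) \<or> p = edge_point G e (b - h) \<Longrightarrow>
      metric_div G (edge_bump e a b h) p \<le> -1"
  using edge_bump_slopes[OF assms] unfolding metric_div_def by (auto simp: floor_le_iff split: if_splits)

text \<open>
  Between two points that are both reached by a chip, along a segment on which the two witnesses
  differ by an affine function: either a chip crosses the segment and can be stopped at t, or chips
  can be present at both ends simultaneously and are moved towards each other.
\<close>

lemma metric_reach_between:
  fixes d :: "('a, 'b) metric_point \<Rightarrow> int"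
  assumes e: "e \<in> arcs G" and abt: "0 \<le> a" "a < t" "t < b" "b \<le> 1"
    and d: "\<And>p. p \<in> metric_points G \<Longrightarrow> d p \<ge> 0" and da: "d (edge_point G e a) \<ge> 1"
    and k: "rational_function G k" and dk: "\<And>p. p \<in> metric_points G \<Longrightarrow> d p + metric_div G k p \<ge> 0"
    and db: "d (edge_point G e b) + metric_div G k (edge_point G e b) \<ge> 1"
    and aff: "\<And>s. a \<le> s \<Longrightarrow> s \<le> b \<Longrightarrow> k (edge_point G e s) = m * s + c"
  obtains f where "rational_function G f" "\<And>p. p \<in> metric_points G \<Longrightarrow> d p + metric_div G f p \<ge> 0"
    "d (edge_point G e t) + metric_div G f (edge_point G e t) \<ge> 1"
proof -
  have tX: "edge_point G e t \<in> metric_points G" and aX: "edge_point G e a \<in> metric_points G"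
    and bX: "edge_point G e b \<in> metric_points G"
    by (rule edge_point_in[OF e]; use abt in linarith)+
  have const_pos: "d p + metric_div G (\<lambda>_. r) p \<ge> 0" if "p \<in> metric_points G" for p r
    using d[OF that] metric.dv_const[OF that, of r] by simp
  have max_pos: "d p + metric_div G (\<lambda>q. max (k q) r) p \<ge> 0" if "p \<in> metric_points G" for p r
    by (rule metric.dv_max_ge) (use that k rational_const const_pos dk in auto)
  show ?thesis
  proof (cases "m < 0")
    case True
    \<comment> \<open>Here \<open>k\<close> descends from \<open>a\<close> to \<open>b\<close>.
      Truncated from below at its value in \<open>t\<close> it turns flat there, and the kink
      \<open>- m\<close> leaves a chip at \<open>t\<close>.\<close>
    let ?r = "m * t + c"
    let ?f = "\<lambda>q. max (k q) ?r"
    have fr: "rational_function G ?f" by (intro rational_max k rational_const)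
    have f: "?f (edge_point G e s) = (if s \<le> t then m * s + c else m * t + c)" if "a \<le> s" "s \<le> b" for s
      using that True by (simp add: aff max_def)
    have "forward_slope (\<lambda>s. ?f (edge_point G e s)) t = 0"
    proof (intro forward_slope_eq has_fwd_affine[of t b] ballI)
      fix s assume "s \<in> {t..<b}"
      then show "?f (edge_point G e s) = ?f (edge_point G e t) + 0 * (s - t)"
        using abt f[of s] f[of t] by (cases "s = t") simp_all
    qed (use abt in simp)
    moreover have "backward_slope (\<lambda>s. ?f (edge_point G e s)) t = - m"
    proof (intro backward_slope_eq has_bwd_affine[of a t] ballI)
      fix s assume "s \<in> {a<..t}"
      then show "?f (edge_point G e s) = ?f (edge_point G e t) + - m * (t - s)"
        using abt f[of s] f[of t] by (simp add: algebra_simps)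
    qed (use abt in simp)
    moreover have "edge_point G e t = Interior e t" using abt by (simp add: edge_point_def)
    ultimately have "outgoing_slopes G ?f (edge_point G e t) = - m" by simp
    then have "real_of_int (metric_div G ?f (edge_point G e t)) > 0"
      using of_int_metric_div[OF fr tX] True by simp
    then have "metric_div G ?f (edge_point G e t) \<ge> 1" by linarith
    then show ?thesis using that[OF fr] max_pos d[OF tX] by fastforce
  next
    case False
    \<comment> \<open>Here \<open>k\<close> does not descend. Truncated from below at its value in
      \<open>b\<close>, it equals the constant at \<open>a\<close>, so the chip of \<open>d\<close>
      at \<open>a\<close> survives, and it equals \<open>k\<close> at \<open>b\<close>, so the chip
      that \<open>k\<close> provides there survives too.\<close>
    define r where "r = k (edge_point G e b)"
    let ?f = "\<lambda>q. max (k q) r"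
    have fr: "rational_function G ?f" by (intro rational_max k rational_const)
    have r: "r = m * b + c" using aff[of b] abt by (simp add: r_def)
    have ka: "k (edge_point G e a) \<le> r"
      using aff[of a] abt False by (simp add: r mult_left_mono)
    have "metric_div G (\<lambda>_. r) (edge_point G e a) \<le> metric_div G ?f (edge_point G e a)"
      by (rule metric.dv_mono) (use fr rational_const aX ka in auto)
    then have fa: "d (edge_point G e a) + metric_div G ?f (edge_point G e a) \<ge> 1"
      using da metric.dv_const[OF aX, of r] by simp
    have "metric_div G k (edge_point G e b) \<le> metric_div G ?f (edge_point G e b)"
      by (rule metric.dv_mono) (use fr k bX in \<open>auto simp: r_def\<close>)
    then have fb: "d (edge_point G e b) + metric_div G ?f (edge_point G e b) \<ge> 1"
      using db by simp
    \<comment> \<open>The two chips approach each other at equal speed until the first of them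
      reaches \<open>t\<close>.\<close>
    define h where "h = min (t - a) (b - t)"
    have h: "0 < h" "a + h \<le> b - h" using abt by (auto simp: h_def min_def)
    have th: "t = a + h \<or> t = b - h" by (auto simp: h_def min_def)
    let ?w = "edge_bump e a b h"
    have wr: "rational_function G ?w" using abt h by (intro edge_bump_rational) auto
    have w: "metric_div G ?w p \<le> (if p = edge_point G e a \<or> p = edge_point G e b then 1 else 0)"
      "p = edge_point G e t \<Longrightarrow> metric_div G ?w p \<le> -1" if "p \<in> metric_points G" for p
      using metric_div_edge_bump[OF e abt(1,4) h that] th by auto
    let ?g = "\<lambda>q. ?f q - ?w q"
    have gr: "rational_function G ?g" by (intro rational_diff fr wr)
    have g: "metric_div G ?g p = metric_div G ?f p - metric_div G ?w p" if "p \<in> metric_points G" for p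
      using metric.dv_diff[of ?f ?w p] fr wr that by simp
    show ?thesis
    proof (rule that[OF gr])
      show "d p + metric_div G ?g p \<ge> 0" if p: "p \<in> metric_points G" for p
        using max_pos[OF p, of r] w(1)[OF p] g[OF p] fa fb by (auto split: if_splits)
      show "d (edge_point G e t) + metric_div G ?g (edge_point G e t) \<ge> 1"
        using max_pos[OF tX, of r] w(2)[OF tX] g[OF tX] by simp
    qed
  qed
qed

end

section \<open>The subdivision inside the metric graph\<close>

lemma subdivide2_simps:
  "verts (subdivide2 G) = Inl ` verts G \<union> Inr ` arcs G"
  "arcs (subdivide2 G) = arcs G \<times> UNIV"
  "tail (subdivide2 G) (e, False) = Inl (tail G e)" "tail (subdivide2 G) (e, True) = Inr e"
  "head (subdivide2 G) (e, False) = Inr e" "head (subdivide2 G) (e, True) = Inl (head G e)"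
  by (simp_all add: subdivide2_def)

fun subdivision_point :: "'a + 'b \<Rightarrow> ('a, 'b) metric_point" where
  "subdivision_point (Inl v) = Vertex v"
| "subdivision_point (Inr e) = Interior e (1/2)"

lemma subdivision_point_inj: "inj subdivision_point"
proof (rule injI)
  fix p q :: "'a + 'b" assume "subdivision_point p = subdivision_point q"
  then show "p = q" by (cases p; cases q) auto
qed

text \<open>On each half edge of length 1/2 the slope is the difference of the values of x.\<close>

definition interpolate_edge :: "int \<Rightarrow> int \<Rightarrow> int \<Rightarrow> real \<Rightarrow> real" where
  "interpolate_edge a m b t = of_int a / 2 + t * of_int (m - a) + max 0 (t - 1/2) * of_int (b - 2 * m + a)"

definition interpolate :: "('a, 'b) pre_digraph \<Rightarrow> ('a + 'b \<Rightarrow> int) \<Rightarrow> ('a, 'b) metric_point \<Rightarrow> real" where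
  "interpolate G x p = (case p of Vertex v \<Rightarrow> of_int (x (Inl v)) / 2
     | Interior e t \<Rightarrow> interpolate_edge (x (Inl (tail G e))) (x (Inr e)) (x (Inl (head G e))) t)"

lemma interpolate_edge_left: "t \<le> 1/2 \<Longrightarrow> interpolate_edge a m b t = of_int (m - a) * t + of_int a / 2"
  by (simp add: interpolate_edge_def max_def)

lemma interpolate_edge_right:
  "1/2 \<le> t \<Longrightarrow> interpolate_edge a m b t = of_int (b - m) * t + (of_int m - of_int b / 2)"
  by (simp add: interpolate_edge_def max_def field_simps)

lemma interpolate_edge_point:
  "interpolate G x (edge_point G e t) =
     interpolate_edge (x (Inl (tail G e))) (x (Inr e)) (x (Inl (head G e))) t"
  by (simp add: interpolate_def edge_point_def interpolate_edge_left interpolate_edge_right)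

lemma interpolate_edge_forward:
  "forward_slope (interpolate_edge a m b) t = (if t < 1/2 then of_int (m - a) else of_int (b - m))"
proof (cases "t < 1/2")
  case True
  have "has_fwd (interpolate_edge a m b) t (of_int (m - a))"
    using True by (intro has_fwd_affine[of t "1/2"]) (auto simp: interpolate_edge_left algebra_simps)
  then show ?thesis using True by (simp add: forward_slope_eq)
next
  case False
  have "has_fwd (interpolate_edge a m b) t (of_int (b - m))"
    using False by (intro has_fwd_affine[of t "t + 1"]) (auto simp: interpolate_edge_right algebra_simps)
  then show ?thesis using False by (simp add: forward_slope_eq)
qed

lemma interpolate_edge_backward:
  "backward_slope (interpolate_edge a m b) t = (if t \<le> 1/2 then of_int (a - m) else of_int (m - b))"
proof (cases "t \<le> 1/2")
  case True
  have "has_bwd (interpolate_edge a m b) t (of_int (a - m))"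
    using True by (intro has_bwd_affine[of "t - 1" t]) (auto simp: interpolate_edge_left algebra_simps)
  then show ?thesis using True by (simp add: backward_slope_eq)
next
  case False
  have "has_bwd (interpolate_edge a m b) t (of_int (m - b))"
    using False by (intro has_bwd_affine[of "1/2" t]) (auto simp: interpolate_edge_right algebra_simps)
  then show ?thesis using False by (simp add: backward_slope_eq)
qed

lemma interpolate_edge_ipl: "integer_piecewise_linear (interpolate_edge a m b)"
  unfolding integer_piecewise_linear_def
proof (intro conjI exI[of _ "{1/2}"] allI impI)
  show "continuous_on {0..1} (interpolate_edge a m b)"
    unfolding interpolate_edge_def by (intro continuous_intros)
  fix u v :: real assume uv: "0 \<le> u \<and> u < v \<and> v \<le> 1 \<and> {u<..<v} \<inter> {1/2} = {}"
  then have "v \<le> 1/2 \<or> 1/2 \<le> u" by force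
  then show "\<exists>(n::int) c. \<forall>t\<in>{u<..<v}. interpolate_edge a m b t = of_int n * t + c"
  proof
    assume "v \<le> 1/2"
    then show ?thesis
      by (intro exI[of _ "m - a"] exI[of _ "of_int a / 2"] ballI interpolate_edge_left) auto
  next
    assume "1/2 \<le> u"
    then show ?thesis
      by (intro exI[of _ "b - m"] exI[of _ "of_int m - of_int b / 2"] ballI interpolate_edge_right) auto
  qed
qed simp

lemma interpolate_rational: "rational_function G (interpolate G x)"
  by (simp add: rational_function_def interpolate_edge_point interpolate_edge_ipl)

context nonempty_multigraph
begin

lemma subdivide2_multigraph: "nonempty_multigraph (subdivide2 G)"
proof
  show "finite (verts (subdivide2 G))" "finite (arcs (subdivide2 G))" "verts (subdivide2 G) \<noteq> {}"
    using verts_nonempty by (simp_all add: subdivide2_simps)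
  fix e assume e: "e \<in> arcs (subdivide2 G)"
  obtain e' h where eh: "e = (e', h)" by (cases e)
  show "tail (subdivide2 G) e \<in> verts (subdivide2 G)" "head (subdivide2 G) e \<in> verts (subdivide2 G)"
    "tail (subdivide2 G) e \<noteq> head (subdivide2 G) e"
    using e by (cases h; simp add: subdivide2_simps eh)+
qed

lemma subdivide2_out_arcs:
  "out_arcs (subdivide2 G) (Inl v) = (\<lambda>e. (e, False)) ` out_arcs G v"
  "e \<in> arcs G \<Longrightarrow> out_arcs (subdivide2 G) (Inr e) = {(e, True)}"
  by (auto simp: out_arcs_def subdivide2_def split: if_splits)

lemma subdivide2_in_arcs:
  "in_arcs (subdivide2 G) (Inl v) = (\<lambda>e. (e, True)) ` in_arcs G v"
  "e \<in> arcs G \<Longrightarrow> in_arcs (subdivide2 G) (Inr e) = {(e, False)}"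
  by (auto simp: in_arcs_def subdivide2_def split: if_splits)

lemma graph_div_subdivide2:
  "graph_div (subdivide2 G) x (Inl v) =
     (\<Sum>e\<in>out_arcs G v. x (Inr e) - x (Inl v)) + (\<Sum>e\<in>in_arcs G v. x (Inr e) - x (Inl v))"
  "e \<in> arcs G \<Longrightarrow> graph_div (subdivide2 G) x (Inr e) = x (Inl (head G e)) + x (Inl (tail G e)) - 2 * x (Inr e)"
proof -
  show "graph_div (subdivide2 G) x (Inl v) =
     (\<Sum>e\<in>out_arcs G v. x (Inr e) - x (Inl v)) + (\<Sum>e\<in>in_arcs G v. x (Inr e) - x (Inl v))"
    unfolding graph_div_def subdivide2_out_arcs subdivide2_in_arcs
    by (subst (1 2) sum.reindex) (auto intro: inj_onI simp: subdivide2_simps)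
  show "graph_div (subdivide2 G) x (Inr e) = x (Inl (head G e)) + x (Inl (tail G e)) - 2 * x (Inr e)"
    if "e \<in> arcs G"
    using that by (simp add: graph_div_def subdivide2_out_arcs subdivide2_in_arcs subdivide2_simps)
qed

lemma subdivision_point_in: "s \<in> verts (subdivide2 G) \<Longrightarrow> subdivision_point s \<in> metric_points G"
  unfolding subdivide2_simps metric_points_def by (force intro: exI[of _ "1/2"])

lemma metric_div_interpolate:
  assumes "s \<in> verts (subdivide2 G)"
  shows "metric_div G (interpolate G x) (subdivision_point s) = graph_div (subdivide2 G) x s"
proof -
  have "outgoing_slopes G (interpolate G x) (subdivision_point s) = of_int (graph_div (subdivide2 G) x s)"
  proof (cases s)
    case (Inl v)
    then show ?thesis
      by (simp add: graph_div_subdivide2 interpolate_edge_point interpolate_edge_forward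
          interpolate_edge_backward out_arcs_def in_arcs_def)
  next
    case (Inr e)
    then have "e \<in> arcs G" using assms by (auto simp: subdivide2_simps)
    with Inr show ?thesis
      by (simp add: graph_div_subdivide2 interpolate_edge_point interpolate_edge_forward interpolate_edge_backward)
  qed
  then show ?thesis by (simp add: metric_div_def)
qed

lemma metric_div_interpolate_0:
  assumes "p \<in> metric_points G" "p \<notin> subdivision_point ` verts (subdivide2 G)"
  shows "metric_div G (interpolate G x) p = 0"
  using assms(1)
proof (cases rule: metric_points_cases)
  case (1 v)
  then have "p = subdivision_point (Inl v)" "Inl v \<in> verts (subdivide2 G)"
    by (simp_all add: subdivide2_simps)
  then show ?thesis using assms(2) by blast
next
  case (2 e t)
  have "t \<noteq> 1/2"
  proof
    assume "t = 1/2"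
    then have "p = subdivision_point (Inr e)" "Inr e \<in> verts (subdivide2 G)"
      using 2 by (simp_all add: subdivide2_simps)
    then show False using assms(2) by blast
  qed
  then show ?thesis
    using 2 by (simp add: metric_div_def interpolate_edge_point interpolate_edge_forward interpolate_edge_backward)
qed

text \<open>Interpolated witnesses reach the vertices and the midpoints. They are affine on each
  half edge, so \<open>metric_reach_between\<close> reaches the remaining points from the two ends
  of the half edge containing them.\<close>

lemma metric_positive_rank_of_subdivision:
  assumes D: "D \<in> divisors_on (verts (subdivide2 G))"
    and pos: "chip_firing.positive_rank (verts (subdivide2 G)) UNIV (graph_div (subdivide2 G)) D"
  shows "\<exists>D'\<in>divisors_on (metric_points G). metric.positive_rank D' \<and> divisor_degree D' = divisor_degree D"
proof -
  interpret S: nonempty_multigraph "subdivide2 G" by (rule subdivide2_multigraph)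
  let ?V = "verts (subdivide2 G)" and ?p = "subdivision_point :: 'a + 'b \<Rightarrow> ('a, 'b) metric_point"
  obtain D' where D': "D' \<in> divisors_on (?p ` ?V)" "divisor_degree D' = divisor_degree D"
    and lk: "\<forall>s\<in>?V. chips D' (?p s) = chips D s"
    using divisor_push_forward[OF subdivision_point_inj S.finite_verts D] by blast
  have on: "D' \<in> divisors_on (metric_points G)"
    using D'(1) subdivision_point_in by (force simp: divisors_on_def)
  define R where "R f q \<longleftrightarrow> rational_function G f \<and>
    (\<forall>p\<in>metric_points G. chips D' p + metric_div G f p \<ge> (if p = q then 1 else 0))" for f q
  have vert: "\<exists>x. R (interpolate G x) (?p s)" if s: "s \<in> ?V" for s
  proof -
    obtain x where x: "\<forall>p\<in>?V. chips D p + graph_div (subdivide2 G) x p \<ge> (if p = s then 1 else 0)"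
      using pos s unfolding S.positive_rank_def by blast
    have "chips D' p + metric_div G (interpolate G x) p \<ge> (if p = ?p s then 1 else 0)"
      if p: "p \<in> metric_points G" for p
    proof (cases "p \<in> ?p ` ?V")
      case True
      then obtain u where u: "u \<in> ?V" "p = ?p u" by blast
      have "p = ?p s \<longleftrightarrow> u = s" using u(2) subdivision_point_inj by (auto dest: injD)
      moreover have "metric_div G (interpolate G x) p = graph_div (subdivide2 G) x u"
        using metric_div_interpolate[OF u(1), of x] u(2) by simp
      moreover have "chips D' p = chips D u" using lk u by simp
      ultimately show ?thesis using x u(1) by simp
    next
      case False
      then have "p \<noteq> ?p s" using s by blast
      then show ?thesis using lookup_not_on[OF D'(1) False] metric_div_interpolate_0[OF p False] by simp
    qed
    then show ?thesis unfolding R_def using interpolate_rational by blast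
  qed
  have between: "\<exists>f. R f (Interior e t)" if e: "e \<in> arcs G" and ab: "0 \<le> a" "a < t" "t < b" "b \<le> 1"
    and x: "R (interpolate G x) (edge_point G e a)" and y: "R (interpolate G y) (edge_point G e b)"
    and aff: "\<And>x. \<exists>m c. \<forall>s. a \<le> s \<and> s \<le> b \<longrightarrow> interpolate G x (edge_point G e s) = m * s + c" for e a b t x y
  proof -
    let ?f = "interpolate G x" and ?g = "interpolate G y"
    \<comment> \<open>The starting configuration is the one that the witness for the first end
      produces; the difference of the two interpolations leads from it to the configuration for the
      second end.\<close>
    let ?d = "\<lambda>p. chips D' p + metric_div G ?f p"
    let ?k = "\<lambda>p. ?g p - ?f p"
    have ends: "edge_point G e a \<in> metric_points G" "edge_point G e b \<in> metric_points G"
      by (rule edge_point_in[OF e]; use ab in linarith)+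
    have k: "rational_function G ?k" by (intro rational_diff interpolate_rational)
    have dk: "?d p + metric_div G ?k p = chips D' p + metric_div G ?g p"
      if "p \<in> metric_points G" for p
      using metric.dv_diff[of ?g ?f p] that by (simp add: interpolate_rational)
    have x': "?d p \<ge> (if p = edge_point G e a then 1 else 0)" if "p \<in> metric_points G" for p
      using x that unfolding R_def by blast
    have y': "chips D' p + metric_div G ?g p \<ge> (if p = edge_point G e b then 1 else 0)"
      if "p \<in> metric_points G" for p
      using y that unfolding R_def by blast
    obtain m1 c1 where m1: "\<forall>s. a \<le> s \<and> s \<le> b \<longrightarrow> ?f (edge_point G e s) = m1 * s + c1" using aff by blast
    obtain m2 c2 where m2: "\<forall>s. a \<le> s \<and> s \<le> b \<longrightarrow> ?g (edge_point G e s) = m2 * s + c2" using aff by blast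
    obtain f where f: "rational_function G f" "\<And>p. p \<in> metric_points G \<Longrightarrow> ?d p + metric_div G f p \<ge> 0"
      "?d (edge_point G e t) + metric_div G f (edge_point G e t) \<ge> 1"
    proof (rule metric_reach_between[OF e ab, of ?d ?k "m2 - m1" "c2 - c1"])
      show "?d p \<ge> 0" if "p \<in> metric_points G" for p using x'[OF that] by (auto split: if_splits)
      show "?d (edge_point G e a) \<ge> 1" using x'[OF ends(1)] by simp
      show "?d p + metric_div G ?k p \<ge> 0" if "p \<in> metric_points G" for p
        using y'[OF that] dk[OF that] by (auto split: if_splits)
      show "?d (edge_point G e b) + metric_div G ?k (edge_point G e b) \<ge> 1"
        using y'[OF ends(2)] dk[OF ends(2)] by simp
      show "?k (edge_point G e s) = (m2 - m1) * s + (c2 - c1)" if "a \<le> s" "s \<le> b" for s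
        using m1[rule_format, of s] m2[rule_format, of s] that by (simp add: algebra_simps)
    qed (use k in auto)
    have et: "edge_point G e t = Interior e t" using ab by simp
    have add: "metric_div G (\<lambda>p. ?f p + f p) p = metric_div G ?f p + metric_div G f p"
      if "p \<in> metric_points G" for p
      using metric.dv_add[of ?f f p] that f(1) by (simp add: interpolate_rational)
    have "rational_function G (\<lambda>p. ?f p + f p)"
      using metric.add_in[of ?f f] f(1) by (simp add: interpolate_rational)
    moreover have "chips D' p + metric_div G (\<lambda>p. ?f p + f p) p \<ge> (if p = Interior e t then 1 else 0)"
      if p: "p \<in> metric_points G" for p
      using f(2)[OF p] f(3) add[OF p] unfolding et by auto
    ultimately have "R (\<lambda>p. ?f p + f p) (Interior e t)" unfolding R_def by blast
    then show ?thesis by blast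
  qed
  have "\<exists>f. R f q" if q: "q \<in> metric_points G" for q
    using q
  proof (cases rule: metric_points_cases)
    case (1 v)
    then have "Inl v \<in> ?V" by (simp add: subdivide2_simps)
    from vert[OF this] show ?thesis using 1 by auto
  next
    case (2 e t)
    have V: "Inl (tail G e) \<in> ?V" "Inr e \<in> ?V" "Inl (head G e) \<in> ?V"
      using 2 by (simp_all add: subdivide2_simps)
    obtain x y z where x: "R (interpolate G x) (edge_point G e 0)"
      and y: "R (interpolate G y) (edge_point G e (1/2))" and z: "R (interpolate G z) (edge_point G e 1)"
      using vert[OF V(1)] vert[OF V(2)] vert[OF V(3)] by auto
    have left: "\<exists>m c. \<forall>s. 0 \<le> s \<and> s \<le> 1/2 \<longrightarrow> interpolate G x (edge_point G e s) = m * s + c" for x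
      unfolding interpolate_edge_point using interpolate_edge_left by blast
    have right: "\<exists>m c. \<forall>s. 1/2 \<le> s \<and> s \<le> 1 \<longrightarrow> interpolate G x (edge_point G e s) = m * s + c" for x
      unfolding interpolate_edge_point using interpolate_edge_right by blast
    consider "t < 1/2" | "t = 1/2" | "t > 1/2" by linarith
    then show ?thesis
    proof cases
      case a: 1
      show ?thesis using between[OF 2(1) order_refl 2(2) a _ x y left] 2(4) by auto
    next
      case 2
      then have "q = edge_point G e (1/2)" using \<open>q = Interior e t\<close> by simp
      then show ?thesis using y by blast
    next
      case a: 3
      show ?thesis using between[OF 2(1) _ a 2(3) order_refl y z right] 2(4) by auto
    qed
  qed
  then have "metric.positive_rank D'"
    unfolding metric.positive_rank_def R_def by auto
  then show ?thesis using on D'(2) by blast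
qed

end

section \<open>Relabelling\<close>

text \<open>Links the tricycle, whose vertices and edges are datatypes suited to case analysis, to a
  copy over the natural numbers. Injectivity on the whole types makes preimages of arbitrary sets
  behave well.\<close>

definition relabels ::
    "('a \<Rightarrow> 'c) \<Rightarrow> ('b \<Rightarrow> 'd) \<Rightarrow> ('a, 'b) pre_digraph \<Rightarrow> ('c, 'd) pre_digraph \<Rightarrow> bool" where
  "relabels \<phi> \<psi> H H' \<longleftrightarrow> inj \<phi> \<and> inj \<psi> \<and> verts H' = \<phi> ` verts H \<and> arcs H' = \<psi> ` arcs H \<and>
     (\<forall>e\<in>arcs H. tail H' (\<psi> e) = \<phi> (tail H e) \<and> head H' (\<psi> e) = \<phi> (head H e))"

lemma relabels_multigraph:
  assumes "relabels \<phi> \<psi> H H'" "nonempty_multigraph H"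
  shows "nonempty_multigraph H'"
proof -
  interpret H: nonempty_multigraph H by fact
  show ?thesis
  proof
    show "finite (verts H')" "finite (arcs H')" "verts H' \<noteq> {}"
      using assms(1) H.verts_nonempty by (simp_all add: relabels_def)
    fix e assume "e \<in> arcs H'"
    then obtain e' where e': "e' \<in> arcs H" "e = \<psi> e'" using assms(1) by (auto simp: relabels_def)
    then have ends: "tail H' e = \<phi> (tail H e')" "head H' e = \<phi> (head H e')" and "inj \<phi>"
      and "verts H' = \<phi> ` verts H"
      using assms(1) by (auto simp: relabels_def)
    then show "tail H' e \<in> verts H'" "head H' e \<in> verts H'" "tail H' e \<noteq> head H' e"
      using e' H.no_loops[OF e'(1)] by (simp_all add: inj_eq)
  qed
qed

lemma relabels_graph_div:
  assumes r: "relabels \<phi> \<psi> H H'"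
  shows "graph_div H' f (\<phi> u) = graph_div H (f \<circ> \<phi>) u"
proof -
  have inj: "inj \<phi>" "inj \<psi>" and arcs: "arcs H' = \<psi> ` arcs H"
    and ends: "\<And>e. e \<in> arcs H \<Longrightarrow> tail H' (\<psi> e) = \<phi> (tail H e)"
      "\<And>e. e \<in> arcs H \<Longrightarrow> head H' (\<psi> e) = \<phi> (head H e)"
    using r by (auto simp: relabels_def)
  have out: "out_arcs H' (\<phi> u) = \<psi> ` out_arcs H u"
    using inj by (auto simp: out_arcs_def arcs ends inj_eq)
  have inn: "in_arcs H' (\<phi> u) = \<psi> ` in_arcs H u"
    using inj by (auto simp: in_arcs_def arcs ends inj_eq)
  have injs: "inj_on \<psi> A" for A using inj(2) by (rule inj_on_subset) simp
  show ?thesis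
    unfolding graph_div_def out inn by (simp add: sum.reindex[OF injs] ends)
qed

lemma relabels_positive_rank:
  assumes r: "relabels \<phi> \<psi> H H'" and fin: "finite (verts H)"
    and pos: "chip_firing.positive_rank (verts H) UNIV (graph_div H) D"
    and D: "D \<in> divisors_on (verts H)"
    and H: "nonempty_multigraph H"
  shows "\<exists>D'\<in>divisors_on (verts H'). chip_firing.positive_rank (verts H') UNIV (graph_div H') D' \<and>
    divisor_degree D' = divisor_degree D"
proof -
  interpret H: nonempty_multigraph H by fact
  interpret H': nonempty_multigraph H' by (rule relabels_multigraph[OF r H])
  have inj: "inj \<phi>" and V: "verts H' = \<phi> ` verts H" using r by (auto simp: relabels_def)
  have inv: "the_inv \<phi> (\<phi> s) = s" for s by (rule the_inv_f_f[OF inj])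
  obtain D' where D': "D' \<in> divisors_on (verts H')" "divisor_degree D' = divisor_degree D"
    "\<forall>v\<in>verts H. chips D' (\<phi> v) = chips D v"
    using divisor_push_forward[OF inj fin D] unfolding V by blast
  have "H'.positive_rank D'"
    unfolding H'.positive_rank_def
  proof
    fix q' assume "q' \<in> verts H'"
    then obtain q where q: "q \<in> verts H" "q' = \<phi> q" using V by blast
    obtain x where x: "\<forall>p\<in>verts H. chips D p + graph_div H x p \<ge> (if p = q then 1 else 0)"
      using pos q(1) unfolding H.positive_rank_def by blast
    have "chips D' (\<phi> p) + graph_div H' (x \<circ> the_inv \<phi>) (\<phi> p) \<ge> (if \<phi> p = q' then 1 else 0)"
      if "p \<in> verts H" for p
    proof -
      have "(x \<circ> the_inv \<phi>) \<circ> \<phi> = x" by (rule ext) (simp add: inv)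
      then have "graph_div H' (x \<circ> the_inv \<phi>) (\<phi> p) = graph_div H x p"
        by (simp add: relabels_graph_div[OF r])
      then show ?thesis using x that q(2) D'(3) by (simp add: inj_eq[OF inj])
    qed
    then show "\<exists>f\<in>UNIV. \<forall>p\<in>verts H'. chips D' p + graph_div H' f p \<ge> (if p = q' then 1 else 0)"
      unfolding V by blast
  qed
  then show ?thesis using D' by auto
qed

lemma relabels_subdivide2:
  assumes "relabels \<phi> \<psi> H H'"
  shows "relabels (map_sum \<phi> \<psi>) (map_prod \<psi> id) (subdivide2 H) (subdivide2 H')"
proof -
  have "inj (map_sum \<phi> \<psi>)" "inj (map_prod \<psi> (id :: bool \<Rightarrow> bool))"
    using assms by (auto simp: relabels_def intro: sum.inj_map prod.inj_map)
  moreover have "tail (subdivide2 H') (map_prod \<psi> id e) = map_sum \<phi> \<psi> (tail (subdivide2 H) e) \<and>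
      head (subdivide2 H') (map_prod \<psi> id e) = map_sum \<phi> \<psi> (head (subdivide2 H) e)"
    if e: "e \<in> arcs (subdivide2 H)" for e
  proof -
    obtain e' h where "e = (e', h)" by (cases e)
    then show ?thesis using e assms by (cases h) (auto simp: subdivide2_simps relabels_def)
  qed
  moreover have "verts (subdivide2 H') = map_sum \<phi> \<psi> ` verts (subdivide2 H)"
    using assms by (simp add: subdivide2_simps relabels_def image_Un image_image)
  moreover have "arcs (subdivide2 H') = map_prod \<psi> id ` arcs (subdivide2 H)"
    using assms by (simp add: subdivide2_simps relabels_def map_prod_def image_paired_Times)
  ultimately show ?thesis unfolding relabels_def by blast
qed

text \<open>Divisors of positive rank are pushed forward along a relabelling, whereas lower bounds
  are pulled back at the level of cut configurations. No function on a metric graph has to be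
  transported.\<close>

lemma relabels_cut_configuration:
  assumes r: "relabels \<phi> \<psi> H H'" and H: "nonempty_multigraph H"
    and z: "z \<in> verts H" and Q: "Q \<subseteq> verts H"
    and cut: "nonempty_multigraph.cut_configuration H' (\<phi> z) (\<phi> ` Q) d C"
  shows "nonempty_multigraph.cut_configuration H z Q (d \<circ> \<phi>) (\<psi> -` C)"
proof -
  interpret H: nonempty_multigraph H by fact
  interpret H': nonempty_multigraph H' by (rule relabels_multigraph[OF r H])
  have inj: "inj \<phi>" "inj \<psi>" and V: "verts H' = \<phi> ` verts H" and arcs: "arcs H' = \<psi> ` arcs H"
    using r by (auto simp: relabels_def)
  have ends: "edge_ends H' (\<psi> e) = \<phi> ` edge_ends H e" if "e \<in> arcs H" for e
    using r that by (simp add: relabels_def edge_ends_def)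
  have deg: "H.cut_degree (\<psi> -` C) (\<phi> -` U) u = H'.cut_degree C U (\<phi> u)" for u U
  proof -
    have "{e \<in> arcs H'. \<phi> u \<in> edge_ends H' e \<and> \<not> edge_ends H' e \<subseteq> U \<and> e \<notin> C} =
      \<psi> ` {e \<in> arcs H. u \<in> edge_ends H e \<and> \<not> edge_ends H e \<subseteq> \<phi> -` U \<and> e \<notin> \<psi> -` C}"
    proof -
      have "\<phi> u \<in> edge_ends H' (\<psi> e) \<and> \<not> edge_ends H' (\<psi> e) \<subseteq> U \<and> \<psi> e \<notin> C \<longleftrightarrow>
          u \<in> edge_ends H e \<and> \<not> edge_ends H e \<subseteq> \<phi> -` U \<and> e \<notin> \<psi> -` C" if "e \<in> arcs H" for e
        using inj(1) that by (simp add: ends inj_image_mem_iff image_subset_iff_subset_vimage)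
      then show ?thesis unfolding arcs by blast
    qed
    then show ?thesis
      unfolding H.cut_degree_def H'.cut_degree_def
      by (simp add: card_image inj_on_subset[OF inj(2)])
  qed
  show ?thesis
    unfolding H.cut_configuration_def
  proof (intro conjI ballI impI)
    show "\<psi> -` C \<subseteq> arcs H"
    proof
      fix e assume "e \<in> \<psi> -` C"
      then have "\<psi> e \<in> \<psi> ` arcs H" using cut unfolding H'.cut_configuration_def arcs by auto
      then show "e \<in> arcs H" using inj(2) by (simp add: inj_image_mem_iff)
    qed
    show "0 \<le> (d \<circ> \<phi>) v" if "v \<in> verts H" for v
      using cut that unfolding H'.cut_configuration_def V by auto
    fix q assume "q \<in> Q" "(d \<circ> \<phi>) q = 0"
    then obtain U where U: "U \<subseteq> verts H'" "\<phi> z \<in> U" "\<phi> q \<notin> U"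
      "\<forall>u\<in>U. int (H'.cut_degree C U u) \<le> d u"
      using cut unfolding H'.cut_configuration_def by auto
    show "\<exists>U\<subseteq>verts H. z \<in> U \<and> q \<notin> U \<and> (\<forall>u\<in>U. int (H.cut_degree (\<psi> -` C) U u) \<le> (d \<circ> \<phi>) u)"
    proof (intro exI[of _ "\<phi> -` U"] conjI ballI)
      show "\<phi> -` U \<subseteq> verts H"
      proof
        fix v assume "v \<in> \<phi> -` U"
        then have "\<phi> v \<in> \<phi> ` verts H" using U(1) V by auto
        then show "v \<in> verts H" using inj(1) by (simp add: inj_image_mem_iff)
      qed
    qed (use U in \<open>auto simp: deg\<close>)
  qed
qed

section \<open>The tricycle\<close>

datatype vertex = Hub | Port nat bool nat | Aux nat bool nat

text \<open>The spokes of a blob end in distinct auxiliary vertices, which keeps the graph simple.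
  The fans join a port to all auxiliary vertices of its Boolean, so every index \<open>l\<close>
  yields a connection between any two ports of the blob.\<close>

datatype edge = Thin nat nat | Spoke nat nat | Fan nat bool nat nat | Link nat nat

instance vertex :: countable by countable_datatype

instance edge :: countable by countable_datatype

fun edge_tail :: "edge \<Rightarrow> vertex" where
  "edge_tail (Thin j i) = Port j False i"
| "edge_tail (Spoke j l) = Hub"
| "edge_tail (Fan j b i l) = Port j b i"
| "edge_tail (Link j l) = Aux j False l"

fun edge_head :: "edge \<Rightarrow> vertex" where
  "edge_head (Thin j i) = Port (Suc j mod 3) True i"
| "edge_head (Spoke j l) = Aux j False l"
| "edge_head (Fan j b i l) = Aux j b l"
| "edge_head (Link j l) = Aux j True l"

text \<open>
  The Boolean of a port tells whether its thin edge comes from the previous blob (True) or leads to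
  the next one (False). Within a blob the ports are tied together by 6k disjoint connections through
  pairs of auxiliary vertices, one for each Boolean; this keeps the graph bipartite although the
  three blobs form a triangle.
\<close>

definition tricycle :: "nat \<Rightarrow> (vertex, edge) pre_digraph" where
  "tricycle k = \<lparr>
     verts = {Hub} \<union> {Port j b i | j b i. j < 3 \<and> i < k} \<union> {Aux j b l | j b l. j < 3 \<and> l < 6 * k},
     arcs = {Thin j i | j i. j < 3 \<and> i < k} \<union> {Spoke j l | j l. j < 3 \<and> l < 2 * k} \<union>
       {Fan j b i l | j b i l. j < 3 \<and> i < k \<and> l < 6 * k} \<union> {Link j l | j l. j < 3 \<and> l < 6 * k},
     tail = edge_tail, head = edge_head \<rparr>"

lemma tricycle_verts [simp]:
  "Hub \<in> verts (tricycle k)" "Port j b i \<in> verts (tricycle k) \<longleftrightarrow> j < 3 \<and> i < k"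
  "Aux j b l \<in> verts (tricycle k) \<longleftrightarrow> j < 3 \<and> l < 6 * k"
  by (auto simp: tricycle_def)

lemma tricycle_arcs [simp]:
  "Thin j i \<in> arcs (tricycle k) \<longleftrightarrow> j < 3 \<and> i < k" "Spoke j l \<in> arcs (tricycle k) \<longleftrightarrow> j < 3 \<and> l < 2 * k"
  "Fan j b i l \<in> arcs (tricycle k) \<longleftrightarrow> j < 3 \<and> i < k \<and> l < 6 * k"
  "Link j l \<in> arcs (tricycle k) \<longleftrightarrow> j < 3 \<and> l < 6 * k"
  by (auto simp: tricycle_def)

lemma tricycle_ends [simp]: "tail (tricycle k) = edge_tail" "head (tricycle k) = edge_head"
  by (simp_all add: tricycle_def)

lemma tricycle_finite: "finite (verts (tricycle k))" "finite (arcs (tricycle k))"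
proof -
  have "v \<in> {Hub} \<union> (\<lambda>(j, b, i). Port j b i) ` ({..<3} \<times> UNIV \<times> {..<k}) \<union>
      (\<lambda>(j, b, i). Aux j b i) ` ({..<3} \<times> UNIV \<times> {..<6 * k})" if "v \<in> verts (tricycle k)" for v
    using that by (cases v) (simp_all add: image_iff Bex_def)
  then show "finite (verts (tricycle k))"
    by (rule finite_subset[OF subsetI]) (assumption, simp)
  have "e \<in> (\<lambda>(j, i). Thin j i) ` ({..<3} \<times> {..<k}) \<union>
      (\<lambda>(j, l). Spoke j l) ` ({..<3} \<times> {..<2 * k}) \<union>
      (\<lambda>(j, b, i, l). Fan j b i l) ` ({..<3} \<times> UNIV \<times> {..<k} \<times> {..<6 * k}) \<union>
      (\<lambda>(j, l). Link j l) ` ({..<3} \<times> {..<6 * k})" if "e \<in> arcs (tricycle k)" for e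
    using that by (cases e) (simp_all add: image_iff Bex_def)
  then show "finite (arcs (tricycle k))"
    by (rule finite_subset[OF subsetI]) (assumption, simp)
qed

lemma tricycle_multigraph: "nonempty_multigraph (tricycle k)"
proof
  fix e assume "e \<in> arcs (tricycle k)"
  then show "tail (tricycle k) e \<in> verts (tricycle k)" "head (tricycle k) e \<in> verts (tricycle k)"
    "tail (tricycle k) e \<noteq> head (tricycle k) e"
    by (cases e; simp)+
next
  show "verts (tricycle k) \<noteq> {}" using tricycle_verts(1) by blast
qed (simp_all add: tricycle_finite)

section \<open>Cuts and the chips that pay for them\<close>

context nonempty_multigraph
begin

definition crosses :: "'a set \<Rightarrow> 'b \<Rightarrow> bool" where
  "crosses U e \<longleftrightarrow> e \<in> arcs G \<and> (tail G e \<in> U \<longleftrightarrow> head G e \<notin> U)"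

lemma crossing_chip:
  assumes "crosses U e" "e \<notin> C" "u \<in> edge_ends G e" "u \<in> U" "int (cut_degree C U u) \<le> d u"
  shows "1 \<le> d u"
proof -
  have "e \<in> {e \<in> arcs G. u \<in> edge_ends G e \<and> \<not> edge_ends G e \<subseteq> U \<and> e \<notin> C}"
    using assms(1-4) by (auto simp: crosses_def edge_ends_def)
  then have "cut_degree C U u > 0" unfolding cut_degree_def by (subst card_gt_0_iff) auto
  then show ?thesis using assms(5) by linarith
qed

text \<open>Every crossing edge is charged either to its end in \<open>U\<close>, which holds enough
  chips for all its uncovered edges, or to itself as a member of \<open>C\<close>.\<close>

lemma cut_size_le:
  assumes U: "U \<subseteq> verts G" and deg: "\<forall>u\<in>U. int (cut_degree C U u) \<le> d u"
    and d: "\<forall>v\<in>verts G. d v \<ge> 0" and C: "C \<subseteq> arcs G"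
  shows "int (card {e. crosses U e}) \<le> (\<Sum>v\<in>verts G. d v) + int (card C)"
proof -
  let ?J = "\<lambda>u. {e \<in> arcs G. u \<in> edge_ends G e \<and> \<not> edge_ends G e \<subseteq> U \<and> e \<notin> C}"
  have finU: "finite U" and finC: "finite C"
    using finite_subset[OF U finite_verts] finite_subset[OF C finite_arcs] .
  have sub: "{e. crosses U e} \<subseteq> (\<Union>u\<in>U. ?J u) \<union> C"
    by (auto simp: crosses_def edge_ends_def)
  have "card {e. crosses U e} \<le> card ((\<Union>u\<in>U. ?J u) \<union> C)"
    by (rule card_mono[OF _ sub]) (use finU finC in auto)
  also have "\<dots> \<le> card (\<Union>u\<in>U. ?J u) + card C" by (rule card_Un_le)
  also have "card (\<Union>u\<in>U. ?J u) \<le> (\<Sum>u\<in>U. card (?J u))" by (rule card_UN_le[OF finU])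
  finally have "int (card {e. crosses U e}) \<le> (\<Sum>u\<in>U. int (cut_degree C U u)) + int (card C)"
    by (simp add: cut_degree_def flip: of_nat_sum of_nat_add)
  also have "(\<Sum>u\<in>U. int (cut_degree C U u)) \<le> (\<Sum>u\<in>U. d u)"
    using deg by (intro sum_mono) auto
  also have "(\<Sum>u\<in>U. d u) \<le> (\<Sum>v\<in>verts G. d v)"
    using U d by (intro sum_mono2) auto
  finally show ?thesis by simp
qed

text \<open>The labels stand for edge-disjoint paths, each of which has a crossing edge. As a label
  is a function of the edge, disjointness is built in.\<close>

lemma crossing_labels:
  assumes "finite L" "\<And>x. x \<in> L \<Longrightarrow> \<exists>e. crosses U e \<and> lab e = x"
  shows "card L \<le> card {e. crosses U e}"
proof (rule surj_card_le)
  show "finite {e. crosses U e}" by (rule finite_subset[of _ "arcs G"]) (auto simp: crosses_def)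
  show "L \<subseteq> lab ` {e. crosses U e}" using assms(2) by force
qed

end

section \<open>Lower bounds for the tricycle\<close>

locale tricycle_graph =
  fixes k :: nat
  assumes k_pos: "0 < k"

sublocale tricycle_graph \<subseteq> nonempty_multigraph "tricycle k"
  by (rule tricycle_multigraph)

context tricycle_graph
begin

abbreviation "V \<equiv> verts (tricycle k)"

abbreviation "E \<equiv> arcs (tricycle k)"

text \<open>For each \<open>l\<close> the two ports are joined by a path through the auxiliary
  vertices of index \<open>l\<close>, using the link if the Booleans differ. Paths of different
  index share no edge.\<close>

lemma blob_split_cut:
  assumes j: "j < 3" and i: "i < k" "i' < k" and U: "Port j b i \<in> U" "Port j b' i' \<notin> U"
  shows "6 * k \<le> card {e. crosses U e}"
proof -
  define lab where "lab e = (case e of Fan j b i l \<Rightarrow> l | Link j l \<Rightarrow> l | _ \<Rightarrow> 0)" for e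
  have "\<exists>e. crosses U e \<and> lab e = l" if l: "l < 6 * k" for l
  proof -
    have "crosses U (Fan j b i l) \<or> crosses U (Fan j b' i' l) \<or> crosses U (Link j l)"
      using j i l U by (cases b; cases b') (auto simp: crosses_def)
    then show ?thesis by (auto simp: lab_def)
  qed
  then have "card {..<6 * k} \<le> card {e. crosses U e}"
    by (intro crossing_labels) auto
  then show ?thesis by simp
qed

text \<open>Each of the three blobs accounts for \<open>2 * k\<close> crossings: a blob outside
  \<open>U\<close> by the paths from the hub over an auxiliary vertex to port 0, and blob
  \<open>c\<close>, if it lies in \<open>U\<close>, by its \<open>k\<close> outgoing and
  \<open>k\<close> incoming thin edges.\<close>

lemma two_blobs_cut:
  assumes hub: "Hub \<in> U" and c: "c < 3"
    and out: "\<And>j b i. j < 3 \<Longrightarrow> j \<noteq> c \<Longrightarrow> i < k \<Longrightarrow> Port j b i \<notin> U"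
    and c_cases: "(\<forall>b. \<forall>i<k. Port c b i \<in> U) \<or> (\<forall>b. \<forall>i<k. Port c b i \<notin> U)"
  shows "6 * k \<le> card {e. crosses U e}"
proof -
  \<comment> \<open>In the second component, outgoing thin edges of blob \<open>c\<close> get the
    values below \<open>k\<close>, incoming ones those from \<open>k\<close> on. It suffices that
    every label occurs on a crossing edge, so the dummy values on other edges do no harm.\<close>
  define lab where "lab e = (case e of Spoke j l \<Rightarrow> (j, l) | Fan j b i l \<Rightarrow> (j, l)
    | Thin j i \<Rightarrow> (c, if j = c then i else k + i) | Link j l \<Rightarrow> (0, 0))" for e
  have spoke: "\<exists>e. crosses U e \<and> lab e = (j, l)"
    if "j < 3" "l < 2 * k" "\<And>b i. i < k \<Longrightarrow> Port j b i \<notin> U" for j l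
  proof -
    have "crosses U (Spoke j l) \<or> crosses U (Fan j False 0 l)"
      using that(1,2) that(3)[of 0 False] hub k_pos by (auto simp: crosses_def)
    then show ?thesis by (auto simp: lab_def)
  qed
  have "\<exists>e. crosses U e \<and> lab e = (j, l)" if jl: "j < 3" "l < 2 * k" for j l
  proof (cases "j \<noteq> c \<or> (\<forall>b. \<forall>i<k. Port c b i \<notin> U)")
    case True
    then show ?thesis using spoke[OF jl] out[OF jl(1)] by metis
  next
    case False
    then have jc: "j = c" and inn: "\<And>b i. i < k \<Longrightarrow> Port c b i \<in> U" using c_cases by auto
    show ?thesis
    proof (cases "l < k")
      case True
      have "Suc c mod 3 \<noteq> c" "Suc c mod 3 < 3" using c by (auto simp: mod_Suc)
      then have "crosses U (Thin c l)"
        using inn[OF True] out[of "Suc c mod 3" l True] True c by (auto simp: crosses_def)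
      then show ?thesis using True jc by (auto simp: lab_def)
    next
      case False
      \<comment> \<open>The predecessor of \<open>c\<close> on the cycle, from which the incoming
        thin edges start.\<close>
      define a where "a = (if c = 0 then 2 else c - 1)"
      have a: "a < 3" "a \<noteq> c" "Suc a mod 3 = c"
        using c by (auto simp: a_def)
      have l: "l - k < k" using False jl by simp
      then have "crosses U (Thin a (l - k))"
        using inn[OF l] out[OF a(1,2) l] a by (auto simp: crosses_def)
      then show ?thesis using False jc a by (intro exI[of _ "Thin a (l - k)"]) (auto simp: lab_def)
    qed
  qed
  then have "card ({..<3::nat} \<times> {..<2 * k}) \<le> card {e. crosses U e}"
    by (intro crossing_labels[where lab = lab]) auto
  then show ?thesis by (simp add: card_cartesian_product)
qed

end

section \<open>Counting chips around deficient blobs\<close>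

locale tricycle_cut = tricycle_graph +
  fixes d :: "vertex \<Rightarrow> int" and C :: "edge set"
  assumes cut: "cut_configuration Hub {Port j b i | j b i. j < 3 \<and> i < k} d C"
begin

abbreviation total :: int where
  "total \<equiv> (\<Sum>v\<in>V. d v) + int (card C)"

definition deficient :: "nat \<Rightarrow> bool" where
  "deficient j \<longleftrightarrow> (\<exists>b. \<exists>i<k. d (Port j b i) = 0)"

lemma d_nonneg: "v \<in> V \<Longrightarrow> d v \<ge> 0" and C_arcs: "C \<subseteq> E"
  using cut by (simp_all add: cut_configuration_def)

lemma C_finite: "finite C"
  using finite_subset[OF C_arcs finite_arcs] .

lemma deficient_cut:
  assumes small: "total < 6 * int k" and j: "j < 3" "deficient j"
  obtains U where "Hub \<in> U" "\<And>b i. i < k \<Longrightarrow> Port j b i \<notin> U"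
    "\<And>j' b i. j' < 3 \<Longrightarrow> j' \<noteq> j \<Longrightarrow> i < k \<Longrightarrow> Port j' b i \<in> U"
    "\<And>u. u \<in> U \<Longrightarrow> int (cut_degree C U u) \<le> d u"
proof -
  obtain b i where bi: "i < k" "d (Port j b i) = 0" using j(2) by (auto simp: deficient_def)
  then obtain U where U: "U \<subseteq> V" "Hub \<in> U" "Port j b i \<notin> U"
    "\<forall>u\<in>U. int (cut_degree C U u) \<le> d u"
    using cut j unfolding cut_configuration_def by blast
  have "int (card {e. crosses U e}) \<le> total"
    using cut_size_le[OF U(1,4) _ C_arcs] d_nonneg by blast
  then have cut_small: "\<not> 6 * k \<le> card {e. crosses U e}" using small by linarith
  have rigid: "Port j' b i \<in> U \<longleftrightarrow> Port j' b' i' \<in> U" if "j' < 3" "i < k" "i' < k" for j' b b' i i'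
    using blob_split_cut[OF that] blob_split_cut[OF that(1,3,2)] cut_small by blast
  have outj: "Port j b' i' \<notin> U" if "i' < k" for b' i'
    using rigid[OF j(1) bi(1) that] U(3) by blast
  have "Port j' b' i' \<in> U" if j': "j' < 3" "j' \<noteq> j" "i' < k" for j' b' i'
  proof (rule ccontr)
    assume "Port j' b' i' \<notin> U"
    then have outj': "Port j' b i \<notin> U" if "i < k" for b i
      using rigid[OF j'(1) j'(3) that] by blast
    \<comment> \<open>The third blob: the three indices add up to 3.\<close>
    define c where "c = 3 - j - j'"
    have c: "c < 3" using j(1) j' by (auto simp: c_def)
    have ex: "x = j \<or> x = j'" if "x < 3" "x \<noteq> c" for x
      using j(1) j' that by (auto simp: c_def)
    have "6 * k \<le> card {e. crosses U e}"
    proof (rule two_blobs_cut[OF U(2) c])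
      show "Port x b i \<notin> U" if "x < 3" "x \<noteq> c" "i < k" for x b i
        using ex[OF that(1,2)] outj[OF that(3)] outj'[OF that(3)] by blast
      show "(\<forall>b. \<forall>i<k. Port c b i \<in> U) \<or> (\<forall>b. \<forall>i<k. Port c b i \<notin> U)"
        using rigid[OF c] by blast
    qed
    then show False using cut_small by blast
  qed
  with that[OF U(2) outj] U(4) show ?thesis by blast
qed

text \<open>The chips beyond the hub that can pay for a cut across the path from the hub over
  \<open>Aux j False l\<close> to \<open>Port j False 0\<close>.\<close>

definition spoke_weight :: "nat \<Rightarrow> nat \<Rightarrow> int" where
  "spoke_weight j l = d (Aux j False l) + of_bool (Spoke j l \<in> C) + of_bool (Fan j False 0 l \<in> C)"

text \<open>Each port is an end of exactly one thin edge, so the weights of different thin edges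
  count different chips and together exhaust the ports.\<close>

definition thin_weight :: "nat \<Rightarrow> nat \<Rightarrow> int" where
  "thin_weight j i = d (Port j False i) + d (Port (Suc j mod 3) True i) + of_bool (Thin j i \<in> C)"

text \<open>The cut for blob \<open>j\<close> crosses all \<open>2 * k\<close> paths from the hub to
  port 0. A path cut at its spoke without an interior chip costs the hub one chip of its own; every
  other path has weight at least 1.\<close>

lemma spoke_bound:
  assumes small: "total < 6 * int k" and j: "j < 3" "deficient j"
  shows "2 * int k \<le> d Hub + (\<Sum>l<2 * k. spoke_weight j l)"
proof -
  obtain U where hub: "Hub \<in> U" and out: "\<And>b i. i < k \<Longrightarrow> Port j b i \<notin> U"
    and deg: "\<And>u. u \<in> U \<Longrightarrow> int (cut_degree C U u) \<le> d u"
    using deficient_cut[OF assms] by metis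
  \<comment> \<open>The spokes for which the hub itself pays. The cut degree of the hub counts all
    of them at once, so their chips are not shared.\<close>
  let ?L = "{l. l < 2 * k \<and> Aux j False l \<notin> U \<and> Spoke j l \<notin> C}"
  have fin: "finite ?L" by simp
  have "Spoke j ` ?L \<subseteq> {e \<in> E. Hub \<in> edge_ends (tricycle k) e \<and> \<not> edge_ends (tricycle k) e \<subseteq> U \<and> e \<notin> C}"
    using j by (auto simp: edge_ends_def)
  then have "card (Spoke j ` ?L) \<le> cut_degree C U Hub"
    unfolding cut_degree_def by (intro card_mono) auto
  then have L: "int (card ?L) \<le> d Hub"
    using deg[OF hub] by (simp add: card_image inj_on_def)
  have w: "spoke_weight j l \<ge> of_bool (l \<notin> ?L)" if l: "l < 2 * k" for l
  proof -
    have "d (Aux j False l) \<ge> 0" using l j by (intro d_nonneg) simp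
    moreover have "d (Aux j False l) \<ge> 1" if "Aux j False l \<in> U" "Fan j False 0 l \<notin> C"
    proof (rule crossing_chip[where C = C])
      show "crosses U (Fan j False 0 l)"
        using that out[of 0 False] k_pos l j by (simp add: crosses_def)
    qed (use that deg in \<open>auto simp: edge_ends_def\<close>)
    ultimately show ?thesis using l by (auto simp: spoke_weight_def)
  qed
  have "2 * int k = (\<Sum>l<2 * k. 1)" by simp
  also have "\<dots> = (\<Sum>l<2 * k. of_bool (l \<in> ?L) + of_bool (l \<notin> ?L))"
    by (rule sum.cong) auto
  also have "\<dots> = (\<Sum>l<2 * k. of_bool (l \<in> ?L)) + (\<Sum>l<2 * k. of_bool (l \<notin> ?L))"
    by (rule sum.distrib)
  also have "(\<Sum>l<2 * k. of_bool (l \<in> ?L)) = int (card ?L)"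
  proof -
    have "(\<Sum>l<2 * k. of_bool (l \<in> ?L)) = (\<Sum>l\<in>?L. 1::int)"
      by (rule sum.mono_neutral_cong_right) auto
    then show ?thesis by simp
  qed
  also have "\<dots> + (\<Sum>l<2 * k. of_bool (l \<notin> ?L)) \<le> d Hub + (\<Sum>l<2 * k. spoke_weight j l)"
    using L w by (intro add_mono sum_mono) auto
  finally show ?thesis .
qed

lemma port_chip: "j < 3 \<Longrightarrow> i < k \<Longrightarrow> \<not> deficient j \<Longrightarrow> d (Port j b i) \<ge> 1"
  using d_nonneg[of "Port j b i"] by (auto simp: deficient_def order_le_less)

text \<open>The cut for blob \<open>j\<close> runs along this thin edge, with the port of the next
  blob inside. With no chip in the interior, that port has to pay.\<close>

lemma thin_tail_deficient:
  assumes small: "total < 6 * int k" and j: "j < 3" "deficient j" "i < k" "Thin j i \<notin> C"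
  shows "d (Port (Suc j mod 3) True i) \<ge> 1"
proof -
  obtain U where out: "\<And>b i. i < k \<Longrightarrow> Port j b i \<notin> U"
    and inn: "\<And>j' b i. j' < 3 \<Longrightarrow> j' \<noteq> j \<Longrightarrow> i < k \<Longrightarrow> Port j' b i \<in> U"
    and deg: "\<And>u. u \<in> U \<Longrightarrow> int (cut_degree C U u) \<le> d u"
    using deficient_cut[OF assms(1-3)] by metis
  have "Suc j mod 3 < 3" "Suc j mod 3 \<noteq> j" using j by (auto simp: mod_Suc)
  then have p: "Port (Suc j mod 3) True i \<in> U" using inn j by blast
  show ?thesis
  proof (rule crossing_chip[where C = C])
    show "crosses U (Thin j i)" using p out j by (simp add: crosses_def)
  qed (use p deg j in \<open>auto simp: edge_ends_def\<close>)
qed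

lemma thin_head_deficient:
  assumes small: "total < 6 * int k" and j: "j < 3" "deficient (Suc j mod 3)" "i < k" "Thin j i \<notin> C"
  shows "d (Port j False i) \<ge> 1"
proof -
  have j': "Suc j mod 3 < 3" "Suc j mod 3 \<noteq> j" using j by (auto simp: mod_Suc)
  obtain U where out: "\<And>b i. i < k \<Longrightarrow> Port (Suc j mod 3) b i \<notin> U"
    and inn: "\<And>j' b i. j' < 3 \<Longrightarrow> j' \<noteq> Suc j mod 3 \<Longrightarrow> i < k \<Longrightarrow> Port j' b i \<in> U"
    and deg: "\<And>u. u \<in> U \<Longrightarrow> int (cut_degree C U u) \<le> d u"
    using deficient_cut[OF assms(1) j'(1) assms(3)] by metis
  have p: "Port j False i \<in> U" using inn j j'(2) by metis
  show ?thesis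
  proof (rule crossing_chip[where C = C])
    show "crosses U (Thin j i)" using p out j by (simp add: crosses_def)
  qed (use p deg j in \<open>auto simp: edge_ends_def\<close>)
qed

text \<open>A deficient blob demands a chip in the interior or at the far end of the thin edge, a
  blob that is not deficient has one at its own end. An interior chip can meet the demands of two
  deficient blobs. Without interior chips, equal status places the two demands at different ends,
  while different status places both at the same end.\<close>

lemma thin_weight_bound:
  assumes small: "total < 6 * int k" and j: "j < 3" "i < k"
  shows "thin_weight j i \<ge> (if \<not> deficient j \<and> \<not> deficient (Suc j mod 3) then 2 else 1)"
    and "C = {} \<Longrightarrow> thin_weight j i \<ge> (if deficient j \<longleftrightarrow> deficient (Suc j mod 3) then 2 else 1)"
proof -
  let ?j = "Suc j mod 3"
  have j': "?j < 3" by simp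
  have nn: "d (Port j False i) \<ge> 0" "d (Port ?j True i) \<ge> 0"
    using j by (auto intro: d_nonneg)
  note a = port_chip[OF j, of False] and b = port_chip[OF j' j(2), of True]
    and c = thin_tail_deficient[OF small j(1) _ j(2)] and e = thin_head_deficient[OF small j(1) _ j(2)]
  show "thin_weight j i \<ge> (if \<not> deficient j \<and> \<not> deficient ?j then 2 else 1)"
    by (cases "deficient j"; cases "deficient ?j"; cases "Thin j i \<in> C";
        use nn a b c e in \<open>simp add: thin_weight_def\<close>)
  show "thin_weight j i \<ge> (if deficient j \<longleftrightarrow> deficient ?j then 2 else 1)" if "C = {}"
  proof -
    have w: "thin_weight j i \<ge> d (Port j False i) + d (Port ?j True i)" 
      by (simp add: thin_weight_def)
    have nC: "Thin j i \<notin> C" using that by blast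
    show ?thesis
      by (cases "deficient j"; cases "deficient ?j"; use nn a b c e w nC in simp)
  qed
qed

lemma sum_below_3: "(\<Sum>a<3. g a) = g 0 + g 1 + g 2" for g :: "nat \<Rightarrow> int"
proof -
  have "{..<3} = {0, 1, 2::nat}" by auto
  then show ?thesis by simp
qed

text \<open>Only the spokes of a single blob enter; the vertices and edges listed on the left are
  pairwise distinct.\<close>

lemma total_ge:
  assumes j: "j < 3"
  shows "d Hub + (\<Sum>l<2 * k. spoke_weight j l) + (\<Sum>a<3. \<Sum>i<k. thin_weight a i) \<le> total"
proof -
  let ?A = "Aux j False ` {..<2 * k}"
  let ?P = "\<lambda>b. (\<lambda>(a, i). Port a b i) ` ({..<3} \<times> {..<k})"
  let ?T = "(\<lambda>(a, i). Thin a i) ` ({..<3} \<times> {..<k})"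
  let ?S = "Spoke j ` {..<2 * k}" and ?F = "Fan j False 0 ` {..<2 * k}"
  have P: "(\<Sum>v\<in>?P b. d v) = (\<Sum>a<3. \<Sum>i<k. d (Port a b i))" for b
    by (subst sum.reindex) (auto simp: inj_on_def sum.cartesian_product case_prod_unfold)
  have A: "(\<Sum>v\<in>?A. d v) = (\<Sum>l<2 * k. d (Aux j False l))"
    by (subst sum.reindex) (auto simp: inj_on_def)
  have "d Hub + (\<Sum>v\<in>?A. d v) + (\<Sum>v\<in>?P False. d v) + (\<Sum>v\<in>?P True. d v) =
      (\<Sum>v\<in>{Hub} \<union> ?A \<union> ?P False \<union> ?P True. d v)"
    by (subst sum.union_disjoint, simp, simp, force)+ simp
  also have "\<dots> \<le> (\<Sum>v\<in>V. d v)"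
    using j d_nonneg by (intro sum_mono2) (auto simp: tricycle_finite)
  finally have V: "d Hub + (\<Sum>l<2 * k. d (Aux j False l)) + (\<Sum>a<3. \<Sum>i<k. d (Port a False i)) +
      (\<Sum>a<3. \<Sum>i<k. d (Port a True i)) \<le> (\<Sum>v\<in>V. d v)"
    by (simp only: P A)
  let ?c = "\<lambda>e. of_bool (e \<in> C) :: int"
  have T: "(\<Sum>e\<in>?T. ?c e) = (\<Sum>a<3. \<Sum>i<k. ?c (Thin a i))"
    by (subst sum.reindex) (auto simp: inj_on_def sum.cartesian_product case_prod_unfold simp del: sum_of_bool_eq)
  have S: "(\<Sum>e\<in>?S. ?c e) = (\<Sum>l<2 * k. ?c (Spoke j l))"
    by (subst sum.reindex) (auto simp: inj_on_def simp del: sum_of_bool_eq)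
  have F: "(\<Sum>e\<in>?F. ?c e) = (\<Sum>l<2 * k. ?c (Fan j False 0 l))"
    by (subst sum.reindex) (auto simp: inj_on_def simp del: sum_of_bool_eq)
  have "(\<Sum>e\<in>?T. ?c e) + (\<Sum>e\<in>?S. ?c e) + (\<Sum>e\<in>?F. ?c e) = (\<Sum>e\<in>?T \<union> ?S \<union> ?F. ?c e)"
    by (subst sum.union_disjoint, simp, simp, force)+ simp
  also have "\<dots> \<le> (\<Sum>e\<in>?T \<union> ?S \<union> ?F \<union> C. ?c e)"
    using C_finite by (intro sum_mono2) auto
  also have "\<dots> = (\<Sum>e\<in>C. ?c e)"
    using C_finite by (intro sum.mono_neutral_right) auto
  also have "\<dots> = int (card C)" by simp
  finally have E: "(\<Sum>a<3. \<Sum>i<k. ?c (Thin a i)) + (\<Sum>l<2 * k. ?c (Spoke j l)) +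
      (\<Sum>l<2 * k. ?c (Fan j False 0 l)) \<le> int (card C)"
    by (simp only: T S F)
  \<comment> \<open>Going once around the cycle permutes the blobs, so counting incoming ports by
    the tail of their thin edge counts each of them once.\<close>
  have shift: "(\<Sum>a<3. \<Sum>i<k. d (Port (Suc a mod 3) True i)) = (\<Sum>a<3. \<Sum>i<k. d (Port a True i))"
    unfolding sum_below_3 by (simp add: numeral_2_eq_2)
  show ?thesis
    using V E shift by (simp add: spoke_weight_def thin_weight_def sum.distrib del: sum_of_bool_eq)
qed

text \<open>With no deficient blob the three bundles already weigh \<open>6 * k\<close>. Otherwise
  the hub and the spokes of a deficient blob supply \<open>2 * k\<close> and each bundle at least
  \<open>k\<close>, in total \<open>5 * k\<close>; if \<open>C = {}\<close>, the bundle between two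
  blobs of equal status adds another \<open>k\<close>.\<close>

lemma total_bounds: "5 * int k \<le> total" "C = {} \<Longrightarrow> 6 * int k \<le> total"
proof -
  have "5 * int k \<le> total \<and> (C = {} \<longrightarrow> 6 * int k \<le> total)"
  proof (cases "total < 6 * int k")
    case False
    then show ?thesis by linarith
  next
    case small: True
    define W where "W j = (\<Sum>i<k. thin_weight j i)" for j
    have W: "W j \<ge> (if \<not> deficient j \<and> \<not> deficient (Suc j mod 3) then 2 * int k else int k)"
      "C = {} \<Longrightarrow> W j \<ge> (if deficient j \<longleftrightarrow> deficient (Suc j mod 3) then 2 * int k else int k)"
      if "j < 3" for j
    proof -
      have "W j \<ge> (\<Sum>i<k. if \<not> deficient j \<and> \<not> deficient (Suc j mod 3) then 2 else 1)"
        unfolding W_def using thin_weight_bound(1)[OF small that] by (intro sum_mono) auto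
      then show "W j \<ge> (if \<not> deficient j \<and> \<not> deficient (Suc j mod 3) then 2 * int k else int k)"
        by (auto split: if_splits)
      assume "C = {}"
      then have "W j \<ge> (\<Sum>i<k. if deficient j \<longleftrightarrow> deficient (Suc j mod 3) then 2 else 1)"
        unfolding W_def using thin_weight_bound(2)[OF small that] by (intro sum_mono) auto
      then show "W j \<ge> (if deficient j \<longleftrightarrow> deficient (Suc j mod 3) then 2 * int k else int k)"
        by (auto split: if_splits)
    qed
    have sum3: "(\<Sum>a<3. \<Sum>i<k. thin_weight a i) = W 0 + W 1 + W 2"
      unfolding W_def by (rule sum_below_3)
    have ge: "d Hub + (\<Sum>l<2 * k. spoke_weight j l) + (W 0 + W 1 + W 2) \<le> total" if "j < 3" for j
      using total_ge[OF that] by (simp only: sum3)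
    have mods: "Suc 0 mod 3 = 1" "Suc 1 mod 3 = 2" "Suc 2 mod 3 = (0::nat)" by simp_all
    note W0 = W[of 0, unfolded mods] and W1 = W[of 1, unfolded mods] and W2 = W[of 2, unfolded mods]
    have spoke: "2 * int k + (W 0 + W 1 + W 2) \<le> total" if "j < 3" "deficient j" for j
      using spoke_bound[OF small that] ge[OF that(1)] by linarith
    have "d Hub \<ge> 0" "(\<Sum>l<2 * k. spoke_weight 0 l) \<ge> 0"
      using d_nonneg by (auto simp: spoke_weight_def intro!: sum_nonneg add_nonneg_nonneg)
    then have base: "W 0 + W 1 + W 2 \<le> total" using ge[of 0] by linarith
    define T where "T = total"
    have "5 * int k \<le> T \<and> (C = {} \<longrightarrow> 6 * int k \<le> T)"
      by (cases "deficient 0"; cases "deficient 1"; cases "deficient 2"; cases "C = {}";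
          use W0 W1 W2 base[folded T_def] spoke[folded T_def, of 0] spoke[folded T_def, of 1]
            spoke[folded T_def, of 2] in simp)
    then show ?thesis unfolding T_def .
  qed
  then show "5 * int k \<le> total" "C = {} \<Longrightarrow> 6 * int k \<le> total" by blast+
qed

end

section \<open>Upper bounds for the tricycle\<close>

context nonempty_multigraph
begin

lemma links_le_card:
  assumes "finite S" "\<And>e. e \<in> arcs G \<Longrightarrow> u \<in> edge_ends G e \<Longrightarrow> edge_ends G e \<inter> W \<noteq> {} \<Longrightarrow> e \<in> S"
  shows "links u W \<le> card S"
  unfolding links_def using assms by (intro card_mono) auto

lemma links_pos:
  assumes "e \<in> arcs G" "u \<in> edge_ends G e" "edge_ends G e \<inter> W \<noteq> {}"
  shows "links u W \<ge> 1"
proof -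
  have "links u W > 0" unfolding links_def using assms by (subst card_gt_0_iff) auto
  then show ?thesis by simp
qed

definition fired :: "'a set \<Rightarrow> ('a \<Rightarrow> int) \<Rightarrow> ('a \<Rightarrow> int) \<Rightarrow> bool" where
  "fired W d d' \<longleftrightarrow> (\<forall>u\<in>verts G. if u \<in> W then d u + int (links u (- W)) \<le> d' u else d' u = d u - int (links u W))"

lemma fire:
  assumes "attainable D d" and "\<And>u. u \<in> verts G \<Longrightarrow> u \<notin> W \<Longrightarrow> int (links u W) \<le> d u"
  shows "\<exists>d'. attainable D d' \<and> fired W d d'"
proof -
  obtain d' where d': "attainable D d'"
    "\<And>u. u \<in> verts G \<Longrightarrow> u \<notin> W \<Longrightarrow> d' u = d u - int (links u W)"
    "\<And>u. u \<in> verts G \<Longrightarrow> u \<in> W \<Longrightarrow> d' u = d u + int (links u (- W))"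
    using attainable_fire[OF assms] by metis
  then show ?thesis unfolding fired_def by (intro exI[of _ d']) auto
qed

lemma fired_ge: "fired W d d' \<Longrightarrow> u \<in> verts G \<Longrightarrow> u \<in> W \<Longrightarrow> d u \<le> d' u"
  by (auto simp: fired_def dest!: bspec)

lemma fired_gain:
  assumes "fired W d d'" "attainable D d" and e: "e \<in> arcs G" "u \<in> edge_ends G e" "u \<in> W" "\<not> edge_ends G e \<subseteq> W"
  shows "1 \<le> d' u"
proof -
  have u: "u \<in> verts G" using e by (auto simp: edge_ends_def)
  have "links u (- W) \<ge> 1" by (rule links_pos[OF e(1,2)]) (use e(4) in auto)
  moreover have "d u \<ge> 0" using assms(2) u by (simp add: attainable_def)
  ultimately show ?thesis using assms(1) u e(3) by (auto simp: fired_def dest!: bspec)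
qed

end

lemma (in tricycle_graph) sum_verts:
  fixes f :: "vertex \<Rightarrow> int"
  shows "(\<Sum>v\<in>verts (tricycle k). f v) = f Hub + (\<Sum>j<3. \<Sum>i<k. f (Port j False i) + f (Port j True i)) +
    (\<Sum>j<3. \<Sum>l<6 * k. f (Aux j False l) + f (Aux j True l))"
proof -
  let ?P = "\<lambda>b. (\<lambda>(j, i). Port j b i) ` ({..<3} \<times> {..<k})"
  let ?A = "\<lambda>b. (\<lambda>(j, l). Aux j b l) ` ({..<3} \<times> {..<6 * k})"
  have P: "(\<Sum>v\<in>?P b. f v) = (\<Sum>j<3. \<Sum>i<k. f (Port j b i))" for b
    by (subst sum.reindex) (auto simp: inj_on_def sum.cartesian_product case_prod_unfold)
  have A: "(\<Sum>v\<in>?A b. f v) = (\<Sum>j<3. \<Sum>l<6 * k. f (Aux j b l))" for b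
    by (subst sum.reindex) (auto simp: inj_on_def sum.cartesian_product case_prod_unfold)
  have "v \<in> verts (tricycle k) \<longleftrightarrow> v \<in> {Hub} \<union> ?P False \<union> ?P True \<union> ?A False \<union> ?A True" for v
    by (cases v; cases "case v of Port j b i \<Rightarrow> b | Aux j b l \<Rightarrow> b | Hub \<Rightarrow> False")
      (auto simp: image_iff)
  then have "verts (tricycle k) = {Hub} \<union> ?P False \<union> ?P True \<union> ?A False \<union> ?A True" by blast
  then have "(\<Sum>v\<in>verts (tricycle k). f v) = (\<Sum>v\<in>{Hub} \<union> ?P False \<union> ?P True \<union> ?A False \<union> ?A True. f v)"
    by simp
  also have "\<dots> = f Hub + (\<Sum>v\<in>?P False. f v) + (\<Sum>v\<in>?P True. f v) + (\<Sum>v\<in>?A False. f v) + (\<Sum>v\<in>?A True. f v)"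
    by (subst sum.union_disjoint, simp, simp, force)+ simp
  finally show ?thesis unfolding P A by (simp add: sum.distrib)
qed

section \<open>A divisor of degree 6k on the tricycle\<close>

context tricycle_graph
begin

text \<open>Blob 0 has a chip on every port and is never pushed into. Blobs 1 and 2 both are, so the
  bundle between them carries chips at both ends; the other two bundles carry them at blob 0 only.
  With the hub this makes \<open>2 * k + 4 * k\<close> chips.\<close>

definition base_chips :: "vertex \<Rightarrow> int" where
  "base_chips v = (case v of Hub \<Rightarrow> 2 * int k
     | Port j b i \<Rightarrow> of_bool (j = 0 \<or> j = 1 \<and> \<not> b \<or> j = 2 \<and> b) | Aux j b l \<Rightarrow> 0)"

lemma base_chips_nonneg: "base_chips v \<ge> 0"
  by (cases v) (simp_all add: base_chips_def)

text \<open>The alternative reflects that pushing into a blob empties the hub: its chips are then at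
  the far ends of the spokes.\<close>

definition blob_ready :: "nat \<Rightarrow> (vertex \<Rightarrow> int) \<Rightarrow> bool" where
  "blob_ready j d \<longleftrightarrow> (\<forall>b. \<forall>i<k. d (Port j b i) \<ge> 1) \<and> (d Hub \<ge> 1 \<or> (\<forall>l<2 * k. d (Aux j False l) \<ge> 1))"

lemma blob_ready:
  assumes D: "attainable D base_chips" and j: "j < 3"
  shows "\<exists>d. attainable D d \<and> blob_ready j d"
proof (cases "j = 0")
  case True
  then show ?thesis using D k_pos by (intro exI[of _ base_chips]) (auto simp: blob_ready_def base_chips_def)
next
  case False
  let ?W = "{v. \<exists>b i. v = Port j b i \<or> v = Aux j b i}"
  have j12: "j = 1 \<or> j = 2" using j False by linarith
  have legal: "int (links u ?W) \<le> base_chips u" if u: "u \<in> V" "u \<notin> ?W" for u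
  proof (cases u)
    case Hub
    have "links u ?W \<le> card (Spoke j ` {..<2 * k})"
    proof (rule links_le_card)
      fix e assume "e \<in> E" "u \<in> edge_ends (tricycle k) e" "edge_ends (tricycle k) e \<inter> ?W \<noteq> {}"
      then show "e \<in> Spoke j ` {..<2 * k}" using Hub by (cases e) (auto simp: edge_ends_def)
    qed simp
    also have "\<dots> = 2 * k" by (simp add: card_image inj_on_def)
    finally show ?thesis using Hub by (simp add: base_chips_def)
  next
    case (Port a b i)
    \<comment> \<open>Only a thin edge leads from a port of another blob into blob \<open>j\<close>,
      and a port has just one; the two branches are its tail and its head.\<close>
    let ?S = "if \<not> b \<and> Suc a mod 3 = j then {Thin a i} else if b \<and> a = Suc j mod 3 then {Thin j i} else {}"
    have "links u ?W \<le> card ?S"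
    proof (rule links_le_card)
      fix e assume e: "e \<in> E" "u \<in> edge_ends (tricycle k) e" "edge_ends (tricycle k) e \<inter> ?W \<noteq> {}"
      then show "e \<in> ?S" using Port u by (cases e) (auto simp: edge_ends_def)
    qed simp
    also have "int (card ?S) \<le> base_chips u"
      using Port u j12 by (auto simp: base_chips_def mod_Suc split: if_splits)
    finally show ?thesis by simp
  next
    case (Aux a b l)
    have "links u ?W \<le> card ({} :: edge set)"
    proof (rule links_le_card)
      fix e assume e: "e \<in> E" "u \<in> edge_ends (tricycle k) e" "edge_ends (tricycle k) e \<inter> ?W \<noteq> {}"
      then show "e \<in> {}" using Aux u by (cases e) (auto simp: edge_ends_def)
    qed simp
    then show ?thesis using base_chips_nonneg[of u] by simp
  qed
  have "\<exists>d. attainable D d \<and> fired ?W base_chips d" by (rule fire[OF D legal])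
  then obtain d where d: "attainable D d" "fired ?W base_chips d" by blast
  have "d (Port j b i) \<ge> 1" if i: "i < k" for b i
  \<comment> \<open>\<open>Port 1 True i\<close> and \<open>Port 2 False i\<close> are the initially
    empty ports; their thin edges bring chips from blob 0.\<close>
  proof (cases "j = 1 \<longleftrightarrow> b")
    case False
    then have "base_chips (Port j b i) = 1" using j12 by (auto simp: base_chips_def)
    then show ?thesis using fired_ge[OF d(2), of "Port j b i"] i j by simp
  next
    case True
    show ?thesis
    proof (rule fired_gain[OF d(2) D, of "if b then Thin 0 i else Thin 2 i"])
      show "\<not> edge_ends (tricycle k) (if b then Thin 0 i else Thin 2 i) \<subseteq> ?W"
        "Port j b i \<in> edge_ends (tricycle k) (if b then Thin 0 i else Thin 2 i)"
        using True j12 by (auto simp: edge_ends_def)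
    qed (use i in auto)
  qed
  moreover have "d (Aux j False l) \<ge> 1" if l: "l < 2 * k" for l
    by (rule fired_gain[OF d(2) D, of "Spoke j l"]) (use l j in \<open>auto simp: edge_ends_def\<close>)
  ultimately show ?thesis using d(1) by (auto simp: blob_ready_def)
qed

lemma attainable_nonneg: "attainable D d \<Longrightarrow> v \<in> V \<Longrightarrow> d v \<ge> 0"
  by (simp add: attainable_def)

text \<open>Normally the ports, and the hub if there is a spoke, push into both auxiliary vertices
  of index \<open>l\<close>. When a spoke ends there and the hub is empty this may be illegal, but
  then \<open>Aux j False l\<close> already has a chip and joins in pushing into
  \<open>Aux j True l\<close>.\<close>

lemma aux_reached:
  assumes D: "attainable D d" "blob_ready j d" and j: "j < 3" and l: "l < 6 * k"
  shows "\<exists>d'. attainable D d' \<and> d' (Aux j b l) \<ge> 1"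
proof (cases "d Hub \<ge> 1 \<or> l \<ge> 2 * k")
  case True
  let ?W = "{Aux j False l, Aux j True l}"
  have legal: "int (links u ?W) \<le> d u" if u: "u \<in> V" "u \<notin> ?W" for u
  proof -
    let ?S = "case u of Hub \<Rightarrow> if l < 2 * k then {Spoke j l} else {} | Port a b i \<Rightarrow> if a = j then {Fan j b i l} else {}
      | Aux a b i \<Rightarrow> {}"
    have "links u ?W \<le> card ?S"
    proof (rule links_le_card)
      fix e assume e: "e \<in> E" "u \<in> edge_ends (tricycle k) e" "edge_ends (tricycle k) e \<inter> ?W \<noteq> {}"
      then show "e \<in> ?S" using u by (cases e; cases u) (auto simp: edge_ends_def)
    qed (auto split: vertex.split)
    also have "int (card ?S) \<le> d u"
      using True D(2) u attainable_nonneg[OF D(1) u(1)]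
      by (cases u) (auto simp: blob_ready_def)
    finally show ?thesis by simp
  qed
  have "\<exists>d'. attainable D d' \<and> fired ?W d d'" by (rule fire[OF D(1) legal])
  then obtain d' where d': "attainable D d'" "fired ?W d d'" by blast
  have "1 \<le> d' (Aux j b l)"
    by (rule fired_gain[OF d'(2) D(1), of "Fan j b 0 l"]) (use j l k_pos in \<open>auto simp: edge_ends_def\<close>)
  then show ?thesis using d'(1) by blast
next
  case False
  then have l2: "l < 2 * k" and F: "d (Aux j False l) \<ge> 1" using D(2) by (auto simp: blob_ready_def)
  let ?W = "{Aux j True l}"
  have legal: "int (links u ?W) \<le> d u" if u: "u \<in> V" "u \<notin> ?W" for u
  proof -
    let ?S = "case u of Hub \<Rightarrow> {} | Port a b i \<Rightarrow> if a = j then {Fan j b i l} else {}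
      | Aux a b i \<Rightarrow> if a = j \<and> \<not> b \<and> i = l then {Link j l} else {}"
    have "links u ?W \<le> card ?S"
    proof (rule links_le_card)
      fix e assume e: "e \<in> E" "u \<in> edge_ends (tricycle k) e" "edge_ends (tricycle k) e \<inter> ?W \<noteq> {}"
      then show "e \<in> ?S" using u by (cases e; cases u) (auto simp: edge_ends_def)
    qed (auto split: vertex.split)
    also have "int (card ?S) \<le> d u"
      using F D(2) u attainable_nonneg[OF D(1) u(1)]
      by (cases u) (auto simp: blob_ready_def)
    finally show ?thesis by simp
  qed
  have "\<exists>d'. attainable D d' \<and> fired ?W d d'" by (rule fire[OF D(1) legal])
  then obtain d' where d': "attainable D d'" "fired ?W d d'" by blast
  have "1 \<le> d' (Aux j True l)"
    by (rule fired_gain[OF d'(2) D(1), of "Link j l"]) (use j l in \<open>auto simp: edge_ends_def\<close>)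
  then show ?thesis using d'(1) F D(1) by (cases b) auto
qed

lemma tricycle_discrete_divisor:
  "\<exists>D\<in>divisors_on (V). positive_rank D \<and> divisor_degree D = 6 * int k"
proof -
  obtain D where D: "D \<in> divisors_on (V)"
    "\<forall>p. chips D p = (if p \<in> V then base_chips p else 0)"
    "divisor_degree D = (\<Sum>v\<in>V. base_chips v)"
    using divisor_of_function[OF finite_verts, of base_chips] by blast
  have "{..<3} = {0, 1, 2::nat}" by auto
  then have deg: "divisor_degree D = 6 * int k"
    unfolding D(3) sum_verts by (simp add: base_chips_def)
  have att: "attainable D base_chips"
    unfolding attainable_def using base_chips_nonneg D(2) by (auto intro!: exI[of _ "\<lambda>_. 0"] simp: dv_const)
  have "positive_rank D"
  proof (rule positive_rankI)
    fix q assume q: "q \<in> V"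
    show "\<exists>d. attainable D d \<and> d q \<ge> 1"
    proof (cases q)
      case Hub
      then show ?thesis using att k_pos by (intro exI[of _ base_chips]) (simp add: base_chips_def)
    next
      case (Port j b i)
      then show ?thesis using blob_ready[OF att, of j] q by (auto simp: blob_ready_def)
    next
      case (Aux j b l)
      then show ?thesis using blob_ready[OF att, of j] aux_reached[of D _ j l b] q by auto
    qed
  qed
  with D(1) deg show ?thesis by blast
qed

end

section \<open>A divisor of degree 5k on the subdivision\<close>

sublocale tricycle_graph \<subseteq> S: nonempty_multigraph "subdivide2 (tricycle k)"
  by (rule subdivide2_multigraph)

lemma subdivide2_edge_ends:
  "edge_ends (subdivide2 G) (e, h) = {Inl (if h then head G e else tail G e), Inr e}"
  by (cases h) (auto simp: edge_ends_def subdivide2_simps)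

text \<open>The receiving side of the first push. Midpoints of thin edges stay outside because their
  chips are to be spent; midpoints of spokes lie inside, so the hub pays only for the first half of
  each spoke.\<close>

fun in_blob :: "nat \<Rightarrow> vertex + edge \<Rightarrow> bool" where
  "in_blob j (Inl Hub) \<longleftrightarrow> False"
| "in_blob j (Inl (Port a b i)) \<longleftrightarrow> a = j"
| "in_blob j (Inl (Aux a b l)) \<longleftrightarrow> a = j"
| "in_blob j (Inr (Thin a i)) \<longleftrightarrow> False"
| "in_blob j (Inr (Spoke a l)) \<longleftrightarrow> a = j"
| "in_blob j (Inr (Fan a b i l)) \<longleftrightarrow> a = j"
| "in_blob j (Inr (Link a l)) \<longleftrightarrow> a = j"

text \<open>The receiving side of the second push. Here the midpoints of fans lie inside while the
  midpoint of the spoke stays outside, where its chip can pay for the second half.\<close>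

fun in_connection :: "nat \<Rightarrow> nat \<Rightarrow> vertex + edge \<Rightarrow> bool" where
  "in_connection j l (Inl (Aux a b l')) \<longleftrightarrow> a = j \<and> l' = l"
| "in_connection j l (Inr (Fan a b i l')) \<longleftrightarrow> a = j \<and> l' = l"
| "in_connection j l (Inr (Link a l')) \<longleftrightarrow> a = j \<and> l' = l"
| "in_connection j l _ \<longleftrightarrow> False"

fun midpoint_chips :: "nat \<Rightarrow> vertex + edge \<Rightarrow> int" where
  "midpoint_chips k (Inl Hub) = 2 * int k"
| "midpoint_chips k (Inr (Thin j i)) = 1"
| "midpoint_chips k _ = 0"

lemma midpoint_chips_nonneg: "midpoint_chips k v \<ge> 0"
  by (cases "(k, v)" rule: midpoint_chips.cases) simp_all

context tricycle_graph
begin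

abbreviation "sub_verts \<equiv> verts (subdivide2 (tricycle k))"

lemma sub_verts_simps [simp]:
  "Inl v \<in> sub_verts \<longleftrightarrow> v \<in> V" "Inr e \<in> sub_verts \<longleftrightarrow> e \<in> E"
  by (auto simp: subdivide2_simps)

lemma sub_arcs_simps [simp]: "(e, h) \<in> arcs (subdivide2 (tricycle k)) \<longleftrightarrow> e \<in> E"
  by (simp add: subdivide2_simps)

lemma sub_edge_ends:
  "edge_ends (subdivide2 (tricycle k)) (e, h) = {Inl (if h then edge_head e else edge_tail e), Inr e}"
  unfolding subdivide2_edge_ends tricycle_ends ..

text \<open>For \<open>u\<close> outside \<open>W\<close>: the half of \<open>e\<close> chosen by
  \<open>h\<close> joins \<open>u\<close> to \<open>W\<close>. It is spelled out with the ends of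
  \<open>e\<close> so that case analysis on the edge constructors decides it.\<close>

definition touches :: "vertex + edge \<Rightarrow> (vertex + edge) set \<Rightarrow> edge \<Rightarrow> bool \<Rightarrow> bool" where
  "touches u W e h \<longleftrightarrow> e \<in> E \<and>
     u \<in> {Inl (if h then edge_head e else edge_tail e), Inr e} \<and>
     (Inl (if h then edge_head e else edge_tail e) \<in> W \<or> Inr e \<in> W)"

lemma touchesD:
  assumes "touches u W e h"
  shows "e \<in> E" "u \<in> {Inl (if h then edge_head e else edge_tail e), Inr e}"
    "Inl (if h then edge_head e else edge_tail e) \<in> W \<or> Inr e \<in> W"
  using assms by (auto simp: touches_def)

lemma sub_links_le:
  assumes "finite T" "\<And>e h. touches u W e h \<Longrightarrow> (e, h) \<in> T"
  shows "S.links u W \<le> card T"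
proof (rule S.links_le_card[OF assms(1)])
  fix x assume x: "x \<in> arcs (subdivide2 (tricycle k))" "u \<in> edge_ends (subdivide2 (tricycle k)) x"
    "edge_ends (subdivide2 (tricycle k)) x \<inter> W \<noteq> {}"
  obtain e h where "x = (e, h)" by (cases x)
  then show "x \<in> T" using x assms(2)[of e h] by (auto simp: sub_edge_ends touches_def)
qed

lemma sub_links_0:
  assumes "\<And>e h. touches u W e h \<Longrightarrow> False"
  shows "S.links u W = 0"
  using sub_links_le[of "{}" u W] assms by auto

lemma sub_links_1:
  assumes "\<And>e h. touches u W e h \<Longrightarrow> (e, h) = x"
  shows "S.links u W \<le> 1"
  using sub_links_le[of "{x}" u W] assms by auto

lemma sub_fired_gain:
  assumes "S.fired W d d'" "S.attainable D d" "e \<in> E"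
    and "Inl (if h then edge_head e else edge_tail e) \<in> W \<longleftrightarrow> Inr e \<notin> W"
    and "u \<in> {Inl (if h then edge_head e else edge_tail e), Inr e}" "u \<in> W"
  shows "1 \<le> d' u"
  by (rule S.fired_gain[OF assms(1,2), of "(e, h)"])
    (use assms(3-) in \<open>auto simp: sub_edge_ends\<close>)

definition sub_ready :: "nat \<Rightarrow> (vertex + edge \<Rightarrow> int) \<Rightarrow> bool" where
  "sub_ready j d \<longleftrightarrow> (\<forall>b. \<forall>i<k. d (Inl (Port j b i)) \<ge> 1) \<and> (\<forall>l<2 * k. d (Inr (Spoke j l)) \<ge> 1)"

lemma sub_ready:
  assumes D: "S.attainable D (midpoint_chips k)" and j: "j < 3"
  shows "\<exists>d. S.attainable D d \<and> sub_ready j d"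
proof -
  let ?W = "Collect (in_blob j)"
  have legal: "int (S.links u ?W) \<le> midpoint_chips k u" if u: "u \<in> sub_verts" "u \<notin> ?W" for u
  proof -
    consider "u = Inl Hub" | a i where "u = Inr (Thin a i)"
      | "u \<noteq> Inl Hub" "\<And>a i. u \<noteq> Inr (Thin a i)" by blast
    then show ?thesis
    proof cases
      case 1
      have "S.links u ?W \<le> card ((\<lambda>l. (Spoke j l, False)) ` {..<2 * k})"
      proof (rule sub_links_le)
        show "(e, h) \<in> (\<lambda>l. (Spoke j l, False)) ` {..<2 * k}" if "touches u ?W e h" for e h
          using touchesD[OF that] 1 by (cases e; cases h) auto
      qed simp
      also have "\<dots> = 2 * k" by (simp add: card_image inj_on_def)
      finally show ?thesis using 1 by simp
    next
      case (2 a i)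
      have "S.links u ?W \<le> 1"
      \<comment> \<open>A thin edge meets blob \<open>j\<close> at one end at most: at its tail if
        \<open>a = j\<close>, otherwise possibly at its head.\<close>
      proof (rule sub_links_1[where x = "(Thin a i, a \<noteq> j)"])
        show "(e, h) = (Thin a i, a \<noteq> j)" if "touches u ?W e h" for e h
          using touchesD[OF that] 2 by (cases h) (auto simp: mod_Suc split: if_splits)
      qed
      then show ?thesis using 2 by simp
    next
      case 3
      have "S.links u ?W = 0"
      proof (rule sub_links_0)
        show False if "touches u ?W e h" for e h
          using touchesD[OF that] 3 u by (cases e; cases h) auto
      qed
      then show ?thesis using midpoint_chips_nonneg[of k u] by simp
    qed
  qed
  have "\<exists>d. S.attainable D d \<and> S.fired ?W (midpoint_chips k) d" by (rule S.fire[OF D legal])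
  then obtain d where d: "S.attainable D d" "S.fired ?W (midpoint_chips k) d" by blast
  have "d (Inl (Port j b i)) \<ge> 1" if i: "i < k" for b i
  proof (cases b)
    case False
    show ?thesis
      by (rule sub_fired_gain[OF d(2) D, of "Thin j i" False]) (use i j False in auto)
  next
    case True
    define a where "a = (if j = 0 then 2 else j - 1)"
    have a: "a < 3" "Suc a mod 3 = j" using j by (auto simp: a_def)
    show ?thesis
      by (rule sub_fired_gain[OF d(2) D, of "Thin a i" True]) (use i a True in auto)
  qed
  moreover have "d (Inr (Spoke j l)) \<ge> 1" if l: "l < 2 * k" for l
    by (rule sub_fired_gain[OF d(2) D, of "Spoke j l" False]) (use l j in auto)
  ultimately show ?thesis using d(1) by (auto simp: sub_ready_def)
qed

text \<open>The ports pay for the first halves of the fans of index \<open>l\<close>, the midpoint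
  of the spoke, if there is one, for its second half. The gained chips sit on the midpoints of the
  fans and, behind a spoke, on \<open>Aux j False l\<close>.\<close>

lemma sub_connection_reached:
  assumes D: "S.attainable D d" "sub_ready j d" and j: "j < 3" and l: "l < 6 * k"
  shows "\<exists>d'. S.attainable D d' \<and> (\<forall>b. \<forall>i<k. d' (Inr (Fan j b i l)) \<ge> 1) \<and>
    (l < 2 * k \<longrightarrow> d' (Inl (Aux j False l)) \<ge> 1)"
proof -
  have port: "d (Inl (Port j b i)) \<ge> 1" if "i < k" for b i using D(2) that by (simp add: sub_ready_def)
  have spoke: "d (Inr (Spoke j l)) \<ge> 1" if "l < 2 * k" using D(2) that by (simp add: sub_ready_def)
  let ?W = "Collect (in_connection j l)"
  have legal: "int (S.links u ?W) \<le> d u" if u: "u \<in> sub_verts" "u \<notin> ?W" for u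
  proof -
    consider b i where "u = Inl (Port j b i)" "i < k" | "u = Inr (Spoke j l)" "l < 2 * k"
      | "\<And>b i. u \<noteq> Inl (Port j b i)" "u \<noteq> Inr (Spoke j l)" using u by force
    then show ?thesis
    proof cases
      case (1 b i)
      have "S.links u ?W \<le> 1"
      proof (rule sub_links_1[where x = "(Fan j b i l, False)"])
        show "(e, h) = (Fan j b i l, False)" if "touches u ?W e h" for e h
          using touchesD[OF that] 1 by (cases e; cases h) auto
      qed
      then show ?thesis using port[OF 1(2), of b] 1 by simp
    next
      case 2
      have "S.links u ?W \<le> 1"
      proof (rule sub_links_1[where x = "(Spoke j l, True)"])
        show "(e, h) = (Spoke j l, True)" if "touches u ?W e h" for e h
          using touchesD[OF that] 2 by (cases e; cases h) auto
      qed
      then show ?thesis using spoke 2 by simp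
    next
      case 3
      have "S.links u ?W = 0"
      proof (rule sub_links_0)
        show False if "touches u ?W e h" for e h
          using touchesD[OF that] 3 u by (cases e; cases h) auto
      qed
      then show ?thesis using D(1) u by (simp add: S.attainable_def)
    qed
  qed
  have "\<exists>d'. S.attainable D d' \<and> S.fired ?W d d'" by (rule S.fire[OF D(1) legal])
  then obtain d' where d': "S.attainable D d'" "S.fired ?W d d'" by blast
  have "d' (Inr (Fan j b i l)) \<ge> 1" if i: "i < k" for b i
    by (rule sub_fired_gain[OF d'(2) D(1), of "Fan j b i l" False]) (use i j l in auto)
  moreover have "d' (Inl (Aux j False l)) \<ge> 1" if l: "l < 2 * k"
    by (rule sub_fired_gain[OF d'(2) D(1), of "Spoke j l" True]) (use j l in auto)
  ultimately show ?thesis using d'(1) by blast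
qed

text \<open>If a spoke ends at \<open>Aux j False l\<close>, its midpoint need no longer hold a
  chip, but the auxiliary vertex itself holds one and can pay for the link. Otherwise no spoke
  interferes, and the midpoints of the fans fill both auxiliary vertices.\<close>

lemma sub_aux_reached:
  assumes D: "S.attainable D d" and fan: "\<And>b i. i < k \<Longrightarrow> d (Inr (Fan j b i l)) \<ge> 1"
    and aux: "l < 2 * k \<Longrightarrow> d (Inl (Aux j False l)) \<ge> 1" and j: "j < 3" and l: "l < 6 * k"
  shows "\<exists>d'. S.attainable D d' \<and> d' (Inl (Aux j b l)) \<ge> 1"
    and "\<exists>d'. S.attainable D d' \<and> d' (Inr (Link j l)) \<ge> 1"
proof -
  have nonneg: "d u \<ge> 0" if "u \<in> sub_verts" for u using D that by (simp add: S.attainable_def)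
  have "(\<exists>d'. S.attainable D d' \<and> d' (Inl (Aux j b l)) \<ge> 1) \<and> (\<exists>d'. S.attainable D d' \<and> d' (Inr (Link j l)) \<ge> 1)"
  proof (cases "l < 2 * k")
    case True
    let ?W = "{Inl (Aux j True l), Inr (Link j l)}"
    have legal: "int (S.links u ?W) \<le> d u" if u: "u \<in> sub_verts" "u \<notin> ?W" for u
    proof -
      consider i where "u = Inr (Fan j True i l)" "i < k" | "u = Inl (Aux j False l)"
        | "\<And>i. u \<noteq> Inr (Fan j True i l)" "u \<noteq> Inl (Aux j False l)" using u by force
      then show ?thesis
      proof cases
        case (1 i)
        have "S.links u ?W \<le> 1"
        proof (rule sub_links_1[where x = "(Fan j True i l, True)"])
          show "(e, h) = (Fan j True i l, True)" if "touches u ?W e h" for e h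
            using touchesD[OF that] 1 by (cases e; cases h) auto
        qed
        then show ?thesis using fan[OF 1(2), of True] 1 by simp
      next
        case 2
        have "S.links u ?W \<le> 1"
        proof (rule sub_links_1[where x = "(Link j l, False)"])
          show "(e, h) = (Link j l, False)" if "touches u ?W e h" for e h
            using touchesD[OF that] 2 by (cases e; cases h) auto
        qed
        then show ?thesis using aux[OF True] 2 by simp
      next
        case 3
        have "S.links u ?W = 0"
        proof (rule sub_links_0)
          show False if "touches u ?W e h" for e h
            using touchesD[OF that] 3 u by (cases e; cases h) auto
        qed
        then show ?thesis using nonneg[OF u(1)] by simp
      qed
    qed
    have "\<exists>d'. S.attainable D d' \<and> S.fired ?W d d'" by (rule S.fire[OF D legal])
    then obtain d' where d': "S.attainable D d'" "S.fired ?W d d'" by blast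
    have "d' (Inl (Aux j True l)) \<ge> 1"
      by (rule sub_fired_gain[OF d'(2) D, of "Fan j True 0 l" True]) (use j l k_pos in auto)
    moreover have "d' (Inr (Link j l)) \<ge> 1"
      by (rule sub_fired_gain[OF d'(2) D, of "Link j l" False]) (use j l in auto)
    ultimately show ?thesis using d'(1) D aux[OF True] by (cases b) auto
  next
    case False
    let ?W = "{Inl (Aux j False l), Inl (Aux j True l), Inr (Link j l)}"
    have legal: "int (S.links u ?W) \<le> d u" if u: "u \<in> sub_verts" "u \<notin> ?W" for u
    proof -
      consider b i where "u = Inr (Fan j b i l)" "i < k"
        | "\<And>b i. u \<noteq> Inr (Fan j b i l)" using u by force
      then show ?thesis
      proof cases
        case (1 b i)
        have "S.links u ?W \<le> 1"
        proof (rule sub_links_1[where x = "(Fan j b i l, True)"])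
          show "(e, h) = (Fan j b i l, True)" if "touches u ?W e h" for e h
            using touchesD[OF that] 1 by (cases e; cases h) auto
        qed
        then show ?thesis using fan[OF 1(2), of b] 1 by simp
      next
        case 2
        have "S.links u ?W = 0"
        proof (rule sub_links_0)
          show False if "touches u ?W e h" for e h
            using touchesD[OF that] 2 u False by (cases e; cases h) auto
        qed
        then show ?thesis using nonneg[OF u(1)] by simp
      qed
    qed
    have "\<exists>d'. S.attainable D d' \<and> S.fired ?W d d'" by (rule S.fire[OF D legal])
    then obtain d' where d': "S.attainable D d'" "S.fired ?W d d'" by blast
    have A: "d' (Inl (Aux j b l)) \<ge> 1" for b
      by (rule sub_fired_gain[OF d'(2) D, of "Fan j b 0 l" True]) (use j l k_pos in auto)
    \<comment> \<open>The midpoint of the link has no neighbour outside the set just filled, so it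
      needs a second firing, paid by the two auxiliary vertices.\<close>
    let ?V = "{Inr (Link j l)}"
    have legal': "int (S.links u ?V) \<le> d' u" if u: "u \<in> sub_verts" "u \<notin> ?V" for u
    proof -
      consider b where "u = Inl (Aux j b l)" | "\<And>b. u \<noteq> Inl (Aux j b l)" by blast
      then show ?thesis
      proof cases
        case (1 b)
        have "S.links u ?V \<le> 1"
        proof (rule sub_links_1[where x = "(Link j l, b)"])
          show "(e, h) = (Link j l, b)" if "touches u ?V e h" for e h
            using touchesD[OF that] 1 by (cases e; cases h) auto
        qed
        then show ?thesis using A[of b] 1 by simp
      next
        case 2
        have "S.links u ?V = 0"
        proof (rule sub_links_0)
          show False if "touches u ?V e h" for e h
            using touchesD[OF that] 2 u by (cases e; cases h) auto
        qed
        then show ?thesis using d'(1) u(1) by (simp add: S.attainable_def)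
      qed
    qed
    have "\<exists>d''. S.attainable D d'' \<and> S.fired ?V d' d''" by (rule S.fire[OF d'(1) legal'])
    then obtain d'' where d'': "S.attainable D d''" "S.fired ?V d' d''" by blast
    have "d'' (Inr (Link j l)) \<ge> 1"
      by (rule sub_fired_gain[OF d''(2) d'(1), of "Link j l" False]) (use j l in auto)
    then show ?thesis using d'(1) A d''(1) by blast
  qed
  then show "\<exists>d'. S.attainable D d' \<and> d' (Inl (Aux j b l)) \<ge> 1"
    "\<exists>d'. S.attainable D d' \<and> d' (Inr (Link j l)) \<ge> 1" by blast+
qed

lemma sub_midpoint_degree: "(\<Sum>u\<in>sub_verts. midpoint_chips k u) = 5 * int k"
proof -
  let ?T = "(\<lambda>(j, i). Inr (Thin j i)) ` ({..<3} \<times> {..<k}) :: (vertex + edge) set"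
  have "(\<Sum>u\<in>sub_verts. midpoint_chips k u) = (\<Sum>u\<in>{Inl Hub} \<union> ?T. midpoint_chips k u)"
  proof (rule sum.mono_neutral_right)
    show "\<forall>u\<in>sub_verts - ({Inl Hub} \<union> ?T). midpoint_chips k u = 0"
    proof
      fix u assume u: "u \<in> sub_verts - ({Inl Hub} \<union> ?T)"
      show "midpoint_chips k u = 0"
        by (cases "(k, u)" rule: midpoint_chips.cases) (use u in \<open>auto simp: image_iff\<close>)
    qed
  qed auto
  also have "\<dots> = 2 * int k + (\<Sum>u\<in>?T. midpoint_chips k u)"
    by (subst sum.union_disjoint) auto
  also have "(\<Sum>u\<in>?T. midpoint_chips k u) = 3 * int k"
    by (subst sum.reindex) (auto simp: inj_on_def case_prod_unfold)
  finally show ?thesis by simp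
qed

lemma tricycle_subdivision_divisor:
  "\<exists>D\<in>divisors_on sub_verts. S.positive_rank D \<and> divisor_degree D = 5 * int k"
proof -
  obtain D where D: "D \<in> divisors_on sub_verts"
    "\<forall>p. chips D p = (if p \<in> sub_verts then midpoint_chips k p else 0)"
    "divisor_degree D = (\<Sum>v\<in>sub_verts. midpoint_chips k v)"
    using divisor_of_function[OF S.finite_verts, of "midpoint_chips k"] by blast
  have att: "S.attainable D (midpoint_chips k)"
    unfolding S.attainable_def using midpoint_chips_nonneg D(2)
    by (auto intro!: exI[of _ "\<lambda>_. 0"] simp: S.dv_const)
  note ready = sub_ready[OF att]
  have conn: "\<exists>d. S.attainable D d \<and> (\<forall>b. \<forall>i<k. d (Inr (Fan j b i l)) \<ge> 1) \<and>
      (l < 2 * k \<longrightarrow> d (Inl (Aux j False l)) \<ge> 1)" if "j < 3" "l < 6 * k" for j l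
    using ready[OF that(1)] sub_connection_reached[OF _ _ that] by blast
  have "S.positive_rank D"
  proof (rule S.positive_rankI)
    fix q assume q: "q \<in> sub_verts"
    show "\<exists>d. S.attainable D d \<and> d q \<ge> 1"
    proof (cases q)
      case (Inl v)
      show ?thesis
      proof (cases v)
        case Hub
        then show ?thesis using att Inl k_pos by (intro exI[of _ "midpoint_chips k"]) simp
      next
        case (Port j b i)
        then have "j < 3" "i < k" using q Inl by simp_all
        then show ?thesis using ready[of j] Inl Port by (auto simp: sub_ready_def)
      next
        case (Aux j b l)
        then have jl: "j < 3" "l < 6 * k" using q Inl by simp_all
        obtain d where d: "S.attainable D d" "\<And>b i. i < k \<Longrightarrow> d (Inr (Fan j b i l)) \<ge> 1"
          "l < 2 * k \<Longrightarrow> d (Inl (Aux j False l)) \<ge> 1" using conn[OF jl] by blast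
        show ?thesis using sub_aux_reached(1)[OF d jl, of b] Inl Aux by simp
      qed
    next
      case (Inr e)
      show ?thesis
      proof (cases e)
        case (Thin j i)
        then show ?thesis using att Inr by (intro exI[of _ "midpoint_chips k"]) simp
      next
        case (Spoke j l)
        then have "j < 3" "l < 2 * k" using q Inr by simp_all
        then show ?thesis using ready[of j] Inr Spoke by (auto simp: sub_ready_def)
      next
        case (Fan j b i l)
        then have "j < 3" "i < k" "l < 6 * k" using q Inr by simp_all
        then show ?thesis using conn[of j l] Inr Fan by blast
      next
        case (Link j l)
        then have jl: "j < 3" "l < 6 * k" using q Inr by simp_all
        obtain d where d: "S.attainable D d" "\<And>b i. i < k \<Longrightarrow> d (Inr (Fan j b i l)) \<ge> 1"
          "l < 2 * k \<Longrightarrow> d (Inl (Aux j False l)) \<ge> 1" using conn[OF jl] by blast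
        show ?thesis using sub_aux_reached(2)[OF d jl] Inr Link by simp
      qed
    qed
  qed
  with D sub_midpoint_degree show ?thesis by auto
qed

end

section \<open>The gonalities of the tricycle\<close>

text \<open>The hypothesis is applied to the set of vertices reachable from \<open>u\<close> in the
  symmetric closure. It trades paths for sets closed along edges, which a preimage under a
  relabelling transports easily.\<close>

lemma (in nonempty_multigraph) connectedI:
  assumes closed: "\<And>U. U \<subseteq> verts G \<Longrightarrow> U \<noteq> {} \<Longrightarrow>
    (\<And>e. e \<in> arcs G \<Longrightarrow> tail G e \<in> U \<longleftrightarrow> head G e \<in> U) \<Longrightarrow> verts G \<subseteq> U"
  shows "Digraph_Component.connected G"
proof -
  interpret S: pair_wf_digraph "mk_symmetric G" by (rule wellformed_mk_symmetric)
  have vs: "verts (with_proj (mk_symmetric G)) = verts G" by simp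
  show ?thesis
    unfolding connected_def strongly_connected_def
  proof (intro conjI ballI)
    show "verts (with_proj (mk_symmetric G)) \<noteq> {}" using verts_nonempty by simp
    fix u v assume u: "u \<in> verts (with_proj (mk_symmetric G))" and v: "v \<in> verts (with_proj (mk_symmetric G))"
    let ?U = "{w \<in> verts G. u \<rightarrow>\<^sup>*\<^bsub>with_proj (mk_symmetric G)\<^esub> w}"
    have step: "y \<in> ?U" if "x \<in> ?U" "(x, y) \<in> parcs (mk_symmetric G)" "y \<in> verts G" for x y
      using that S.reachable_adj_trans[of u x y] by simp
    have "verts G \<subseteq> ?U"
    proof (rule closed)
      have "u \<in> ?U" using u S.reachable_refl by simp
      then show "?U \<noteq> {}" by blast
      fix e assume e: "e \<in> arcs G"
      have "(tail G e, head G e) \<in> parcs (mk_symmetric G)" "(head G e, tail G e) \<in> parcs (mk_symmetric G)"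
        using e by (auto simp: parcs_mk_symmetric)
      then show "tail G e \<in> ?U \<longleftrightarrow> head G e \<in> ?U"
        using step[of "tail G e" "head G e"] step[of "head G e" "tail G e"] e by auto
    qed simp
    then show "u \<rightarrow>\<^sup>*\<^bsub>with_proj (mk_symmetric G)\<^esub> v" using v by auto
  qed
qed

lemma (in nonempty_multigraph) multigraphI: "Digraph_Component.connected G \<Longrightarrow> multigraph G"
  unfolding multigraph_def by (simp add: fin_digraph_axioms loopfree_digraph_axioms)

text \<open>Membership spreads from the hub along a spoke to an auxiliary vertex, by the fans to the
  ports and auxiliary vertices of Boolean \<open>False\<close>, and by the links and the remaining
  fans to those of Boolean \<open>True\<close>.\<close>

lemma tricycle_closed_set:
  assumes k: "0 < k" and U: "U \<noteq> {}" "U \<subseteq> verts (tricycle k)"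
    and closed: "\<And>e. e \<in> arcs (tricycle k) \<Longrightarrow> edge_tail e \<in> U \<longleftrightarrow> edge_head e \<in> U"
  shows "verts (tricycle k) \<subseteq> U"
proof -
  have aux0: "Aux j False 0 \<in> U \<longleftrightarrow> Hub \<in> U" if "j < 3" for j
    using closed[of "Spoke j 0"] that k by simp
  have portF: "Port j False i \<in> U \<longleftrightarrow> Hub \<in> U" if "j < 3" "i < k" for j i
    using closed[of "Fan j False i 0"] aux0[OF that(1)] that by simp
  have auxF: "Aux j False l \<in> U \<longleftrightarrow> Hub \<in> U" if "j < 3" "l < 6 * k" for j l
    using closed[of "Fan j False 0 l"] portF[OF that(1) k] that k by simp
  have auxT: "Aux j True l \<in> U \<longleftrightarrow> Hub \<in> U" if "j < 3" "l < 6 * k" for j l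
    using closed[of "Link j l"] auxF[OF that] that by simp
  have portT: "Port j True i \<in> U \<longleftrightarrow> Hub \<in> U" if "j < 3" "i < k" for j i
    using closed[of "Fan j True i 0"] auxT[of j 0] that by simp
  have all: "v \<in> U \<longleftrightarrow> Hub \<in> U" if v: "v \<in> verts (tricycle k)" for v
  proof (cases v)
    case (Port j b i)
    then show ?thesis using v portF portT by (cases b) auto
  next
    case (Aux j b l)
    then show ?thesis using v auxF auxT by (cases b) auto
  qed simp
  obtain w where "w \<in> U" using U(1) by blast
  then have "Hub \<in> U" using all[of w] U(2) by blast
  then show ?thesis using all by blast
qed

section \<open>The tricycle over the natural numbers\<close>

definition tricycle_nat :: "nat \<Rightarrow> (nat, nat) pre_digraph" where
  "tricycle_nat k = \<lparr> verts = to_nat ` verts (tricycle k), arcs = to_nat ` arcs (tricycle k),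
     tail = (\<lambda>e. to_nat (edge_tail (from_nat e))), head = (\<lambda>e. to_nat (edge_head (from_nat e))) \<rparr>"

lemma tricycle_nat_relabels: "relabels to_nat to_nat (tricycle k) (tricycle_nat k)"
  by (simp add: relabels_def tricycle_nat_def)

lemma tricycle_nat_ends: "edge_ends (tricycle_nat k) (to_nat e) = to_nat ` {edge_tail e, edge_head e}"
  by (simp add: edge_ends_def tricycle_nat_def)

lemma tricycle_nat_simple: "simple_multigraph (tricycle_nat k)"
  unfolding simple_multigraph_def
proof
  interpret N: nonempty_multigraph "tricycle_nat k"
    by (rule relabels_multigraph[OF tricycle_nat_relabels tricycle_multigraph])
  show "\<forall>e\<in>arcs (tricycle_nat k). tail (tricycle_nat k) e \<noteq> head (tricycle_nat k) e"
    using N.no_loops by blast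
  have inj: "e = e'" if e: "e \<in> arcs (tricycle k)" "e' \<in> arcs (tricycle k)"
    and eq: "{edge_tail e, edge_head e} = {edge_tail e', edge_head e'}" for e e'
    using e eq by (cases e; cases e') (auto simp: doubleton_eq_iff)
  show "inj_on (edge_ends (tricycle_nat k)) (arcs (tricycle_nat k))"
  proof (rule inj_onI)
    fix x y assume "x \<in> arcs (tricycle_nat k)" "y \<in> arcs (tricycle_nat k)"
      and xy: "edge_ends (tricycle_nat k) x = edge_ends (tricycle_nat k) y"
    then obtain e e' where e: "x = to_nat e" "y = to_nat e'" "e \<in> arcs (tricycle k)" "e' \<in> arcs (tricycle k)"
      by (auto simp: tricycle_nat_def)
    have "{edge_tail e, edge_head e} = {edge_tail e', edge_head e'}"
      using xy unfolding e tricycle_nat_ends by (rule inj_image_eq_iff[OF inj_to_nat, THEN iffD1])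
    then show "x = y" using inj e by simp
  qed
qed

fun black :: "vertex \<Rightarrow> bool" where
  "black Hub \<longleftrightarrow> True"
| "black (Port j b i) \<longleftrightarrow> \<not> b"
| "black (Aux j b l) \<longleftrightarrow> b"

lemma tricycle_nat_bipartite: "bipartite (tricycle_nat k)"
  unfolding bipartite_def
proof (rule exI[of _ "to_nat ` {v \<in> verts (tricycle k). black v}"],
    rule exI[of _ "to_nat ` {v \<in> verts (tricycle k). \<not> black v}"], intro conjI ballI)
  let ?B = "{v \<in> verts (tricycle k). black v}" and ?W = "{v \<in> verts (tricycle k). \<not> black v}"
  show "to_nat ` ?B \<union> to_nat ` ?W = verts (tricycle_nat k)"
    by (auto simp: tricycle_nat_def)
  show "to_nat ` ?B \<inter> to_nat ` ?W = {}" by auto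
  interpret nonempty_multigraph "tricycle k" by (rule tricycle_multigraph)
  fix x assume "x \<in> arcs (tricycle_nat k)"
  then obtain e where e: "x = to_nat e" "e \<in> arcs (tricycle k)" by (auto simp: tricycle_nat_def)
  have "edge_tail e \<in> verts (tricycle k)" "edge_head e \<in> verts (tricycle k)"
    using tail_in_verts[OF e(2)] head_in_verts[OF e(2)] by simp_all
  moreover have "black (edge_tail e) \<noteq> black (edge_head e)"
    by (cases e) simp_all
  ultimately have "edge_tail e \<in> ?B \<and> edge_head e \<in> ?W \<or> edge_head e \<in> ?B \<and> edge_tail e \<in> ?W"
    by blast
  moreover have "edge_ends (tricycle_nat k) x = {to_nat (edge_tail e), to_nat (edge_head e)}"
    "edge_ends (tricycle_nat k) x = {to_nat (edge_head e), to_nat (edge_tail e)}"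
    unfolding e(1) tricycle_nat_ends by auto
  ultimately show "\<exists>a\<in>to_nat ` ?B. \<exists>b\<in>to_nat ` ?W. edge_ends (tricycle_nat k) x = {a, b}"
    by blast
qed

theorem theorem1p4:
  fixes k :: nat
  assumes "k \<ge> 1"
  shows "\<exists>G :: (nat, nat) pre_digraph.
           multigraph G \<and>
           dgon G = 6 * k \<and>
           metric_dgon G = 5 * k \<and>
           dgon (subdivide2 G) = 5 * k \<and>
           simple_multigraph G \<and>
           bipartite G"
proof -
  interpret T: tricycle_graph k by unfold_locales (use assms in simp)
  let ?G = "tricycle_nat k" and ?\<phi> = "to_nat :: vertex \<Rightarrow> nat" and ?\<psi> = "to_nat :: edge \<Rightarrow> nat"
  note r = tricycle_nat_relabels[of k]
  interpret N: nonempty_multigraph ?G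
    by (rule relabels_multigraph[OF r tricycle_multigraph])
  interpret NS: nonempty_multigraph "subdivide2 ?G"
    by (rule N.subdivide2_multigraph)
  let ?Q = "{Port j b i | j b i. j < 3 \<and> i < k}"
  have Q: "?Q \<subseteq> verts (tricycle k)" by auto
  have "0 < (3::nat)" by simp
  with T.k_pos have "Port 0 False 0 \<in> ?Q" by blast
  then have Q': "?\<phi> ` ?Q \<noteq> {}" "?\<phi> ` ?Q \<subseteq> verts ?G"
    using Q by (blast, auto simp: tricycle_nat_def)
  have z: "?\<phi> Hub \<in> verts ?G" by (simp add: tricycle_nat_def)
  have sum: "(\<Sum>v\<in>verts (tricycle k). (d \<circ> ?\<phi>) v) = (\<Sum>v\<in>verts ?G. d v)" for d :: "nat \<Rightarrow> int"
    by (simp add: tricycle_nat_def sum.reindex[OF inj_on_subset[OF inj_to_nat]])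
  have card: "card (?\<psi> -` C) = card C" if "C \<subseteq> arcs ?G" for C
    using that by (intro card_vimage_inj inj_to_nat) (auto simp: tricycle_nat_def)
  have pull: "tricycle_cut k (d \<circ> ?\<phi>) (?\<psi> -` C)" if "N.cut_configuration (?\<phi> Hub) (?\<phi> ` ?Q) d C" for d C
    by unfold_locales (rule relabels_cut_configuration[OF r tricycle_multigraph _ Q that], simp)

  have discrete_ge: "6 * int k \<le> divisor_degree D"
    if D: "D \<in> divisors_on (verts ?G)" "N.positive_rank D" for D
  proof -
    obtain d where d: "N.cut_configuration (?\<phi> Hub) (?\<phi> ` ?Q) d {}"
      "(\<Sum>v\<in>verts ?G. d v) = divisor_degree D"
      using N.discrete_cut_configuration[OF D z Q'] by blast
    show ?thesis
      using tricycle_cut.total_bounds(2)[OF pull[OF d(1)]] d(2) by (simp only: vimage_empty sum card.empty) simp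
  qed
  have metric_ge: "5 * int k \<le> divisor_degree D"
    if D: "D \<in> divisors_on (metric_points ?G)" "N.metric.positive_rank D" for D
  proof -
    obtain d C where d: "N.cut_configuration (?\<phi> Hub) (?\<phi> ` ?Q) d C"
      "(\<Sum>v\<in>verts ?G. d v) + int (card C) \<le> divisor_degree D"
      using N.metric_cut_configuration[OF D z Q'] by blast
    have "C \<subseteq> arcs ?G" using d(1) by (simp add: N.cut_configuration_def)
    then show ?thesis
      using tricycle_cut.total_bounds(1)[OF pull[OF d(1)]] d(2) by (simp only: sum card)
  qed

  obtain D where D: "D \<in> divisors_on (verts ?G)" "N.positive_rank D" "divisor_degree D = 6 * int k"
    using T.tricycle_discrete_divisor relabels_positive_rank[OF r tricycle_finite(1) _ _ tricycle_multigraph]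
    by metis
  have dgon: "dgon ?G = 6 * k"
    unfolding N.dgon_eq by (rule N.gonality_eqI[OF D(1,2)]) (use D(3) discrete_ge in auto)

  obtain E where E: "E \<in> divisors_on (verts (subdivide2 ?G))" "NS.positive_rank E" "divisor_degree E = 5 * int k"
    using T.tricycle_subdivision_divisor
      relabels_positive_rank[OF relabels_subdivide2[OF r] T.S.finite_verts _ _ T.S.nonempty_multigraph_axioms]
    by metis
  have sub_ge: "5 * int k \<le> divisor_degree D'"
    if "D' \<in> divisors_on (verts (subdivide2 ?G))" "NS.positive_rank D'" for D'
    using N.metric_positive_rank_of_subdivision[OF that] metric_ge by force
  have sub: "dgon (subdivide2 ?G) = 5 * k"
    unfolding NS.dgon_eq by (rule NS.gonality_eqI[OF E(1,2)]) (use E(3) sub_ge in auto)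

  obtain E' where E': "E' \<in> divisors_on (metric_points ?G)" "N.metric.positive_rank E'"
    "divisor_degree E' = 5 * int k"
    using N.metric_positive_rank_of_subdivision[OF E(1,2)] E(3) by auto
  have metric: "metric_dgon ?G = 5 * k"
    unfolding N.metric_dgon_eq by (rule N.metric.gonality_eqI[OF E'(1,2)]) (use E'(3) metric_ge in auto)

  have "Digraph_Component.connected ?G"
  proof (rule N.connectedI)
    fix U assume U: "U \<subseteq> verts ?G" "U \<noteq> {}"
      and closed: "\<And>e. e \<in> arcs ?G \<Longrightarrow> tail ?G e \<in> U \<longleftrightarrow> head ?G e \<in> U"
    have "verts (tricycle k) \<subseteq> ?\<phi> -` U"
    proof (rule tricycle_closed_set[OF T.k_pos])
      show "?\<phi> -` U \<noteq> {}" "?\<phi> -` U \<subseteq> verts (tricycle k)"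
        using U by (auto simp: tricycle_nat_def)
      show "edge_tail e \<in> ?\<phi> -` U \<longleftrightarrow> edge_head e \<in> ?\<phi> -` U" if "e \<in> arcs (tricycle k)" for e
        using closed[of "?\<psi> e"] that by (simp add: tricycle_nat_def)
    qed
    then show "verts ?G \<subseteq> U" by (auto simp: tricycle_nat_def)
  qed
  then have "multigraph ?G" by (rule N.multigraphI)
  with dgon metric sub tricycle_nat_simple tricycle_nat_bipartite show ?thesis by blast
qed

end
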